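(* Let $m>1$, $n>1$ and $p\ge 1$ be integers with $p\mid m$, and let $\ell$ be a prime divisor of the order of $G(m,p,n)$. Let the base-$\ell$ expression of $n$ be $(b_kb_{k-1}\dots b_1b_0)_\ell$. (i) If $\ell\mid p$, then the $\ell$-Sylow classes of reflection subgroups of $G(m,p,n)$ are the $G(m,p,n)$-conjugacy classes of the subgroups $\hat\theta_\alpha\, G(\ell^{\nu_\ell(m)},\ell^{\nu_\ell(p)},n)\,\hat\theta_\alpha^{-1}$, where $\alpha\in\left\{e^{2\pi i j/m} \;\middle|\; 0\le j\le \gcd\!\left(\frac{p}{\ell^{\nu_\ell(p)}},\,n\right)-1\right\}$. (ii) If $\ell\nmid p$, then there is a unique $\ell$-Sylow class of reflection subgroups of $G(m,p,n)$, namely the $G(m,p,n)$-conjugacy class of $\prod_{i=0}^{k}G(\ell^{\nu_\ell(m)},1,\ell^i)^{b_i}$.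
   Context: A complex reflection of a complex vector space $V$ is a linear transformation of $V$ of finite order whose fixed space is a hyperplane; a unitary reflection group on $V$ is a finite subgroup of $GL(V)$ generated by complex reflections. A reflection subgroup of a unitary reflection group $G$ is a subgroup generated by reflections. For a prime $\ell$ dividing $|G|$, an $\ell$-Sylow class of reflection subgroups of $G$ is a $G$-conjugacy class consisting of reflection subgroups of $G$ that are minimal with respect to inclusion (among reflection subgroups of $G$) subject to containing an $\ell$-Sylow subgroup of $G$. The group $G(m,p,n)$: let $V$ be an $n$-dimensional complex vector space with orthonormal basis $e_1,\dots,e_n$, let $\mu_m$ be the group of $m$th roots of unity in $\mathbb{C}$, and let $p\mid m$. For $\theta:\{1,\dots,n\}\to\mu_m$ let $\hat\theta$ be the linear transformation with $\hat\theta(e_i)=\theta(i)e_i$. Let $A(m,p,n)$ be the group of all $\hat\theta$ with $\prod_{i=1}^n\theta(i)^{m/p}=1$. Let $\pi\in\mathrm{Sym}(n)$ act on $V$ by $\pi(e_i)=e_{\pi(i)}$. Then $G(m,p,n)=A(m,p,n)\rtimes\mathrm{Sym}(n)$, a unitary reflection group on $V$ of order $m^n n!/p$. When $p'\mid m'$, $m'\mid m$ and $\frac{m'}{p'}\mid\frac{m}{p}$, the group $G(m',p',n)$ defined using the same basis is a reflection subgroup of $G(m,p,n)$. For $\alpha\in\mu_m$, $\hat\theta_\alpha$ is the linear transformation with $\hat\theta_\alpha(e_1)=\alpha e_1$ and $\hat\theta_\alpha(e_i)=e_i$ for $i>1$. $\nu_\ell(r)=\max\{v\in\{0,1,2,\dots\}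 : \ell^v\mid r\}$ is the $\ell$-adic valuation of a positive integer $r$. Base-$\ell$ expression: $n=\sum_{i=0}^k b_i\ell^i$ with $0\le b_i<\ell$ and $b_k\ne 0$. The product $\prod_{i=0}^{k}G(\ell^{\nu_\ell(m)},1,\ell^i)^{b_i}$ denotes the following subgroup of $G(m,p,n)$: partition the basis $\{e_1,\dots,e_n\}$ into subsets, exactly $b_i$ of them of size $\ell^i$ for each $0\le i\le k$, and let each factor $G(\ell^{\nu_\ell(m)},1,\ell^i)$ act on the span of the corresponding subset as the group generated by all permutations of the basis vectors in that subset together with all linear transformations multiplying each basis vector in that subset by an $\ell^{\nu_\ell(m)}$th root of unity, and trivially on the other basis vectors. *)

theory Defs
  imports
    "HOL-Analysis.Analysis"
    "HOL-Algebra.Coset"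
    "HOL-Algebra.Generated_Groups"
    "HOL-Library.Disjoint_Sets"
begin

text \<open>
  The \<open>n\<close>-dimensional space \<open>V\<close> is \<open>complex ^ 'n\<close> with \<open>n = CARD('n)\<close>, and the orthonormal basis
  is the standard one, \<open>e\<^sub>i = axis i 1\<close>.  Complex linearity is linearity with respect to the scalar
  multiplication \<open>*s\<close> of \<open>complex ^ 'n\<close> (the plain \<open>linear\<close> is real linearity), and
  \<open>vec.dim\<close> is the complex dimension.
\<close>

definition GL :: "(complex ^ 'n \<Rightarrow> complex ^ 'n) monoid" where
  "GL = \<lparr>carrier = {f. Vector_Spaces.linear (*s) (*s) f \<and> bij f}, mult = (\<circ>), one = id\<rparr>"


section \<open>Reflections and Sylow classes of reflection subgroups\<close>

definition complex_reflection :: "(complex ^ 'n \<Rightarrow> complex ^ 'n) \<Rightarrow> bool" where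
  "complex_reflection f \<longleftrightarrow>
     Vector_Spaces.linear (*s) (*s) f \<and>
     (\<exists>k>0. f ^^ k = id) \<and>
     vec.dim {v. f v = v} + 1 = CARD('n)"

definition reflection_subgroup ::
    "(complex ^ 'n \<Rightarrow> complex ^ 'n) set \<Rightarrow> (complex ^ 'n \<Rightarrow> complex ^ 'n) set \<Rightarrow> bool" where
  "reflection_subgroup G H \<longleftrightarrow>
     subgroup H GL \<and> H \<subseteq> G \<and> (\<exists>S. (\<forall>f\<in>S. complex_reflection f) \<and> H = generate GL S)"

definition sylow_subgroup ::
    "nat \<Rightarrow> (complex ^ 'n \<Rightarrow> complex ^ 'n) set \<Rightarrow> (complex ^ 'n \<Rightarrow> complex ^ 'n) set \<Rightarrow> bool" where
  "sylow_subgroup l G P \<longleftrightarrow>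
     subgroup P GL \<and> P \<subseteq> G \<and> finite P \<and> card P = l ^ multiplicity l (card G)"

definition contains_sylow ::
    "nat \<Rightarrow> (complex ^ 'n \<Rightarrow> complex ^ 'n) set \<Rightarrow> (complex ^ 'n \<Rightarrow> complex ^ 'n) set \<Rightarrow> bool" where
  "contains_sylow l G H \<longleftrightarrow> (\<exists>P. sylow_subgroup l G P \<and> P \<subseteq> H)"

definition minimal_sylow_reflection_subgroup ::
    "nat \<Rightarrow> (complex ^ 'n \<Rightarrow> complex ^ 'n) set \<Rightarrow> (complex ^ 'n \<Rightarrow> complex ^ 'n) set \<Rightarrow> bool" where
  "minimal_sylow_reflection_subgroup l G H \<longleftrightarrow>
     reflection_subgroup G H \<and> contains_sylow l G H \<and>
     (\<forall>K. reflection_subgroup G K \<and> contains_sylow l G K \<and> K \<subseteq> H \<longrightarrow> K = H)"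

definition conjugate_subgroup ::
    "(complex ^ 'n \<Rightarrow> complex ^ 'n) \<Rightarrow> (complex ^ 'n \<Rightarrow> complex ^ 'n) set
      \<Rightarrow> (complex ^ 'n \<Rightarrow> complex ^ 'n) set" where
  "conjugate_subgroup g H = g <#\<^bsub>GL\<^esub> H #>\<^bsub>GL\<^esub> inv\<^bsub>GL\<^esub> g"

definition conjugacy_class ::
    "(complex ^ 'n \<Rightarrow> complex ^ 'n) set \<Rightarrow> (complex ^ 'n \<Rightarrow> complex ^ 'n) set
      \<Rightarrow> (complex ^ 'n \<Rightarrow> complex ^ 'n) set set" where
  "conjugacy_class G H = {conjugate_subgroup g H | g. g \<in> G}"

definition sylow_reflection_classes ::
    "nat \<Rightarrow> (complex ^ 'n \<Rightarrow> complex ^ 'n) set \<Rightarrow> (complex ^ 'n \<Rightarrow> complex ^ 'n) set set set" where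
  "sylow_reflection_classes l G =
     {C. (\<exists>H. reflection_subgroup G H \<and> C = conjugacy_class G H) \<and>
         (\<forall>H\<in>C. minimal_sylow_reflection_subgroup l G H)}"


section \<open>The groups \<open>G(m,p,n)\<close>\<close>

definition diag_map :: "('n \<Rightarrow> complex) \<Rightarrow> complex ^ 'n \<Rightarrow> complex ^ 'n" where
  "diag_map \<theta> v = (\<Sum>i\<in>UNIV. (v $ i) *s (\<theta> i *s axis i 1))"

definition perm_map :: "('n \<Rightarrow> 'n) \<Rightarrow> complex ^ 'n \<Rightarrow> complex ^ 'n" where
  "perm_map \<pi> v = (\<Sum>i\<in>UNIV. (v $ i) *s axis (\<pi> i) 1)"

definition A_group :: "nat \<Rightarrow> nat \<Rightarrow> (complex ^ 'n \<Rightarrow> complex ^ 'n) set" where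
  "A_group m p =
     {diag_map \<theta> | \<theta>. (\<forall>i. \<theta> i ^ m = 1) \<and> (\<Prod>i\<in>UNIV. \<theta> i ^ (m div p)) = 1}"

text \<open>The rank \<open>n = CARD('n)\<close> of \<open>G(m,p,n)\<close> is carried by the type.\<close>

definition G_group :: "nat \<Rightarrow> nat \<Rightarrow> (complex ^ 'n \<Rightarrow> complex ^ 'n) set" where
  "G_group m p = A_group m p <#>\<^bsub>GL\<^esub> {perm_map \<pi> | \<pi>. \<pi> permutes UNIV}"


section \<open>The products \<open>\<Prod> G(q,1,l\<^sup>i)\<^bsup>b\<^sub>i\<^esup>\<close>\<close>

text \<open>\<open>block_group q B\<close> is \<open>G(q,1,|B|)\<close> acting on the span of \<open>{e\<^sub>i | i \<in> B}\<close> and fixing the other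
  basis vectors.\<close>

definition block_group :: "nat \<Rightarrow> 'n set \<Rightarrow> (complex ^ 'n \<Rightarrow> complex ^ 'n) set" where
  "block_group q B = generate GL
     ({perm_map \<pi> | \<pi>. \<pi> permutes B} \<union>
      {diag_map \<theta> | \<theta>. (\<forall>i\<in>B. \<theta> i ^ q = 1) \<and> (\<forall>i. i \<notin> B \<longrightarrow> \<theta> i = 1)})"

text \<open>For distinct blocks of a partition the factors commute and meet trivially, so the subgroup they
  generate is their internal direct product.\<close>

definition block_product :: "nat \<Rightarrow> 'n set set \<Rightarrow> (complex ^ 'n \<Rightarrow> complex ^ 'n) set" where
  "block_product q P = generate GL (\<Union>B\<in>P. block_group q B)"

text \<open>When \<open>\<Sum>i\<le>k. b i * l ^ i\<close> is the cardinality of the set \<open>A\<close> and \<open>l > 1\<close>, counting shows that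
  there are no blocks besides those required here.\<close>

definition block_partition :: "nat \<Rightarrow> nat \<Rightarrow> (nat \<Rightarrow> nat) \<Rightarrow> 'a set \<Rightarrow> 'a set set \<Rightarrow> bool" where
  "block_partition l k b A P \<longleftrightarrow>
     partition_on A P \<and> (\<forall>i\<le>k. card {B \<in> P. card B = l ^ i} = b i)"

lemma partition_with_block_sizes:
  fixes A :: "'a set"
  assumes "finite A" "card A = sum_list xs" "\<forall>x\<in>set xs. x > 0"
  shows "\<exists>P. partition_on A P \<and> (\<forall>x. card {B \<in> P. card B = x} = count_list xs x)"
  using assms
proof (induction xs arbitrary: A)
  case Nil
  then show ?case
    by (intro exI[of _ "{}"]) (auto simp: partition_on_def)
next
  case (Cons y xs)
  obtain B where B: "B \<subseteq> A" "card B = y"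
    using obtain_subset_with_card_n[of y A] Cons.prems by auto
  have fB: "finite B" "B \<noteq> {}"
    using B Cons.prems finite_subset by auto
  have "card (A - B) = sum_list xs"
    using B Cons.prems fB by (simp add: card_Diff_subset)
  then obtain P where P: "partition_on (A - B) P"
      "\<forall>x. card {B \<in> P. card B = x} = count_list xs x"
    using Cons.IH[of "A - B"] Cons.prems by auto
  have notin: "B \<notin> P"
    using P(1) fB(2) by (auto simp: partition_on_def)
  have finP: "finite P"
    using P(1) Cons.prems(1) finite_elements by blast
  have "partition_on A (insert B P)"
    using partition_on_insert[of B P A] P(1) B(1) fB(2) partition_onD1[OF P(1)]
    by (auto simp: disjnt_def)
  moreover have "card {C \<in> insert B P. card C = x} = count_list (y # xs) x" for x
  proof (cases "x = y")
    case True
    then have "{C \<in> insert B P. card C = x} = insert B {C \<in> P. card C = x}"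
      using B by auto
    then show ?thesis
      using P(2) notin finP True by simp
  next
    case False
    then have "{C \<in> insert B P. card C = x} = {C \<in> P. card C = x}"
      using B by auto
    then show ?thesis
      using P(2) False by simp
  qed
  ultimately show ?case by blast
qed

lemma block_partition_exists:
  assumes "finite A" "l > 1" "card A = (\<Sum>i\<le>k. b i * l ^ i)"
  shows "\<exists>P. block_partition l k b A P"
proof -
  define f where "f j = concat (map (\<lambda>i. replicate (b i) (l ^ i)) [0..<j])" for j
  have sum: "sum_list (f j) = (\<Sum>i<j. b i * l ^ i)" for j
    by (induction j) (auto simp: f_def sum_list_replicate)
  have rep: "count_list (replicate r (x::nat)) y = (if x = y then r else 0)" for r x y
    by (induction r) auto
  have count: "count_list (f j) (l ^ i) = (if i < j then b i else 0)" for i j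
    using assms(2) by (induction j) (auto simp: f_def rep less_Suc_eq)
  have "\<forall>x\<in>set (f (Suc k)). x > 0"
    using assms(2) by (auto simp: f_def)
  moreover have "card A = sum_list (f (Suc k))"
    using assms(3) sum by (simp add: lessThan_Suc_atMost)
  ultimately obtain P where "partition_on A P"
      "\<forall>x. card {B \<in> P. card B = x} = count_list (f (Suc k)) x"
    using partition_with_block_sizes[OF assms(1)] by metis
  then show ?thesis
    using count by (auto simp: block_partition_def)
qed

end

theory Submission
  imports Defs "HOL-Algebra.Sylow" "HOL-Algebra.SndIsomorphismGrp" "HOL-Number_Theory.Cong"
begin

text \<open>
  Let \<open>K\<close> be a reflection subgroup of \<open>G(m,p,n)\<close> containing a Sylow \<open>l\<close>-subgroup.  The diagonal
  \<open>l\<close>-elements of \<open>G(m,p,n)\<close> form a normal \<open>l\<close>-subgroup, so \<open>K\<close> contains all of them.  The non-diagonal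
  reflections in \<open>K\<close> cut the basis into components, and after conjugating by a diagonal map \<open>K\<close> contains
  every permutation matrix preserving the components.  If \<open>l\<close> divides \<open>p\<close>, comparing orders of
  determinants shows that there is one component.  Otherwise, by Lagrange, the product of the factorials of the
  component sizes has the same \<open>l\<close>-part as \<open>n!\<close>; by Legendre's formula no carries occur when the sizes
  are added in base \<open>l\<close>, so the components can be subdivided into blocks as in the base-\<open>l\<close> expression
  of \<open>n\<close>.  Either way \<open>K\<close> contains a conjugate of one of the asserted groups; since these all have
  the same order and contain a Sylow \<open>l\<close>-subgroup, they are exactly the minimal ones.
\<close>


section \<open>Digit sums\<close>

text \<open>The diagonal conjugator \<open>D\<close> extracted from \<open>K\<close> has m-th roots
  of unity as entries, so it lies in G(m,1,n) but in general not in G(m,p,n), whereas the classes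
  are taken under G(m,p,n). The obstacle is the determinant of \<open>D\<close>, which must become a
  p-th power of an m-th root of unity. \<open>D\<close> may be altered by diagonal maps normalising
  the asserted group: entries of l-power order, and factors constant on its blocks. If l divides p
  there is one block, of size n, and with p' the l-free part of p these changes leave a cyclic
  quotient of order gcd(p',n); its representatives are the \<alpha> of the theorem. If l does not
  divide p, some block has size prime to p, and scaling it corrects any determinant, so a single
  class remains.\<close>

function digit_sum :: "nat \<Rightarrow> nat \<Rightarrow> nat" where
  "digit_sum l n = (if l \<le> 1 \<or> n = 0 then n else n mod l + digit_sum l (n div l))"
  by auto
termination
  by (relation "Wellfounded.measure snd") auto

declare digit_sum.simps [simp del]

lemma digit_sum_0 [simp]: "digit_sum l 0 = 0"
  by (simp add: digit_sum.simps)

lemma digit_sum_rec: "l > 1 \<Longrightarrow> digit_sum l n = n mod l + digit_sum l (n div l)"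
  by (cases "n = 0") (simp_all add: digit_sum.simps[of l n])

lemma digit_sum_add_mult:
  "l > 1 \<Longrightarrow> r < l \<Longrightarrow> digit_sum l (r + l * q) = r + digit_sum l q"
  by (subst digit_sum_rec) simp_all

lemma digit_sum_power [simp]: "l > 1 \<Longrightarrow> digit_sum l (l ^ i) = 1"
proof (induction i)
  case 0
  then show ?case
    using digit_sum_add_mult[of l 1 0] by simp
next
  case (Suc i)
  then show ?case
    using digit_sum_add_mult[of l 0 "l ^ i"] by simp
qed

lemma digit_sum_sum:
  assumes "l > 1" "\<forall>i\<le>k. b i < l"
  shows "digit_sum l (\<Sum>i\<le>k. b i * l ^ i) = (\<Sum>i\<le>k. b i)"
  using assms(2)
proof (induction k arbitrary: b)
  case 0
  then show ?case
    using digit_sum_add_mult[of l "b 0" 0] assms(1) by simp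
next
  case (Suc k)
  have "(\<Sum>i\<le>Suc k. b i * l ^ i) = b 0 + l * (\<Sum>i\<le>k. b (Suc i) * l ^ i)"
    by (simp only: sum.atMost_Suc_shift sum_distrib_left) (simp add: mult.left_commute)
  then show ?case
    using digit_sum_add_mult[of l "b 0"] assms(1) Suc.prems Suc.IH[of "\<lambda>i. b (Suc i)"]
    by (simp add: sum.atMost_Suc_shift del: sum.atMost_Suc)
qed

text \<open>Adding one turns each trailing digit \<open>l - 1\<close> into 0 and raises the next
  digit by one. The number of these trailing digits is the multiplicity of \<open>l\<close> in
  \<open>Suc n\<close>.\<close>

lemma digit_sum_Suc:
  assumes "prime l"
  shows "(l - 1) * multiplicity l (Suc n) + digit_sum l (Suc n) = Suc (digit_sum l n)"
proof (induction n rule: less_induct)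
  case (less n)
  have l: "l > 1"
    using assms prime_gt_1_nat by blast
  show ?case
  proof (cases "l dvd Suc n")
    case False
    then have "Suc n mod l = Suc (n mod l)" "Suc n div l = n div l"
      by (simp_all add: mod_Suc div_Suc dvd_eq_mod_eq_0 split: if_splits)
    with False l show ?thesis
      by (simp add: not_dvd_imp_multiplicity_0 digit_sum_rec[of l n] digit_sum_rec[of l "Suc n"])
  next
    case True
    then obtain q where q: "Suc n = l * q"
      by blast
    then obtain r where r: "q = Suc r"
      by (cases q) auto
    \<comment> \<open>Subtracting one from \<open>l * q\<close> borrows: the last digit of
      \<open>n\<close> is \<open>l - 1\<close> and the other digits are those of
      \<open>r = q - 1\<close>, so the claim descends to \<open>r\<close>.\<close>
    have n: "n = (l - 1) + l * r"
      using q r l by simp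
    have "r \<le> l * r"
      using l by simp
    then have rn: "r < n"
      using n l by linarith
    have "multiplicity l (Suc n) = Suc (multiplicity l q)"
      unfolding q using l r by (subst multiplicity_times_same) auto
    moreover have "digit_sum l (Suc n) = digit_sum l q"
      unfolding q using digit_sum_add_mult[of l 0 q] l by simp
    moreover have "digit_sum l n = (l - 1) + digit_sum l r"
      unfolding n using digit_sum_add_mult[of l "l - 1" r] l by simp
    ultimately show ?thesis
      using less[OF rn] r by simp
  qed
qed

text \<open>Legendre's formula, by telescoping the preceding identity over the factors of
  \<open>n!\<close>. It is written additively because subtraction on naturals truncates.\<close>

lemma legendre_digit_sum:
  assumes "prime l"
  shows "(l - 1) * multiplicity l (fact n :: nat) + digit_sum l n = n"
proof (induction n)
  case (Suc n)
  have "multiplicity l (fact (Suc n) :: nat) = multiplicity l (Suc n) + multiplicity l (fact n :: nat)"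
    using assms by (subst fact_Suc, subst prime_elem_multiplicity_mult_distrib) auto
  then show ?case
    using Suc digit_sum_Suc[OF assms, of n] by (simp add: algebra_simps)
qed simp

text \<open>Trading \<open>l\<close> copies of one power for a single copy of the next shortens the
  sum by \<open>l - 1\<close>, so only the digit expansion has as few terms.\<close>

lemma base_expansion_minimal:
  fixes l :: nat
  assumes "l > 1" "\<forall>i\<le>k. b i < l" "(\<Sum>i\<le>k. c i * l ^ i) = (\<Sum>i\<le>k. b i * l ^ i)"
    "(\<Sum>i\<le>k. c i) \<le> (\<Sum>i\<le>k. b i)"
  shows "\<forall>i\<le>k. c i = b i"
  using assms(2-)
proof (induction k arbitrary: b c)
  case 0
  then show ?case by simp
next
  case (Suc k)
  have exp: "(\<Sum>i\<le>Suc k. f i * l ^ i) = f 0 + l * (\<Sum>i\<le>k. f (Suc i) * l ^ i)" for f :: "nat \<Rightarrow> nat"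
    by (simp only: sum.atMost_Suc_shift sum_distrib_left) (simp add: mult.left_commute)
  define t where "t = c 0 div l"
  have b0: "b 0 < l"
    using Suc.prems by simp
  have eq: "c 0 + l * (\<Sum>i\<le>k. c (Suc i) * l ^ i) = b 0 + l * (\<Sum>i\<le>k. b (Suc i) * l ^ i)"
    using Suc.prems(2) unfolding exp .
  have "c 0 mod l = b 0"
    using arg_cong[OF eq, of "\<lambda>x. x mod l"] b0 by simp
  then have c0: "c 0 = b 0 + l * t"
    unfolding t_def by (metis add.commute mult_div_mod_eq)
  \<comment> \<open>Carry: \<open>c 0\<close> exceeds \<open>b 0\<close> by \<open>l * t\<close>,
    which becomes \<open>t\<close> additional units at the next power.\<close>
  define c' where "c' i = c (Suc i) + (if i = 0 then t else 0)" for i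
  have "l * (t + (\<Sum>i\<le>k. c (Suc i) * l ^ i)) = l * (\<Sum>i\<le>k. b (Suc i) * l ^ i)"
    using eq c0 by (simp add: algebra_simps)
  then have "t + (\<Sum>i\<le>k. c (Suc i) * l ^ i) = (\<Sum>i\<le>k. b (Suc i) * l ^ i)"
    using assms(1) by simp
  moreover have "(\<Sum>i\<le>k. c' i * l ^ i) = t + (\<Sum>i\<le>k. c (Suc i) * l ^ i)"
    by (simp add: c'_def add_mult_distrib sum.distrib if_distrib[of "\<lambda>x. x * _"] cong: if_cong)
  moreover have sc': "(\<Sum>i\<le>k. c' i) = t + (\<Sum>i\<le>k. c (Suc i))"
    by (simp add: c'_def sum.distrib)
  moreover have le: "l * t + (\<Sum>i\<le>k. c (Suc i)) \<le> (\<Sum>i\<le>k. b (Suc i))"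
    using Suc.prems(3) c0 by (simp add: sum.atMost_Suc_shift del: sum.atMost_Suc)
  moreover have "t \<le> l * t"
    using assms(1) by simp
  ultimately have IH: "\<forall>i\<le>k. c' i = b (Suc i)"
    using Suc.prems(1) by (intro Suc.IH) (simp, simp, linarith)
  then have "(\<Sum>i\<le>k. c' i) = (\<Sum>i\<le>k. b (Suc i))"
    by simp
  \<comment> \<open>The induction hypothesis fixes the length after the carry, while the assumed
    bound counts \<open>l * t\<close> terms where only \<open>t\<close> remain; hence nothing was
    carried.\<close>
  then have "l * t \<le> t"
    using sc' le by linarith
  then have "t = 0"
    using assms(1) mult_le_cancel2[of l t 1] by auto
  show ?case
  proof (intro allI impI)
    fix i assume "i \<le> Suc k"
    then show "c i = b i"
      using IH c0 \<open>t = 0\<close> by (cases i) (auto simp: c'_def)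
  qed
qed


section \<open>Permutations preserving a labelling\<close>

text \<open>A Young subgroup, given by a labelling instead of a partition: components, blocks, the
  full symmetric group (constant label) and the trivial group (\<open>id\<close>) are all
  instances.\<close>

definition label_perms :: "('a \<Rightarrow> 'r) \<Rightarrow> 'a set \<Rightarrow> ('a \<Rightarrow> 'a) set" where
  "label_perms c A = {\<pi>. \<pi> permutes A \<and> (\<forall>i. c (\<pi> i) = c i)}"

text \<open>Coset decomposition by the image of \<open>a\<close>: following \<open>\<pi>\<close> by
  the transposition of \<open>a\<close> and \<open>\<pi> a\<close> fixes \<open>a\<close> and, as
  these points share a label, still preserves labels.\<close>

lemma label_perms_insert:
  assumes "a \<notin> A"
  shows "label_perms c (insert a A) =
    (\<lambda>(b, \<pi>). Transposition.transpose a b \<circ> \<pi>) ` ({b \<in> insert a A. c b = c a} \<times> label_perms c A)" (is "_ = ?h ` ?D")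
proof (intro equalityI subsetI)
  fix \<pi> assume \<pi>: "\<pi> \<in> label_perms c (insert a A)"
  then have "Transposition.transpose a (\<pi> a) \<circ> \<pi> permutes A"
    by (auto simp: label_perms_def intro: permutes_insert_lemma)
  moreover have "c ((Transposition.transpose a (\<pi> a) \<circ> \<pi>) i) = c i" for i
    using \<pi> by (auto simp: label_perms_def Transposition.transpose_def) metis
  moreover have "\<pi> a \<in> insert a A" "c (\<pi> a) = c a"
    using \<pi> permutes_in_image[of \<pi> "insert a A" a] by (auto simp: label_perms_def)
  moreover have "\<pi> = ?h (\<pi> a, Transposition.transpose a (\<pi> a) \<circ> \<pi>)"
    by (simp flip: comp_assoc)
  ultimately show "\<pi> \<in> ?h ` ?D"
    unfolding label_perms_def by blast
next
  fix \<pi> assume "\<pi> \<in> ?h ` ?D"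
  then obtain b \<rho> where b: "b \<in> insert a A" "c b = c a" "\<rho> \<in> label_perms c A" "\<pi> = Transposition.transpose a b \<circ> \<rho>"
    by auto
  then have "\<pi> permutes insert a A"
    by (auto simp: label_perms_def intro!: permutes_compose permutes_swap_id intro: permutes_subset)
  moreover have "c (\<pi> i) = c i" for i
    using b by (auto simp: label_perms_def Transposition.transpose_def)
  ultimately show "\<pi> \<in> label_perms c (insert a A)"
    by (simp add: label_perms_def)
qed

lemma finite_label_perms [simp]: "finite A \<Longrightarrow> finite (label_perms c A)"
  unfolding label_perms_def by (rule finite_subset[OF _ finite_permutations[of A]]) auto

text \<open>By the coset decomposition, inserting \<open>a\<close> multiplies the count by the new
  size of its class. \<open>R\<close> may contain labels that do not occur, each contributing
  \<open>fact 0 = 1\<close>.\<close>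

lemma card_label_perms:
  assumes "finite A" "finite R" "c ` A \<subseteq> R"
  shows "card (label_perms c A) = (\<Prod>r\<in>R. fact (card {i \<in> A. c i = r}))"
  using assms
proof (induction A rule: finite_induct)
  case empty
  then show ?case
    by (simp add: label_perms_def cong: conj_cong)
next
  case (insert a A)
  let ?h = "\<lambda>(b, \<pi>). Transposition.transpose a b \<circ> \<pi>"
  let ?D = "{b \<in> insert a A. c b = c a} \<times> label_perms c A"
  have "inj_on ?h ?D"
  proof (rule inj_onI, clarify)
    fix b \<pi> b' \<pi>'
    assume *: "\<pi> \<in> label_perms c A" "\<pi>' \<in> label_perms c A" "Transposition.transpose a b \<circ> \<pi> = Transposition.transpose a b' \<circ> \<pi>'"
    have "\<pi> a = a" "\<pi>' a = a"
      using *(1,2) insert.hyps by (auto simp: label_perms_def permutes_not_in)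
    then have "b = b'"
      using fun_cong[OF *(3), of a] by simp
    moreover have "\<pi> = Transposition.transpose a b \<circ> (Transposition.transpose a b' \<circ> \<pi>')"
      unfolding *(3)[symmetric] by (simp flip: comp_assoc)
    ultimately show "b = b' \<and> \<pi> = \<pi>'"
      by (simp flip: comp_assoc)
  qed
  then have "card (label_perms c (insert a A)) = card {b \<in> insert a A. c b = c a} * card (label_perms c A)"
    unfolding label_perms_insert[OF insert.hyps(2)] by (simp add: card_image card_cartesian_product)
  also have "{b \<in> insert a A. c b = c a} = insert a {b \<in> A. c b = c a}"
    by auto
  also have "card \<dots> = Suc (card {b \<in> A. c b = c a})"
    using insert.hyps by simp
  also have "card (label_perms c A) = (\<Prod>r\<in>R. fact (card {i \<in> A. c i = r}))"
    using insert by auto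
  also have "\<dots> = fact (card {i \<in> A. c i = c a}) * (\<Prod>r\<in>R - {c a}. fact (card {i \<in> A. c i = r}))"
    using insert.prems by (intro prod.remove) auto
  also have "(\<Prod>r\<in>R - {c a}. fact (card {i \<in> A. c i = r})) =
      (\<Prod>r\<in>R - {c a}. fact (card {i \<in> insert a A. c i = r}) :: nat)"
    by (intro prod.cong refl arg_cong[where f = fact] arg_cong[where f = card]) auto
  also have "Suc (card {b \<in> A. c b = c a}) * (fact (card {i \<in> A. c i = c a}) * \<dots>) =
      fact (Suc (card {b \<in> A. c b = c a})) * \<dots>"
    by (simp only: fact_Suc of_nat_id mult.assoc)
  also have "Suc (card {b \<in> A. c b = c a}) = card {i \<in> insert a A. c i = c a}"
    using insert.hyps \<open>{b \<in> insert a A. c b = c a} = _\<close> by simp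
  also have "fact (card {i \<in> insert a A. c i = c a}) *
      (\<Prod>r\<in>R - {c a}. fact (card {i \<in> insert a A. c i = r})) =
      (\<Prod>r\<in>R. fact (card {i \<in> insert a A. c i = r}) :: nat)"
    using insert.prems by (intro prod.remove[symmetric]) auto
  finally show ?case .
qed

text \<open>Legendre's formula summed over the classes. The l-part of a Young subgroup is large when
  the total digit sum of the class sizes is small; the least value,
  \<open>digit_sum l (card A)\<close>, means addition without carries.\<close>

lemma multiplicity_card_label_perms:
  fixes A :: "'a set"
  assumes "prime l" "finite A" "finite R" "c ` A \<subseteq> R"
  shows "(l - 1) * multiplicity l (card (label_perms c A)) +
    (\<Sum>r\<in>R. digit_sum l (card {i \<in> A. c i = r})) = card A"
proof -
  have "multiplicity l (card (label_perms c A)) =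
      (\<Sum>r\<in>R. multiplicity l (fact (card {i \<in> A. c i = r}) :: nat))"
    unfolding card_label_perms[OF assms(2-)]
    using assms by (subst prime_elem_multiplicity_prod_distrib) auto
  then have "(l - 1) * multiplicity l (card (label_perms c A)) +
      (\<Sum>r\<in>R. digit_sum l (card {i \<in> A. c i = r})) = (\<Sum>r\<in>R. card {i \<in> A. c i = r})"
    by (simp only: sum_distrib_left legendre_digit_sum[OF assms(1)] flip: sum.distrib)
  also have "\<dots> = card A"
    using sum.group[OF assms(2,3,4), of "\<lambda>_. 1 :: nat"] by simp
  finally show ?thesis .
qed


section \<open>Partitions into blocks of prime power size\<close>

text \<open>Reads a partition as a labelling. Outside the union of \<open>P\<close> the value is
  unspecified, but permutations of that union fix those points.\<close>

definition block_of :: "'a set set \<Rightarrow> 'a \<Rightarrow> 'a set" where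
  "block_of P i = (THE B. B \<in> P \<and> i \<in> B)"

lemma block_of_eq:
  assumes "partition_on A P" "B \<in> P" "i \<in> B"
  shows "block_of P i = B"
  unfolding block_of_def
proof (rule the_equality)
  fix C assume "C \<in> P \<and> i \<in> C"
  then show "C = B"
    using partition_onD2[OF assms(1)] assms(2,3) by (auto simp: disjoint_def)
qed (use assms in auto)

lemma block_of_in:
  assumes "partition_on A P" "i \<in> A"
  shows "block_of P i \<in> P" "i \<in> block_of P i"
proof -
  obtain B where "B \<in> P" "i \<in> B"
    using assms by (auto simp: partition_on_def)
  then show "block_of P i \<in> P" "i \<in> block_of P i"
    using block_of_eq[OF assms(1)] by auto
qed

lemma exists_powers_list:
  assumes "l > 1"
  shows "\<exists>xs. sum_list xs = n \<and> length xs = digit_sum l n \<and> (\<forall>x\<in>set xs. \<exists>i. x = l ^ i)"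
proof (induction n rule: less_induct)
  case (less n)
  show ?case
  proof (cases "n = 0")
    case False
    then obtain xs where xs: "sum_list xs = n div l" "length xs = digit_sum l (n div l)"
        "\<forall>x\<in>set xs. \<exists>i. x = l ^ i"
      using less[of "n div l"] assms by auto
    let ?ys = "replicate (n mod l) 1 @ map ((*) l) xs"
    have "sum_list ?ys = n"
      using xs(1) by (simp add: sum_list_replicate sum_list_const_mult)
    moreover have "length ?ys = digit_sum l n"
      using xs(2) digit_sum_rec[OF assms, of n] by simp
    moreover have "\<exists>i. x = l ^ i" if "x \<in> set ?ys" for x
    proof -
      have "x = 1 \<or> (\<exists>y\<in>set xs. x = l * y)"
        using that by (auto split: if_splits)
      then show ?thesis
        using xs(3) by (metis power_0 power_Suc)
    qed
    ultimately show ?thesis by blast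
  qed (simp add: exI[of _ "[]"])
qed

lemma partition_into_powers:
  fixes A :: "'a set"
  assumes "finite A" "l > 1"
  shows "\<exists>P. partition_on A P \<and> card P = digit_sum l (card A) \<and> (\<forall>B\<in>P. \<exists>i. card B = l ^ i)"
proof -
  obtain xs where xs: "sum_list xs = card A" "length xs = digit_sum l (card A)"
      "\<forall>x\<in>set xs. \<exists>i. x = l ^ i"
    using exists_powers_list[OF assms(2)] by blast
  have "\<forall>x\<in>set xs. x > 0"
    using xs(3) assms(2) by auto
  then obtain P where P: "partition_on A P" "\<forall>x. card {B \<in> P. card B = x} = count_list xs x"
    using partition_with_block_sizes[OF assms(1) xs(1)[symmetric]] by blast
  have fin: "finite P"
    using P(1) assms(1) finite_elements by blast
  have sizes: "card ` P \<subseteq> set xs"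
  proof
    fix x assume "x \<in> card ` P"
    then have "{B \<in> P. card B = x} \<noteq> {}"
      by auto
    then have "count_list xs x \<noteq> 0"
      using P(2) fin by (metis (no_types, lifting) card_eq_0_iff finite_subset mem_Collect_eq subsetI)
    then show "x \<in> set xs"
      by (metis count_notin)
  qed
  have "card P = (\<Sum>x\<in>set xs. card {B \<in> P. card B = x})"
    using sum.group[OF fin _ sizes, of "\<lambda>_. 1 :: nat"] by simp
  also have "\<dots> = length xs"
    using P(2) sum_count_set[of xs "set xs"] by simp
  finally show ?thesis
    using P(1) xs sizes by (metis image_subset_iff)
qed

lemma card_partition_on:
  assumes "finite A" "partition_on A P"
  shows "card A = (\<Sum>B\<in>P. card B)"
proof -
  have "finite B" if "B \<in> P" for B
    using assms that by (metis finite_subset partition_onD1 Sup_upper)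
  then show ?thesis
    using card_Union_disjoint[OF partition_onD2[OF assms(2)]] partition_onD1[OF assms(2)] by simp
qed

text \<open>The prescribed blocks already contain \<open>card A\<close> points, so all remaining
  blocks together have size 0; a partition has no empty block.\<close>

lemma block_partition_sizes:
  fixes A :: "'a set"
  assumes "finite A" "l > 1" "card A = (\<Sum>i\<le>k. b i * l ^ i)" "block_partition l k b A P"
  shows "\<forall>B\<in>P. \<exists>i\<le>k. card B = l ^ i" "card P = (\<Sum>i\<le>k. b i)"
proof -
  have P: "partition_on A P" "\<And>i. i \<le> k \<Longrightarrow> card {B \<in> P. card B = l ^ i} = b i"
    using assms(4) by (auto simp: block_partition_def)
  have fin: "finite P"
    using P(1) assms(1) finite_elements by blast
  have finB: "finite B" if "B \<in> P" for B
    using P(1) assms(1) that by (metis finite_subset partition_onD1 Sup_upper)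
  define X where "X = (\<lambda>i. l ^ i) ` {..k}"
  define P' where "P' = {B \<in> P. card B \<in> X}"
  have injl: "inj_on (\<lambda>i. l ^ i) {..k}"
    using assms(2) by (auto intro!: inj_onI)
  \<comment> \<open>Used twice: the weight \<open>h x = x\<close> measures points, the constant
    weight 1 counts blocks.\<close>
  have grp: "(\<Sum>B\<in>P'. h (card B)) = (\<Sum>i\<le>k. b i * h (l ^ i))" for h :: "nat \<Rightarrow> nat"
  proof -
    have "(\<Sum>B\<in>P'. h (card B)) = (\<Sum>x\<in>X. \<Sum>B\<in>{B \<in> P'. card B = x}. h (card B))"
      using fin by (intro sum.group[symmetric]) (auto simp: P'_def X_def)
    also have "\<dots> = (\<Sum>x\<in>X. card {B \<in> P. card B = x} * h x)"
      by (intro sum.cong refl) (auto simp: P'_def intro!: arg_cong2[where f = "(*)"] arg_cong[where f = card])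
    also have "\<dots> = (\<Sum>i\<le>k. b i * h (l ^ i))"
      unfolding X_def using injl P(2) by (simp add: sum.reindex)
    finally show ?thesis .
  qed
  have "card A = (\<Sum>B\<in>P. card B)"
    using card_partition_on[OF assms(1) P(1)] .
  also have "\<dots> = (\<Sum>B\<in>P'. card B) + (\<Sum>B\<in>P - P'. card B)"
    using fin by (intro sum.subset_diff[THEN trans[OF _ add.commute]]) (auto simp: P'_def)
  also have "(\<Sum>B\<in>P'. card B) = card A"
    using grp[of "\<lambda>x. x"] assms(3) by simp
  finally have "(\<Sum>B\<in>P - P'. card B) = 0"
    by simp
  then have "\<forall>B\<in>P - P'. card B = 0"
    using fin by simp
  then have "P - P' = {}"
    using finB partition_onD3[OF P(1)] by (metis DiffD1 card_0_eq equals0I)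
  then have "P = P'"
    by (auto simp: P'_def)
  then show "\<forall>B\<in>P. \<exists>i\<le>k. card B = l ^ i"
    unfolding P'_def X_def by blast
  show "card P = (\<Sum>i\<le>k. b i)"
    using grp[of "\<lambda>_. 1 :: nat"] \<open>P = P'\<close> by simp
qed

text \<open>At most \<open>digit_sum l (card A)\<close> blocks of l-power size give a shortest
  expression of \<open>card A\<close> by powers of \<open>l\<close>, hence its base-l
  expansion.\<close>

lemma block_partitionI:
  fixes A :: "'a set"
  assumes "finite A" "l > 1" "card A = (\<Sum>i\<le>k. b i * l ^ i)" "\<forall>i\<le>k. b i < l"
    "partition_on A P" "\<forall>B\<in>P. \<exists>i. card B = l ^ i" "card P \<le> digit_sum l (card A)"
  shows "block_partition l k b A P"
proof -
  have fin: "finite P"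
    using assms(1,5) finite_elements by blast
  have finB: "finite B" if "B \<in> P" for B
    using assms(1,5) that by (metis finite_subset partition_onD1 Sup_upper)
  \<comment> \<open>\<open>card A\<close> is below \<open>l ^ Suc k\<close>, so no block has an
    exponent beyond \<open>k\<close>, and the block counts fall into the range where expansions are
    compared.\<close>
  have less: "(\<Sum>i\<le>j. b i * l ^ i) < l ^ Suc j" if "j \<le> k" for j
    using that
  proof (induction j)
    case 0
    then show ?case using assms(4) by simp
  next
    case (Suc j)
    have "b (Suc j) * l ^ Suc j \<le> (l - 1) * l ^ Suc j"
      using assms(4) Suc.prems by (intro mult_right_mono) force+
    moreover have "(l - 1) * l ^ Suc j + l ^ Suc j = l ^ Suc (Suc j)"
      using assms(2) by (cases l) auto
    moreover have "(\<Sum>i\<le>j. b i * l ^ i) < l ^ Suc j"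
      using Suc by simp
    ultimately have "(\<Sum>i\<le>j. b i * l ^ i) + b (Suc j) * l ^ Suc j < l ^ Suc (Suc j)"
      by linarith
    then show ?case
      by (simp only: sum.atMost_Suc)
  qed
  have sizes: "card ` P \<subseteq> (\<lambda>i. l ^ i) ` {..k}"
  proof
    fix x assume "x \<in> card ` P"
    then obtain B i where B: "B \<in> P" "x = card B" "card B = l ^ i"
      using assms(6) by auto
    have "card B \<le> card A"
      using assms(1,5) B(1) by (metis card_mono partition_onD1 Sup_upper)
    then have "l ^ i < l ^ Suc k"
      using less[of k] assms(3) B(3) by simp
    then have "i < Suc k"
      using assms(2) power_less_imp_less_exp by blast
    then show "x \<in> (\<lambda>i. l ^ i) ` {..k}"
      using B by auto
  qed
  have injl: "inj_on (\<lambda>i. l ^ i) {..k}"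
    using assms(2) by (auto intro!: inj_onI)
  define c where "c i = card {B \<in> P. card B = l ^ i}" for i
  have grp: "(\<Sum>B\<in>P. h (card B)) = (\<Sum>i\<le>k. c i * h (l ^ i))" for h :: "nat \<Rightarrow> nat"
  proof -
    have "(\<Sum>B\<in>P. h (card B)) = (\<Sum>x\<in>(\<lambda>i. l ^ i) ` {..k}. \<Sum>B\<in>{B \<in> P. card B = x}. h (card B))"
      using fin sizes by (intro sum.group[symmetric]) auto
    also have "\<dots> = (\<Sum>x\<in>(\<lambda>i. l ^ i) ` {..k}. card {B \<in> P. card B = x} * h x)"
      by (intro sum.cong refl) auto
    also have "\<dots> = (\<Sum>i\<le>k. c i * h (l ^ i))"
      using injl by (simp add: sum.reindex c_def)
    finally show ?thesis .
  qed
  have "card A = (\<Sum>B\<in>P. card B)"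
    using card_partition_on[OF assms(1,5)] .
  then have "(\<Sum>i\<le>k. c i * l ^ i) = (\<Sum>i\<le>k. b i * l ^ i)"
    using grp[of "\<lambda>x. x"] assms(3) by simp
  moreover have "(\<Sum>i\<le>k. c i) \<le> (\<Sum>i\<le>k. b i)"
    using assms(7) grp[of "\<lambda>_. 1 :: nat"] digit_sum_sum[OF assms(2,4)] assms(3) by simp
  ultimately have "\<forall>i\<le>k. c i = b i"
    using base_expansion_minimal[OF assms(2,4)] by blast
  then show ?thesis
    using assms(5) by (simp add: block_partition_def c_def)
qed

text \<open>Every block has digit sum 1 and there are \<open>digit_sum l (card A)\<close> blocks, so
  Legendre's formula gives the l-part of the full symmetric group.\<close>

lemma multiplicity_card_block_perms:
  fixes A :: "'a set"
  assumes "finite A" "prime l" "card A = (\<Sum>i\<le>k. b i * l ^ i)" "\<forall>i\<le>k. b i < l"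
    "block_partition l k b A P"
  shows "multiplicity l (card (label_perms (block_of P) A)) = multiplicity l (fact (card A) :: nat)"
proof -
  have l: "l > 1"
    using assms(2) prime_gt_1_nat by blast
  have P: "partition_on A P"
    using assms(5) by (simp add: block_partition_def)
  have fin: "finite P"
    using P assms(1) finite_elements by blast
  have labels: "block_of P ` A \<subseteq> P"
    using block_of_in(1)[OF P] by auto
  have "{i \<in> A. block_of P i = B} = B" if "B \<in> P" for B
    using block_of_eq[OF P that] block_of_in(2)[OF P] partition_onD1[OF P] that by blast
  then have "(\<Sum>B\<in>P. digit_sum l (card {i \<in> A. block_of P i = B})) = (\<Sum>B\<in>P. 1)"
    using block_partition_sizes(1)[OF assms(1) l assms(3,5)] l by (intro sum.cong refl) auto
  also have "\<dots> = digit_sum l (card A)"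
    using block_partition_sizes(2)[OF assms(1) l assms(3,5)] digit_sum_sum[OF l assms(4)] assms(3) by simp
  finally have "(l - 1) * multiplicity l (card (label_perms (block_of P) A)) =
      (l - 1) * multiplicity l (fact (card A) :: nat)"
    using multiplicity_card_label_perms[OF assms(2,1) fin labels]
      legendre_digit_sum[OF assms(2), of "card A"] by linarith
  then show ?thesis
    using l by simp
qed

text \<open>The hypothesis says that the class sizes add up without carries. Cutting each class by
  its own base-l expansion then uses no more blocks than the digit sum of \<open>card A\<close>, so
  the pieces form the expansion of \<open>card A\<close> itself.\<close>

lemma block_partition_refining:
  fixes A :: "'a set"
  assumes "finite A" "prime l" "card A = (\<Sum>i\<le>k. b i * l ^ i)" "\<forall>i\<le>k. b i < l"
    and mult: "multiplicity l (fact (card A) :: nat) \<le> multiplicity l (card (label_perms c A))"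
  shows "\<exists>P. block_partition l k b A P \<and> (\<forall>B\<in>P. \<forall>i\<in>B. \<forall>j\<in>B. c i = c j)"
proof -
  have l: "l > 1"
    using assms(2) prime_gt_1_nat by blast
  define C where "C r = {i \<in> A. c i = r}" for r
  have "finite (C r)" for r
    using assms(1) by (simp add: C_def)
  then have "\<forall>r. \<exists>P. partition_on (C r) P \<and> card P = digit_sum l (card (C r)) \<and> (\<forall>B\<in>P. \<exists>i. card B = l ^ i)"
    using partition_into_powers[OF _ l] by blast
  then obtain Q where Q: "\<And>r. partition_on (C r) (Q r)" "\<And>r. card (Q r) = digit_sum l (card (C r))"
      "\<And>r B. B \<in> Q r \<Longrightarrow> \<exists>i. card B = l ^ i"
    by metis
  define P where "P = (\<Union>r\<in>c ` A. Q r)"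
  have QC: "B \<subseteq> C r" if "B \<in> Q r" for B r
    using Q(1)[of r] that by (auto dest!: partition_onD1)
  have "partition_on A P"
    unfolding partition_on_def
  proof (intro conjI)
    have "\<Union>P = (\<Union>r\<in>c ` A. C r)"
      using partition_onD1[OF Q(1)] by (auto simp: P_def)
    then show "\<Union>P = A"
      by (auto simp: C_def)
    show "{} \<notin> P"
      using Q(1) by (auto simp: P_def partition_on_def)
    show "disjoint P"
      unfolding disjoint_def
    proof (intro ballI impI)
      fix B B' assume "B \<in> P" "B' \<in> P" "B \<noteq> B'"
      then obtain r r' where r: "B \<in> Q r" "B' \<in> Q r'"
        by (auto simp: P_def)
      show "B \<inter> B' = {}"
      proof (cases "r = r'")
        case True
        then show ?thesis
          using partition_onD2[OF Q(1)[of r]] r \<open>B \<noteq> B'\<close> by (auto simp: disjoint_def)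
      next
        case False
        then show ?thesis
          using QC[OF r(1)] QC[OF r(2)] by (auto simp: C_def)
      qed
    qed
  qed
  moreover have "\<forall>B\<in>P. \<exists>i. card B = l ^ i"
    using Q(3) by (auto simp: P_def)
  moreover have "card P \<le> digit_sum l (card A)"
  proof -
    have "card P \<le> (\<Sum>r\<in>c ` A. digit_sum l (card (C r)))"
      unfolding P_def Q(2)[symmetric] using assms(1) by (intro card_UN_le) auto
    moreover have "(l - 1) * multiplicity l (fact (card A) :: nat) \<le>
        (l - 1) * multiplicity l (card (label_perms c A))"
      using mult by simp
    ultimately show ?thesis
      using multiplicity_card_label_perms[OF assms(2,1) finite_imageI[OF assms(1)] order.refl, of c]
        legendre_digit_sum[OF assms(2), of "card A"] unfolding C_def by linarith
  qed
  ultimately have "block_partition l k b A P"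
    using block_partitionI[OF assms(1) l assms(3,4)] by blast
  moreover have "\<forall>B\<in>P. \<forall>i\<in>B. \<forall>j\<in>B. c i = c j"
  proof (intro ballI)
    fix B i j assume "B \<in> P" "i \<in> B" "j \<in> B"
    then obtain r where "B \<in> Q r"
      by (auto simp: P_def)
    then show "c i = c j"
      using QC[of B r] \<open>i \<in> B\<close> \<open>j \<in> B\<close> by (auto simp: C_def)
  qed
  ultimately show ?thesis by blast
qed

text \<open>Blocks of equal size are matched first, then the points inside matched blocks. Hence the
  choice of the partition does not affect the conjugacy class.\<close>

lemma block_partitions_isomorphic:
  fixes P Q :: "'n::finite set set"
  assumes "l > 1" "CARD('n) = (\<Sum>i\<le>k. b i * l ^ i)"
    "block_partition l k b UNIV P" "block_partition l k b UNIV Q"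
  shows "\<exists>\<sigma>. \<sigma> permutes UNIV \<and> (\<forall>i j. block_of Q (\<sigma> i) = block_of Q (\<sigma> j) \<longleftrightarrow> block_of P i = block_of P j)"
proof -
  have P: "partition_on UNIV P" and Q: "partition_on UNIV Q"
    using assms(3,4) by (auto simp: block_partition_def)
  have szP: "\<forall>B\<in>P. \<exists>i\<le>k. card B = l ^ i" and szQ: "\<forall>B\<in>Q. \<exists>i\<le>k. card B = l ^ i"
    using block_partition_sizes(1)[OF finite assms(1,2)] assms(3,4) by auto
  have "\<exists>f. bij_betw f {B \<in> P. card B = l ^ i} {B \<in> Q. card B = l ^ i}" if "i \<le> k" for i
    using that assms(3,4) by (intro finite_same_card_bij) (auto simp: block_partition_def)
  then have "\<exists>f. bij_betw f {B \<in> P. card B = x} {B \<in> Q. card B = x}" for x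
  proof (cases "\<exists>i\<le>k. x = l ^ i")
    case False
    then have "{B \<in> P. card B = x} = {}" "{B \<in> Q. card B = x} = {}"
      using szP szQ by auto
    then show ?thesis
      by (metis bij_betw_def image_empty inj_on_empty)
  qed auto
  then obtain f where f: "\<And>x. bij_betw (f x) {B \<in> P. card B = x} {B \<in> Q. card B = x}"
    by metis
  define h where "h B = f (card B) B" for B
  have h: "h B \<in> Q" "card (h B) = card B" if "B \<in> P" for B
    using bij_betwE[OF f[of "card B"]] that by (auto simp: h_def)
  have h_inj: "B = B'" if "B \<in> P" "B' \<in> P" "h B = h B'" for B B'
  proof -
    have "card B = card B'"
      using h that by metis
    then show ?thesis
      using bij_betw_imp_inj_on[OF f[of "card B"]] that by (auto simp: h_def inj_on_def)
  qed
  have "\<exists>g. bij_betw g B (h B)" if "B \<in> P" for B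
    using h(2)[OF that] by (intro finite_same_card_bij) auto
  then obtain g where g: "\<And>B. B \<in> P \<Longrightarrow> bij_betw (g B) B (h B)"
    by metis
  define \<sigma> where "\<sigma> i = g (block_of P i) i" for i
  have \<sigma>: "block_of Q (\<sigma> i) = h (block_of P i)" for i
    using bij_betwE[OF g[OF block_of_in(1)[OF P, of i]]] block_of_in[OF P, of i] h(1)
    by (intro block_of_eq[OF Q]) (auto simp: \<sigma>_def)
  have iff: "block_of Q (\<sigma> i) = block_of Q (\<sigma> j) \<longleftrightarrow> block_of P i = block_of P j" for i j
    unfolding \<sigma> using h_inj block_of_in(1)[OF P] by auto
  have "inj \<sigma>"
  proof (rule injI)
    fix i j assume eq: "\<sigma> i = \<sigma> j"
    then have bl: "block_of P i = block_of P j"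
      using iff[of i j] by simp
    then show "i = j"
      using eq bij_betw_imp_inj_on[OF g[OF block_of_in(1)[OF P, of i]]]
        block_of_in(2)[OF P, of i] block_of_in(2)[OF P, of j]
      by (auto simp: \<sigma>_def inj_on_def)
  qed
  then have "\<sigma> permutes UNIV"
    by (intro bij_imp_permutes) (auto simp: bij_def finite_UNIV_inj_surj)
  then show ?thesis
    using iff by blast
qed


section \<open>The general linear group\<close>

lemma GL_simps [simp]:
  "mult GL = (\<circ>)" "one GL = id"
  by (simp_all add: GL_def)

lemma carrier_GL: "f \<in> carrier GL \<longleftrightarrow> Vector_Spaces.linear (*s) (*s) f \<and> bij f"
  by (simp add: GL_def)

lemma linear_inv_into:
  fixes f :: "complex ^ 'n::finite \<Rightarrow> complex ^ 'n"
  assumes "Vector_Spaces.linear (*s) (*s) f" "bij f"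
  shows "Vector_Spaces.linear (*s) (*s) (inv_into UNIV f)"
proof -
  interpret f: Vector_Spaces.linear "(*s)" "(*s)" f
    by fact
  have inj: "inj f" and surj: "surj f"
    using assms(2) by (auto simp: bij_def)
  show ?thesis
  proof (unfold Vector_Spaces.linear_iff, intro conjI allI)
    show "inv_into UNIV f (x + y) = inv_into UNIV f x + inv_into UNIV f y" for x y
      by (rule injD[OF inj]) (simp add: f.add surj_f_inv_f[OF surj])
    show "inv_into UNIV f (a *s x) = a *s inv_into UNIV f x" for a x
      by (rule injD[OF inj]) (simp add: f.scale surj_f_inv_f[OF surj])
  qed (rule vec.vector_space_axioms)+
qed

lemma group_GL: "group (GL :: (complex ^ 'n::finite \<Rightarrow> complex ^ 'n) monoid)"
proof (rule groupI)
  fix f :: "complex ^ 'n \<Rightarrow> complex ^ 'n" assume f: "f \<in> carrier GL"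
  then have "inv_into UNIV f \<in> carrier GL"
    by (auto simp: carrier_GL linear_inv_into bij_imp_bij_inv)
  moreover have "inv_into UNIV f \<circ> f = id"
    using f by (simp add: carrier_GL bij_is_inj)
  ultimately show "\<exists>g\<in>carrier GL. g \<otimes>\<^bsub>GL\<^esub> f = \<one>\<^bsub>GL\<^esub>"
    by auto
qed (auto simp: carrier_GL vec.linear_id id_def[symmetric] bij_comp intro: Vector_Spaces.linear_compose)

interpretation GL: group "GL :: (complex ^ 'n::finite \<Rightarrow> complex ^ 'n) monoid"
  by (rule group_GL)

lemma subgroup_GL_comp: "subgroup K GL \<Longrightarrow> f \<in> K \<Longrightarrow> g \<in> K \<Longrightarrow> f \<circ> g \<in> K"
  using subgroup.m_closed[of K GL f g] by simp

lemma GL_inv_comp [simp]: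
  assumes "g \<in> carrier GL"
  shows "inv\<^bsub>GL\<^esub> g \<circ> g = id" "g \<circ> inv\<^bsub>GL\<^esub> g = id" "(inv\<^bsub>GL\<^esub> g) (g v) = v" "g ((inv\<^bsub>GL\<^esub> g) v) = v"
  using GL.l_inv[OF assms] GL.r_inv[OF assms] by (auto dest: fun_cong simp: fun_eq_iff)

section \<open>Conjugates of subgroups of GL(V)\<close>

lemma conjugate_subgroup_image:
  "conjugate_subgroup g H = (\<lambda>h. g \<circ> h \<circ> inv\<^bsub>GL\<^esub> g) ` H"
  by (auto simp: conjugate_subgroup_def l_coset_def r_coset_def)

lemma conjugate_subgroup_comp:
  assumes "g \<in> carrier GL" "h \<in> carrier GL"
  shows "conjugate_subgroup (g \<circ> h) H = conjugate_subgroup g (conjugate_subgroup h H)"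
proof -
  have "inv\<^bsub>GL\<^esub> (g \<circ> h) = inv\<^bsub>GL\<^esub> h \<circ> inv\<^bsub>GL\<^esub> g"
    using GL.inv_mult_group[OF assms] by simp
  then show ?thesis
    by (simp add: conjugate_subgroup_image image_image comp_assoc)
qed

lemma conjugate_subgroup_id [simp]: "conjugate_subgroup id H = H"
  by (simp add: conjugate_subgroup_image GL.inv_one[simplified])

lemma conjugate_subgroup_mono: "H \<subseteq> K \<Longrightarrow> conjugate_subgroup g H \<subseteq> conjugate_subgroup g K"
  by (auto simp: conjugate_subgroup_image)

lemma inj_conjugation:
  assumes "g \<in> carrier GL"
  shows "inj (\<lambda>h. g \<circ> h \<circ> inv\<^bsub>GL\<^esub> g)"
proof (rule injI)
  fix h h' assume "g \<circ> h \<circ> inv\<^bsub>GL\<^esub> g = g \<circ> h' \<circ> inv\<^bsub>GL\<^esub> g"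
  then have "inv\<^bsub>GL\<^esub> g \<circ> (g \<circ> h \<circ> inv\<^bsub>GL\<^esub> g) \<circ> g = inv\<^bsub>GL\<^esub> g \<circ> (g \<circ> h' \<circ> inv\<^bsub>GL\<^esub> g) \<circ> g"
    by simp
  then show "h = h'"
    using assms by (simp add: fun_eq_iff)
qed

lemma card_conjugate_subgroup:
  assumes "g \<in> carrier GL"
  shows "card (conjugate_subgroup g H) = card H"
  unfolding conjugate_subgroup_image
  by (rule card_image) (rule inj_on_subset[OF inj_conjugation[OF assms]], simp)

lemma conjugation_hom:
  assumes "g \<in> carrier (GL :: (complex ^ 'n::finite \<Rightarrow> complex ^ 'n) monoid)"
  shows "group_hom GL GL (\<lambda>h. g \<circ> h \<circ> inv\<^bsub>GL\<^esub> g)"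
proof (unfold_locales, rule homI)
  fix x y :: "complex ^ 'n \<Rightarrow> complex ^ 'n" assume xy: "x \<in> carrier GL" "y \<in> carrier GL"
  show "g \<circ> x \<circ> inv\<^bsub>GL\<^esub> g \<in> carrier GL"
    using GL.m_closed[OF GL.m_closed[OF assms xy(1)] GL.inv_closed[OF assms]] by simp
  show "g \<circ> (x \<otimes>\<^bsub>GL\<^esub> y) \<circ> inv\<^bsub>GL\<^esub> g = (g \<circ> x \<circ> inv\<^bsub>GL\<^esub> g) \<otimes>\<^bsub>GL\<^esub> (g \<circ> y \<circ> inv\<^bsub>GL\<^esub> g)"
    using assms by (simp add: fun_eq_iff)
qed

lemma subgroup_conjugate:
  assumes "g \<in> carrier GL" "subgroup H GL"
  shows "subgroup (conjugate_subgroup g H) GL"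
  unfolding conjugate_subgroup_image
  using group_hom.subgroup_img_is_subgroup[OF conjugation_hom[OF assms(1)] assms(2)] .

text \<open>Conjugation by \<open>g\<close> and by its inverse both map \<open>H\<close> into
  itself, which gives equality for infinite \<open>H\<close> as well.\<close>

lemma conjugate_subgroup_of_member:
  assumes "subgroup H GL" "g \<in> H"
  shows "conjugate_subgroup g H = H"
proof -
  have g: "g \<in> carrier GL" "inv\<^bsub>GL\<^esub> g \<in> H"
    using subgroup.mem_carrier[OF assms] subgroup.m_inv_closed[OF assms] by auto
  have sub: "conjugate_subgroup x H \<subseteq> H" if "x \<in> H" for x
    using subgroup.m_closed[OF assms(1)] subgroup.m_inv_closed[OF assms(1)] that
    by (auto simp: conjugate_subgroup_image)
  have "H = conjugate_subgroup g (conjugate_subgroup (inv\<^bsub>GL\<^esub> g) H)"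
    using g(1) by (simp flip: conjugate_subgroup_comp)
  also have "\<dots> \<subseteq> conjugate_subgroup g H"
    by (rule conjugate_subgroup_mono) (rule sub[OF g(2)])
  finally show ?thesis
    using sub[OF assms(2)] by blast
qed


section \<open>Complex reflections\<close>

text \<open>The map \<open>f - id\<close> has rank at most one: a single vector \<open>u\<close>
  completes a basis of the fixed hyperplane, and \<open>f v - v\<close> depends only on the
  \<open>u\<close>-coordinate of \<open>v\<close>. In this form the dimension condition can be
  tested on matrix entries.\<close>

lemma dim_fix_imp_line:
  fixes f :: "complex ^ 'n::finite \<Rightarrow> complex ^ 'n"
  assumes "Vector_Spaces.linear (*s) (*s) f" "vec.dim {v. f v = v} + 1 = CARD('n)"
  shows "\<exists>w. \<forall>v. \<exists>a. f v - v = a *s w"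
proof -
  interpret f: Vector_Spaces.linear "(*s)" "(*s)" f
    by fact
  have sub: "vec.subspace {v. f v = v}"
    by (auto simp: vec.subspace_def f.add f.scale f.zero)
  obtain B where B: "B \<subseteq> {v. f v = v}" "vec.independent B" "{v. f v = v} \<subseteq> vec.span B"
      "card B = vec.dim {v. f v = v}"
    using vec.basis_exists by blast
  obtain B' where B': "B \<subseteq> B'" "B' \<subseteq> UNIV" "vec.independent B'" "UNIV \<subseteq> vec.span B'"
    by (rule vec.maximal_independent_subset_extend[OF subset_UNIV B(2)])
  have "card B' = CARD('n)"
    using vec.dim_eq_card[OF _ B'(3), of UNIV] B'(4) vec_dim_card[where 'a = complex and 'n = 'n]
    by (simp add: top.extremum_unique)
  then have "card (B' - B) = 1"
    using B'(1) B(4) assms(2) vec.finiteI_independent[OF B(2)] by (simp add: card_Diff_subset)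
  then obtain u where "B' - B = {u}"
    by (auto simp: card_1_singleton_iff)
  then have "B' = insert u B"
    using B'(1) by auto
  have "\<exists>a. f v - v = a *s (f u - u)" for v
  proof -
    have "v \<in> vec.span (insert u B)"
      using B'(4) \<open>B' = _\<close> by auto
    then obtain a where "v - a *s u \<in> vec.span B"
      using vec.span_breakdown_eq by blast
    then have "f (v - a *s u) = v - a *s u"
      using vec.span_minimal[OF B(1) sub] by auto
    then have "f v - v = a *s (f u - u)"
      by (simp add: f.diff f.scale vec.scale_right_diff_distrib algebra_simps)
    then show ?thesis by blast
  qed
  then show ?thesis by blast
qed

text \<open>Subtracting a multiple of \<open>u\<close> makes any \<open>v\<close> fixed, so the
  fixed space and \<open>u\<close> together span everything. This certifies explicit reflections
  without computing their fixed spaces.\<close>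

lemma dim_fix_of_line:
  fixes f :: "complex ^ 'n::finite \<Rightarrow> complex ^ 'n"
  assumes "Vector_Spaces.linear (*s) (*s) f" "f u \<noteq> u" "\<And>v. \<exists>a. f v - v = a *s (f u - u)"
  shows "vec.dim {v. f v = v} + 1 = CARD('n)"
proof -
  interpret f: Vector_Spaces.linear "(*s)" "(*s)" f
    by fact
  let ?N = "{v. f v = v}"
  have sub: "vec.subspace ?N"
    by (auto simp: vec.subspace_def f.add f.scale f.zero)
  then have sp: "vec.span ?N = ?N"
    by (simp add: vec.span_eq_iff)
  have "v \<in> vec.span (insert u ?N)" for v
  proof -
    obtain a where "f v - v = a *s (f u - u)"
      using assms(3) by blast
    then have "v - a *s u \<in> ?N"
      by (simp add: f.diff f.scale vec.scale_right_diff_distrib algebra_simps)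
    then show ?thesis
      using vec.span_breakdown_eq sp by blast
  qed
  then have "vec.span (insert u ?N) = UNIV"
    by auto
  then have "CARD('n) = vec.dim (insert u ?N)"
    by (metis vec.dim_span vec_dim_card)
  also have "\<dots> = vec.dim ?N + 1"
    using assms(2) by (simp add: vec.dim_insert sp)
  finally show ?thesis by simp
qed

lemma complex_reflection_conjugate:
  assumes "g \<in> carrier GL" "complex_reflection f"
  shows "complex_reflection (g \<circ> f \<circ> inv\<^bsub>GL\<^esub> g)"
proof -
  have lin: "Vector_Spaces.linear (*s) (*s) g" "Vector_Spaces.linear (*s) (*s) (inv\<^bsub>GL\<^esub> g)" "bij g"
    using assms(1) GL.inv_closed[OF assms(1)] by (auto simp: carrier_GL)
  have pow: "(g \<circ> f \<circ> inv\<^bsub>GL\<^esub> g) ^^ k = g \<circ> f ^^ k \<circ> inv\<^bsub>GL\<^esub> g" for k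
    using assms(1) by (induction k) (auto simp: fun_eq_iff)
  have "{v. (g \<circ> f \<circ> inv\<^bsub>GL\<^esub> g) v = v} = g ` {v. f v = v}"
  proof (intro equalityI subsetI)
    fix v assume "v \<in> {v. (g \<circ> f \<circ> inv\<^bsub>GL\<^esub> g) v = v}"
    then have "(inv\<^bsub>GL\<^esub> g) (g (f ((inv\<^bsub>GL\<^esub> g) v))) = (inv\<^bsub>GL\<^esub> g) v"
      by simp
    then have "f ((inv\<^bsub>GL\<^esub> g) v) = (inv\<^bsub>GL\<^esub> g) v"
      unfolding GL_inv_comp(3)[OF assms(1)] .
    moreover have "v = g ((inv\<^bsub>GL\<^esub> g) v)"
      using assms(1) by simp
    ultimately show "v \<in> g ` {v. f v = v}" by blast
  qed (use assms(1) in auto)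
  moreover have "vec.dim (g ` {v. f v = v}) = vec.dim {v. f v = v}"
    using lin(1,3) by (intro vec.dim_image_eq) (auto simp: bij_def intro: inj_on_subset)
  ultimately have dim: "vec.dim {v. (g \<circ> f \<circ> inv\<^bsub>GL\<^esub> g) v = v} = vec.dim {v. f v = v}"
    by (simp only:)
  show ?thesis
    using assms lin dim unfolding complex_reflection_def
    by (auto simp: pow intro!: Vector_Spaces.linear_compose)
qed

lemma complex_reflection_in_GL:
  assumes "complex_reflection f"
  shows "f \<in> carrier GL"
proof -
  obtain k where k: "k > 0" "f ^^ k = id"
    using assms by (auto simp: complex_reflection_def)
  then obtain j where "k = Suc j"
    by (cases k) auto
  then have "f ^^ j \<circ> f = id" "f \<circ> f ^^ j = id"
    using k(2) funpow_Suc_right[of j f] by auto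
  then have "bij f"
    by (metis o_bij)
  then show ?thesis
    using assms by (simp add: carrier_GL complex_reflection_def)
qed


section \<open>Monomial maps\<close>

text \<open>Coordinate form of \<open>diag_map \<theta> \<circ> perm_map \<pi>\<close> for bijective
  \<open>\<pi>\<close>. Coordinate \<open>i\<close> of the image comes from the basis vector at
  \<open>inv_into UNIV \<pi> i\<close>; accordingly \<open>e_i\<close> goes to
  \<open>\<theta> (\<pi> i)\<close> times the basis vector at \<open>\<pi> i\<close>.\<close>

definition monomial_map :: "('n::finite \<Rightarrow> complex) \<Rightarrow> ('n \<Rightarrow> 'n) \<Rightarrow> complex ^ 'n \<Rightarrow> complex ^ 'n" where
  "monomial_map \<theta> \<pi> v = (\<chi> i. \<theta> i * v $ inv_into UNIV \<pi> i)"

lemma permutes_UNIV_iff: "(\<pi> :: 'n \<Rightarrow> 'n) permutes UNIV \<longleftrightarrow> bij \<pi>"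
  by (auto intro: permutes_bij bij_imp_permutes)

lemma monomial_map_axis:
  "bij \<pi> \<Longrightarrow> monomial_map \<theta> \<pi> (axis i x) = axis (\<pi> i) (\<theta> (\<pi> i) * x)"
  by (auto simp: monomial_map_def vec_eq_iff axis_def bij_is_inj bij_is_surj surj_f_inv_f)

lemma diag_map_eq: "diag_map \<theta> = monomial_map \<theta> id"
  by (auto simp: diag_map_def monomial_map_def vec_eq_iff fun_eq_iff axis_def if_distrib[of "\<lambda>x. _ * x"]
      cong: if_cong)

lemma perm_map_eq:
  assumes "bij \<pi>"
  shows "perm_map \<pi> = monomial_map (\<lambda>_. 1) \<pi>"
proof (intro ext, simp add: vec_eq_iff, intro allI)
  fix v :: "complex ^ 'a" and j
  have "j = \<pi> i \<longleftrightarrow> i = inv_into UNIV \<pi> j" for i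
    using assms by (auto simp: bij_is_inj bij_is_surj surj_f_inv_f)
  then have "perm_map \<pi> v $ j = (\<Sum>i\<in>UNIV. if i = inv_into UNIV \<pi> j then v $ i else 0)"
    unfolding perm_map_def by (simp add: axis_def if_distrib[of "\<lambda>x. _ * x"] cong: if_cong)
  then show "perm_map \<pi> v $ j = monomial_map (\<lambda>_. 1) \<pi> v $ j"
    by (simp add: monomial_map_def)
qed

lemma monomial_map_comp:
  assumes "bij \<pi>" "bij \<rho>"
  shows "monomial_map \<theta> \<pi> \<circ> monomial_map \<eta> \<rho> = monomial_map (\<lambda>i. \<theta> i * \<eta> (inv_into UNIV \<pi> i)) (\<pi> \<circ> \<rho>)"
  using assms by (auto simp: monomial_map_def fun_eq_iff vec_eq_iff o_inv_distrib)

lemma monomial_map_one [simp]: "monomial_map (\<lambda>_. 1) id = id"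
  by (auto simp: monomial_map_def fun_eq_iff vec_eq_iff)

lemma monomial_map_inverse:
  assumes "bij \<pi>" "\<And>i. \<theta> i \<noteq> 0"
  shows "monomial_map (\<lambda>i. inverse (\<theta> (\<pi> i))) (inv_into UNIV \<pi>) \<circ> monomial_map \<theta> \<pi> = id"
    and "monomial_map \<theta> \<pi> \<circ> monomial_map (\<lambda>i. inverse (\<theta> (\<pi> i))) (inv_into UNIV \<pi>) = id"
  using assms by (auto simp: monomial_map_comp bij_imp_bij_inv inv_inv_eq bij_is_inj bij_is_surj surj_f_inv_f
      surj_iff[THEN iffD1] simp flip: monomial_map_one simp del: monomial_map_one)

lemma monomial_map_in_GL:
  assumes "bij \<pi>" "\<And>i. \<theta> i \<noteq> 0"
  shows "monomial_map \<theta> \<pi> \<in> carrier GL"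
proof -
  have "bij (monomial_map \<theta> \<pi>)"
    using monomial_map_inverse[OF assms] by (rule o_bij)
  then show ?thesis
    by (auto simp: carrier_GL Vector_Spaces.linear_iff monomial_map_def vec_eq_iff algebra_simps vec.vector_space_axioms)
qed

lemma GL_inv_monomial_map:
  assumes "bij \<pi>" "\<And>i. \<theta> i \<noteq> 0"
  shows "inv\<^bsub>GL\<^esub> (monomial_map \<theta> \<pi>) = monomial_map (\<lambda>i. inverse (\<theta> (\<pi> i))) (inv_into UNIV \<pi>)"
  using assms
  by (intro GL.inv_equality) (auto simp: monomial_map_inverse intro!: monomial_map_in_GL bij_imp_bij_inv)

lemma monomial_map_inject:
  assumes "monomial_map \<theta> \<pi> = monomial_map \<eta> \<rho>" "bij \<pi>" "bij \<rho>" "\<And>i. \<theta> i \<noteq> 0"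
  shows "\<pi> = \<rho>" "\<theta> = \<eta>"
proof -
  have "axis (\<pi> i) (\<theta> (\<pi> i)) = axis (\<rho> i) (\<eta> (\<rho> i))" for i
    using fun_cong[OF assms(1), of "axis i 1"] assms(2,3) by (simp add: monomial_map_axis)
  then have *: "\<pi> i = \<rho> i \<and> \<theta> (\<pi> i) = \<eta> (\<rho> i)" for i
    using assms(4) by (metis axis_eq_axis)
  then show "\<pi> = \<rho>" by auto
  show "\<theta> = \<eta>"
  proof
    fix j
    obtain i where "j = \<pi> i"
      using assms(2) by (metis bij_pointE)
    then show "\<theta> j = \<eta> j"
      using * by metis
  qed
qed

text \<open>Diagonal and permutation parts range independently, so orders multiply, and the subgroup
  property reduces to closure of both parts and invariance of \<open>\<Theta>\<close> under
  permuting coordinates.\<close>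

definition monomial_set :: "('n::finite \<Rightarrow> complex) set \<Rightarrow> ('n \<Rightarrow> 'n) set \<Rightarrow> (complex ^ 'n \<Rightarrow> complex ^ 'n) set" where
  "monomial_set \<Theta> S = {monomial_map \<theta> \<pi> | \<theta> \<pi>. \<theta> \<in> \<Theta> \<and> \<pi> \<in> S}"

lemma monomial_setI: "\<theta> \<in> \<Theta> \<Longrightarrow> \<pi> \<in> S \<Longrightarrow> monomial_map \<theta> \<pi> \<in> monomial_set \<Theta> S"
  by (auto simp: monomial_set_def)

lemma card_monomial_set:
  assumes "\<And>\<theta> i. \<theta> \<in> \<Theta> \<Longrightarrow> \<theta> i \<noteq> 0" "\<And>\<pi>. \<pi> \<in> S \<Longrightarrow> bij \<pi>"
  shows "card (monomial_set \<Theta> S) = card \<Theta> * card S"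
proof -
  have "monomial_set \<Theta> S = case_prod monomial_map ` (\<Theta> \<times> S)"
    by (auto simp: monomial_set_def)
  moreover have "inj_on (case_prod monomial_map) (\<Theta> \<times> S)"
  proof (rule inj_onI, clarify)
    fix \<theta> \<pi> \<eta> \<rho>
    assume *: "\<theta> \<in> \<Theta>" "\<eta> \<in> \<Theta>" "\<pi> \<in> S" "\<rho> \<in> S" "monomial_map \<theta> \<pi> = monomial_map \<eta> \<rho>"
    show "\<theta> = \<eta> \<and> \<pi> = \<rho>"
      using monomial_map_inject[OF *(5)] assms * by blast
  qed
  ultimately show ?thesis
    by (simp add: card_image card_cartesian_product)
qed

lemma finite_monomial_set: "finite \<Theta> \<Longrightarrow> finite S \<Longrightarrow> finite (monomial_set \<Theta> S)"
  unfolding monomial_set_def by (rule finite_image_set2) simp_all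

lemma subgroup_monomial_set:
  assumes "\<And>\<theta> i. \<theta> \<in> \<Theta> \<Longrightarrow> \<theta> i \<noteq> 0" "\<And>\<pi>. \<pi> \<in> S \<Longrightarrow> bij \<pi>"
    and "(\<lambda>_. 1) \<in> \<Theta>" "\<And>\<theta> \<eta>. \<theta> \<in> \<Theta> \<Longrightarrow> \<eta> \<in> \<Theta> \<Longrightarrow> (\<lambda>i. \<theta> i * \<eta> i) \<in> \<Theta>"
    and "\<And>\<theta>. \<theta> \<in> \<Theta> \<Longrightarrow> (\<lambda>i. inverse (\<theta> i)) \<in> \<Theta>"
    and "id \<in> S" "\<And>\<pi> \<rho>. \<pi> \<in> S \<Longrightarrow> \<rho> \<in> S \<Longrightarrow> \<pi> \<circ> \<rho> \<in> S" "\<And>\<pi>. \<pi> \<in> S \<Longrightarrow> inv_into UNIV \<pi> \<in> S"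
    and "\<And>\<theta> \<pi>. \<theta> \<in> \<Theta> \<Longrightarrow> \<pi> \<in> S \<Longrightarrow> (\<lambda>i. \<theta> (\<pi> i)) \<in> \<Theta>"
  shows "subgroup (monomial_set \<Theta> S) GL"
proof (rule GL.subgroupI)
  show "monomial_set \<Theta> S \<subseteq> carrier GL"
    using assms(1,2) by (auto simp: monomial_set_def intro!: monomial_map_in_GL)
  show "monomial_set \<Theta> S \<noteq> {}"
    using assms(3,6) by (auto simp: monomial_set_def)
next
  fix f assume "f \<in> monomial_set \<Theta> S"
  then obtain \<theta> \<pi> where f: "f = monomial_map \<theta> \<pi>" "\<theta> \<in> \<Theta>" "\<pi> \<in> S"
    by (auto simp: monomial_set_def)
  have "inv\<^bsub>GL\<^esub> f = monomial_map (\<lambda>i. inverse (\<theta> (\<pi> i))) (inv_into UNIV \<pi>)"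
    unfolding f(1) using f assms(1,2) by (intro GL_inv_monomial_map) auto
  then show "inv\<^bsub>GL\<^esub> f \<in> monomial_set \<Theta> S"
    using assms(5)[OF assms(9)[OF f(2,3)]] assms(8)[OF f(3)] by (simp add: monomial_setI)
next
  fix f g assume "f \<in> monomial_set \<Theta> S" "g \<in> monomial_set \<Theta> S"
  then obtain \<theta> \<pi> \<eta> \<rho> where f: "f = monomial_map \<theta> \<pi>" "\<theta> \<in> \<Theta>" "\<pi> \<in> S" and g: "g = monomial_map \<eta> \<rho>" "\<eta> \<in> \<Theta>" "\<rho> \<in> S"
    by (auto simp: monomial_set_def)
  have "(\<lambda>i. \<theta> i * \<eta> (inv_into UNIV \<pi> i)) \<in> \<Theta>"
    using assms(4)[OF f(2) assms(9)[OF g(2) assms(8)[OF f(3)]]] .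
  then show "f \<otimes>\<^bsub>GL\<^esub> g \<in> monomial_set \<Theta> S"
    using f g assms(2,7) by (simp add: monomial_map_comp monomial_setI)
qed


section \<open>Normal subgroups of prime power order\<close>

text \<open>Every fibre of the multiplication map on \<open>H \<times> K\<close> is a copy of
  \<open>H \<inter> K\<close>; the set \<open>H <#> K\<close> need not be a subgroup here.\<close>

lemma (in group) card_set_mult:
  assumes H: "subgroup H G" and K: "subgroup K G" and "finite H" "finite K"
  shows "card (H <#> K) * card (H \<inter> K) = card H * card K"
proof -
  let ?m = "\<lambda>(x, y). x \<otimes> y"
  have img: "?m ` (H \<times> K) = H <#> K"
    by (auto simp: set_mult_def)
  have fiber: "card {xy \<in> H \<times> K. ?m xy = z} = card (H \<inter> K)" if "z \<in> H <#> K" for z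
  proof -
    obtain x0 y0 where 0: "x0 \<in> H" "y0 \<in> K" "z = x0 \<otimes> y0"
      using \<open>z \<in> H <#> K\<close> by (auto simp: set_mult_def)
    note mem = subgroup.mem_carrier[OF H] subgroup.mem_carrier[OF K]
    \<comment> \<open>An element \<open>t\<close> of the intersection can be shifted from one factor
      to the other without changing the product of \<open>x0\<close> and \<open>y0\<close>.\<close>
    have "bij_betw (\<lambda>t. (x0 \<otimes> t, inv t \<otimes> y0)) (H \<inter> K) {xy \<in> H \<times> K. ?m xy = z}"
    proof (rule bij_betw_byWitness[where f' = "\<lambda>(x, y). inv x0 \<otimes> x"])
      show "\<forall>t\<in>H \<inter> K. (case (x0 \<otimes> t, inv t \<otimes> y0) of (x, y) \<Rightarrow> inv x0 \<otimes> x) = t"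
        using 0 mem by (auto simp flip: m_assoc)
      show "\<forall>xy\<in>{xy \<in> H \<times> K. ?m xy = z}.
          (x0 \<otimes> (case xy of (x, y) \<Rightarrow> inv x0 \<otimes> x), inv (case xy of (x, y) \<Rightarrow> inv x0 \<otimes> x) \<otimes> y0) = xy"
      proof
        fix xy assume "xy \<in> {xy \<in> H \<times> K. ?m xy = z}"
        then obtain x y where xy: "x \<in> H" "y \<in> K" "x \<otimes> y = z" "xy = (x, y)"
          by auto
        have "x0 \<otimes> (inv x0 \<otimes> x) = x"
          using 0 xy mem by (simp flip: m_assoc)
        have "inv (inv x0 \<otimes> x) \<otimes> y0 = inv x \<otimes> (x0 \<otimes> y0)"
          using 0 xy mem by (simp add: inv_mult_group m_assoc)
        also have "\<dots> = inv x \<otimes> (x \<otimes> y)"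
          using 0 xy by simp
        also have "\<dots> = y"
          using xy(1,2) mem by (simp flip: m_assoc)
        finally have "inv (inv x0 \<otimes> x) \<otimes> y0 = y" .
        with \<open>x0 \<otimes> (inv x0 \<otimes> x) = x\<close>
        show "(x0 \<otimes> (case xy of (x, y) \<Rightarrow> inv x0 \<otimes> x), inv (case xy of (x, y) \<Rightarrow> inv x0 \<otimes> x) \<otimes> y0) = xy"
          by (simp add: xy(4))
      qed
      show "(\<lambda>t. (x0 \<otimes> t, inv t \<otimes> y0)) ` (H \<inter> K) \<subseteq> {xy \<in> H \<times> K. ?m xy = z}"
      proof (rule image_subsetI)
        fix t assume "t \<in> H \<inter> K"
        then have t: "t \<in> H" "t \<in> K"
          by auto
        have "t \<otimes> (inv t \<otimes> y0) = y0"
          using 0 t mem by (simp flip: m_assoc)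
        then have "(x0 \<otimes> t) \<otimes> (inv t \<otimes> y0) = z"
          using 0 t mem by (simp add: m_assoc)
        moreover have "x0 \<otimes> t \<in> H" "inv t \<otimes> y0 \<in> K"
          using 0 t subgroup.m_closed[OF H] subgroup.m_closed[OF K] subgroup.m_inv_closed[OF K] by auto
        ultimately show "(x0 \<otimes> t, inv t \<otimes> y0) \<in> {xy \<in> H \<times> K. ?m xy = z}"
          by simp
      qed
      show "(\<lambda>(x, y). inv x0 \<otimes> x) ` {xy \<in> H \<times> K. ?m xy = z} \<subseteq> H \<inter> K"
      proof (rule image_subsetI)
        fix xy assume "xy \<in> {xy \<in> H \<times> K. ?m xy = z}"
        then obtain x y where xy: "x \<in> H" "y \<in> K" "x \<otimes> y = z" "xy = (x, y)"
          by auto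
        have "x = x0 \<otimes> y0 \<otimes> inv y"
          using 0 xy mem by (metis inv_solve_right m_closed)
        then have "inv x0 \<otimes> x = y0 \<otimes> inv y"
          using 0 xy mem by (simp add: m_assoc) (simp flip: m_assoc)
        moreover have "inv x0 \<otimes> x \<in> H" "y0 \<otimes> inv y \<in> K"
          using 0(1,2) xy(1,2) subgroup.m_closed[OF H] subgroup.m_closed[OF K]
            subgroup.m_inv_closed[OF H] subgroup.m_inv_closed[OF K] by auto
        ultimately show "(case xy of (x, y) \<Rightarrow> inv x0 \<otimes> x) \<in> H \<inter> K"
          by (simp add: xy(4))
      qed
    qed
    then show ?thesis
      by (simp add: bij_betw_same_card)
  qed
  have "card H * card K = (\<Sum>xy\<in>H \<times> K. 1 :: nat)"
    by (simp add: card_cartesian_product)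
  also have "\<dots> = (\<Sum>z\<in>H <#> K. \<Sum>xy\<in>{xy \<in> H \<times> K. ?m xy = z}. 1)"
    unfolding img[symmetric] using assms by (intro sum.image_gen) auto
  also have "\<dots> = card (H <#> K) * card (H \<inter> K)"
    using fiber by simp
  finally show ?thesis ..
qed

text \<open>Since \<open>N\<close> is normal, \<open>N <#> P\<close> is a subgroup, and by the
  product formula its order is a power of \<open>l\<close>. It contains \<open>P\<close>, which
  already has the largest such order.\<close>

lemma (in group) normal_prime_power_le_sylow:
  assumes "finite (carrier G)" "prime l" "N \<lhd> G" "card N = l ^ x"
    and P: "subgroup P G" "card P = l ^ multiplicity l (order G)"
  shows "N \<subseteq> P"
proof -
  interpret second_isomorphism_grp N G P
    using assms(3) P(1) by (simp add: second_isomorphism_grp_def second_isomorphism_grp_axioms_def)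
  have N: "subgroup N G"
    using assms(3) normal_imp_subgroup by blast
  have fin: "finite N" "finite P" "finite (N <#> P)"
    using assms(1) subgroup.subset[OF N] subgroup.subset[OF P(1)]
      subgroup.subset[OF normal_set_mult_subgroup] finite_subset by blast+
  have "card (N <#> P) dvd l ^ (x + multiplicity l (order G))"
    using card_set_mult[OF N P(1) fin(1,2)] assms(4) P(2) by (metis dvd_triv_left power_add)
  then obtain y where y: "card (N <#> P) = l ^ y"
    using assms(2) divides_primepow_nat by blast
  have "card (N <#> P) dvd order G"
    using lagrange[OF normal_set_mult_subgroup] by (metis dvd_triv_right)
  moreover have "order G \<noteq> 0"
    using assms(1) order_gt_0_iff_finite by simp
  ultimately have "y \<le> multiplicity l (order G)"
    using prime_gt_1_nat[OF assms(2)] y by (simp add: power_dvd_iff_le_multiplicity)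
  then have "card (N <#> P) \<le> card P"
    using y P(2) power_increasing[OF _ prime_ge_1_nat[OF assms(2)]] by simp
  then have "P = N <#> P"
    using S_contained_in_set_mult fin by (intro card_seteq) auto
  then show ?thesis
    using H_contained_in_set_mult by simp
qed

lemma normal_prime_power_le_sylow_subgroup:
  fixes G :: "(complex ^ 'n::finite \<Rightarrow> complex ^ 'n) set"
  assumes "prime l" "subgroup G GL" "finite G" "subgroup N GL" "N \<subseteq> G"
    "\<And>g h. g \<in> G \<Longrightarrow> h \<in> N \<Longrightarrow> g \<circ> h \<circ> inv\<^bsub>GL\<^esub> g \<in> N" "card N = l ^ x" "sylow_subgroup l G P"
  shows "N \<subseteq> P"
proof -
  let ?G = "GL\<lparr>carrier := G\<rparr>"
  interpret G: group ?G
    using GL.subgroup_imp_group[OF assms(2)] .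
  have N: "subgroup N ?G"
    using GL.subgroup_incl[OF assms(4,2,5)] .
  have P: "subgroup P ?G" "card P = l ^ multiplicity l (order ?G)"
    using assms(8) GL.subgroup_incl[of P G] assms(2) by (auto simp: sylow_subgroup_def order_def)
  have "N \<lhd> ?G"
    unfolding G.normal_inv_iff
    using N assms(6) GL.m_inv_consistent[OF assms(2)] by simp
  from G.normal_prime_power_le_sylow[OF _ assms(1) this assms(7) P] show ?thesis
    using assms(3) by simp
qed

text \<open>A Sylow subgroup of \<open>H\<close> has the order required in \<open>G\<close> once the
  l-parts of the two orders agree, so containment becomes a comparison of orders.\<close>

lemma contains_sylowI:
  fixes G :: "(complex ^ 'n::finite \<Rightarrow> complex ^ 'n) set"
  assumes "prime l" "subgroup H GL" "H \<subseteq> G" "finite H"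
    "multiplicity l (card H) = multiplicity l (card G)"
  shows "contains_sylow l G H"
proof -
  let ?H = "GL\<lparr>carrier := H\<rparr>"
  have "l ^ multiplicity l (card H) dvd order ?H"
    by (simp add: order_def multiplicity_dvd)
  then obtain r where "order ?H = l ^ multiplicity l (card H) * r"
    by blast
  then obtain P where P: "subgroup P ?H" "card P = l ^ multiplicity l (card H)"
    using sylow_thm[OF assms(1) GL.subgroup_imp_group[OF assms(2)]] assms(4) by auto
  have "P \<subseteq> H"
    using subgroup.subset[OF P(1)] by simp
  moreover have "subgroup P GL"
    using GL.incl_subgroup[OF assms(2) P(1)] .
  ultimately show ?thesis
    using P(2) assms(3,4,5) unfolding contains_sylow_def sylow_subgroup_def
    by (auto intro: finite_subset)
qed

text \<open>Here \<open>g\<close> only has to conjugate \<open>G\<close> into itself; this covers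
  \<theta>_\<alpha>, which normalises G(m,p,n) without having to belong to it.\<close>

lemma conjugate_reflection_subgroup:
  assumes "subgroup G GL" "g \<in> carrier GL" "conjugate_subgroup g G \<subseteq> G" "reflection_subgroup G H"
  shows "reflection_subgroup G (conjugate_subgroup g H)"
proof -
  interpret c: group_hom GL GL "\<lambda>h. g \<circ> h \<circ> inv\<^bsub>GL\<^esub> g"
    by (rule conjugation_hom[OF assms(2)])
  obtain S where S: "\<forall>f\<in>S. complex_reflection f" "H = generate GL S"
    using assms(4) by (auto simp: reflection_subgroup_def)
  have "conjugate_subgroup g H = generate GL ((\<lambda>h. g \<circ> h \<circ> inv\<^bsub>GL\<^esub> g) ` S)"
    unfolding conjugate_subgroup_image S(2)
    using S(1) complex_reflection_in_GL by (intro c.generate_img[symmetric]) auto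
  moreover have "\<forall>f\<in>(\<lambda>h. g \<circ> h \<circ> inv\<^bsub>GL\<^esub> g) ` S. complex_reflection f"
    using S(1) complex_reflection_conjugate[OF assms(2)] by auto
  moreover have "subgroup (conjugate_subgroup g H) GL"
    using assms(4) subgroup_conjugate[OF assms(2)] by (simp add: reflection_subgroup_def)
  moreover have "conjugate_subgroup g H \<subseteq> G"
    using assms(3,4) conjugate_subgroup_mono[of H G g] by (simp add: reflection_subgroup_def)
  ultimately show ?thesis
    unfolding reflection_subgroup_def by blast
qed

lemma conjugate_contains_sylow:
  assumes "subgroup G GL" "g \<in> G" "contains_sylow l G H"
  shows "contains_sylow l G (conjugate_subgroup g H)"
proof -
  have g: "g \<in> carrier GL"
    using subgroup.mem_carrier[OF assms(1,2)] .
  obtain P where P: "sylow_subgroup l G P" "P \<subseteq> H"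
    using assms(3) by (auto simp: contains_sylow_def)
  have "conjugate_subgroup g P \<subseteq> conjugate_subgroup g G"
    using P(1) by (auto simp: sylow_subgroup_def intro!: conjugate_subgroup_mono)
  then have "sylow_subgroup l G (conjugate_subgroup g P)"
    using P(1) subgroup_conjugate[OF g, of P] card_conjugate_subgroup[OF g, of P]
      conjugate_subgroup_of_member[OF assms(1,2)]
    by (auto simp: sylow_subgroup_def conjugate_subgroup_image)
  then show ?thesis
    using conjugate_subgroup_mono[OF P(2), of g] unfolding contains_sylow_def by blast
qed

text \<open>The common order \<open>N\<close> makes minimality automatic: a smaller candidate would
  contain a conjugate of some \<open>X s\<close>, of the same order as the group it sits in. The
  main task for a specific family is therefore \<open>below\<close>.\<close>

lemma sylow_reflection_classes_eq:
  fixes G :: "(complex ^ 'n::finite \<Rightarrow> complex ^ 'n) set"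
  assumes G: "subgroup G GL" "finite G"
    and X: "\<And>t. t \<in> I \<Longrightarrow> reflection_subgroup G (X t)" "\<And>t. t \<in> I \<Longrightarrow> contains_sylow l G (X t)"
      "\<And>t. t \<in> I \<Longrightarrow> card (X t) = N"
    and below: "\<And>K. reflection_subgroup G K \<Longrightarrow> contains_sylow l G K \<Longrightarrow>
      \<exists>t\<in>I. \<exists>g\<in>G. conjugate_subgroup g (X t) \<subseteq> K"
  shows "sylow_reflection_classes l G = {conjugacy_class G (X t) | t. t \<in> I}"
proof -
  note GL = subgroup.mem_carrier[OF G(1)]
  have minimal: "minimal_sylow_reflection_subgroup l G (conjugate_subgroup g (X t))"
    if "t \<in> I" "g \<in> G" for t g
    unfolding minimal_sylow_reflection_subgroup_def
  proof (intro conjI allI impI)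
    show refl: "reflection_subgroup G (conjugate_subgroup g (X t))"
      using that conjugate_reflection_subgroup[OF G(1) GL[of g]] conjugate_subgroup_of_member[OF G(1)] X(1)
      by auto
    show "contains_sylow l G (conjugate_subgroup g (X t))"
      using that conjugate_contains_sylow[OF G(1)] X(2) by auto
    fix K assume K: "reflection_subgroup G K \<and> contains_sylow l G K \<and> K \<subseteq> conjugate_subgroup g (X t)"
    then obtain s h where sh: "s \<in> I" "h \<in> G" "conjugate_subgroup h (X s) \<subseteq> K"
      using below by blast
    \<comment> \<open>The index \<open>s\<close> may differ from \<open>t\<close>; the two
      conjugates agree by inclusion and equal cardinality.\<close>
    have "finite (conjugate_subgroup g (X t))"
      using refl G(2) by (auto simp: reflection_subgroup_def intro: finite_subset)
    moreover have "card (conjugate_subgroup h (X s)) = card (conjugate_subgroup g (X t))"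
      using that sh X(3) card_conjugate_subgroup GL by metis
    ultimately have "conjugate_subgroup h (X s) = conjugate_subgroup g (X t)"
      using sh(3) K by (intro card_subset_eq) auto
    then show "K = conjugate_subgroup g (X t)"
      using sh(3) K by auto
  qed
  have id: "id \<in> G"
    using subgroup.one_closed[OF G(1)] by simp
  show ?thesis
  proof (intro equalityI subsetI)
    fix C assume "C \<in> sylow_reflection_classes l G"
    then obtain H where H: "C = conjugacy_class G H" "\<forall>H\<in>C. minimal_sylow_reflection_subgroup l G H"
      by (auto simp: sylow_reflection_classes_def)
    have "H \<in> C"
      unfolding H(1) conjugacy_class_def using id by (auto intro: exI[of _ id])
    then have min: "minimal_sylow_reflection_subgroup l G H"
      using H(2) by blast
    then obtain t g where tg: "t \<in> I" "g \<in> G" "conjugate_subgroup g (X t) \<subseteq> H"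
      using below unfolding minimal_sylow_reflection_subgroup_def by blast
    then have eq: "H = conjugate_subgroup g (X t)"
      using min minimal[OF tg(1,2)] unfolding minimal_sylow_reflection_subgroup_def by blast
    have "conjugacy_class G H = conjugacy_class G (X t)"
    proof (intro equalityI subsetI)
      fix K assume "K \<in> conjugacy_class G H"
      then obtain h where "h \<in> G" "K = conjugate_subgroup h H"
        by (auto simp: conjugacy_class_def)
      then have "K = conjugate_subgroup (h \<circ> g) (X t)" "h \<circ> g \<in> G"
        using eq tg(2) GL subgroup.m_closed[OF G(1), of h g] by (auto simp: conjugate_subgroup_comp)
      then show "K \<in> conjugacy_class G (X t)"
        by (auto simp: conjugacy_class_def)
    next
      fix K assume "K \<in> conjugacy_class G (X t)"
      then obtain h where h: "h \<in> G" "K = conjugate_subgroup h (X t)"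
        by (auto simp: conjugacy_class_def)
      have inv: "inv\<^bsub>GL\<^esub> g \<in> G"
        using subgroup.m_inv_closed[OF G(1) tg(2)] .
      have "conjugate_subgroup (h \<circ> inv\<^bsub>GL\<^esub> g) H = conjugate_subgroup h (conjugate_subgroup (inv\<^bsub>GL\<^esub> g \<circ> g) (X t))"
        unfolding eq using h inv tg(2) GL by (simp only: conjugate_subgroup_comp)
      then have "K = conjugate_subgroup (h \<circ> inv\<^bsub>GL\<^esub> g) H"
        using h(2) GL[OF tg(2)] by simp
      moreover have "h \<circ> inv\<^bsub>GL\<^esub> g \<in> G"
        using subgroup.m_closed[OF G(1) h(1) inv] by simp
      ultimately show "K \<in> conjugacy_class G H"
        by (auto simp: conjugacy_class_def)
    qed
    then show "C \<in> {conjugacy_class G (X t) | t. t \<in> I}"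
      using H(1) tg(1) by auto
  next
    fix C assume "C \<in> {conjugacy_class G (X t) | t. t \<in> I}"
    then show "C \<in> sylow_reflection_classes l G"
      using X(1) minimal by (auto simp: sylow_reflection_classes_def conjugacy_class_def)
  qed
qed


section \<open>Reflections in monomial groups\<close>

text \<open>For \<open>i \<noteq> j\<close> this reflection sends \<open>e_i\<close> to
  \<open>z e_j\<close> and \<open>e_j\<close> to \<open>z^-1 e_i\<close>. Regard \<open>z\<close> as
  a label on the edge from \<open>i\<close> to \<open>j\<close>; reversal inverts it. The diagonal
  entries multiply to 1, so the determinant condition holds for every \<open>p\<close>.\<close>

definition swap_map :: "'n::finite \<Rightarrow> 'n \<Rightarrow> complex \<Rightarrow> complex ^ 'n \<Rightarrow> complex ^ 'n" where
  "swap_map i j z = monomial_map ((\<lambda>_. 1)(i := inverse z, j := z)) (Transposition.transpose i j)"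

lemma bij_transpose [simp]: "bij (Transposition.transpose i j)"
  by (simp add: permutes_bij permutes_swap_id flip: permutes_UNIV_iff)

lemma inv_transpose [simp]: "inv_into UNIV (Transposition.transpose i j) = Transposition.transpose i j"
  by (rule inv_unique_comp) simp_all

lemma swap_map_nth:
  "i \<noteq> j \<Longrightarrow> swap_map i j z v $ x = (if x = i then inverse z * v $ j else if x = j then z * v $ i else v $ x)"
  by (auto simp: swap_map_def monomial_map_def Transposition.transpose_def)

lemma swap_map_in_GL: "z \<noteq> 0 \<Longrightarrow> swap_map i j z \<in> carrier GL"
  by (auto simp: swap_map_def intro!: monomial_map_in_GL split: if_splits)

lemma swap_map_commute: "i \<noteq> j \<Longrightarrow> swap_map i j z = swap_map j i (inverse z)"
  by (auto simp: fun_eq_iff vec_eq_iff swap_map_nth)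

text \<open>Conjugation by the involution \<open>swap_map j k y\<close> replaces the edge from
  \<open>i\<close> to \<open>j\<close> by one from \<open>i\<close> to \<open>k\<close>, and labels
  multiply along the path.\<close>

lemma swap_map_comp:
  assumes "i \<noteq> j" "j \<noteq> k" "i \<noteq> k" "y \<noteq> 0" "z \<noteq> 0"
  shows "swap_map j k y \<circ> swap_map i j z \<circ> swap_map j k y = swap_map i k (z * y)"
  using assms by (auto simp: fun_eq_iff vec_eq_iff swap_map_nth)

lemma complex_reflection_swap_map:
  assumes "i \<noteq> j" "z \<noteq> 0"
  shows "complex_reflection (swap_map i j z)"
proof -
  have lin: "Vector_Spaces.linear (*s) (*s) (swap_map i j z)"
    using swap_map_in_GL[OF assms(2), of i j] by (simp add: carrier_GL)
  have "swap_map i j z \<circ> swap_map i j z = id"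
    using assms by (auto simp: fun_eq_iff vec_eq_iff swap_map_nth)
  then have "swap_map i j z ^^ 2 = id"
    by (simp add: numeral_2_eq_2)
  moreover have "vec.dim {v. swap_map i j z v = v} + 1 = CARD('a)"
  proof (rule dim_fix_of_line[OF lin, of "axis i 1"])
    have "swap_map i j z (axis i 1) $ i \<noteq> axis i 1 $ i"
      using assms by (simp add: swap_map_nth axis_def)
    then show "swap_map i j z (axis i 1) \<noteq> axis i 1"
      by metis
    fix v
    have "swap_map i j z v - v = (v $ i - inverse z * v $ j) *s (swap_map i j z (axis i 1) - axis i 1)"
      using assms by (auto simp: vec_eq_iff swap_map_nth axis_def algebra_simps)
    then show "\<exists>a. swap_map i j z v - v = a *s (swap_map i j z (axis i 1) - axis i 1)"
      by blast
  qed
  ultimately show ?thesis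
    using lin unfolding complex_reflection_def by (metis zero_less_numeral)
qed

definition diag_at :: "'n::finite \<Rightarrow> complex \<Rightarrow> complex ^ 'n \<Rightarrow> complex ^ 'n" where
  "diag_at i z = monomial_map ((\<lambda>_. 1)(i := z)) id"

lemma diag_at_nth: "diag_at i z v $ x = (if x = i then z * v $ i else v $ x)"
  by (auto simp: diag_at_def monomial_map_def)

lemma complex_reflection_diag_at:
  assumes "z \<noteq> 1" "z ^ k = 1" "k > 0"
  shows "complex_reflection (diag_at i z)"
proof -
  have "z \<noteq> 0"
    using assms by (auto simp: zero_power)
  then have lin: "Vector_Spaces.linear (*s) (*s) (diag_at i z)"
    using monomial_map_in_GL[of id "(\<lambda>_. 1)(i := z)"] by (simp add: carrier_GL diag_at_def)
  have "(diag_at i z ^^ r) v $ x = (if x = i then z ^ r * v $ i else v $ x)" for r v x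
    by (induction r) (auto simp: diag_at_nth)
  then have "diag_at i z ^^ k = id"
    using assms(2) by (auto simp: fun_eq_iff vec_eq_iff)
  moreover have "vec.dim {v. diag_at i z v = v} + 1 = CARD('a)"
  proof (rule dim_fix_of_line[OF lin, of "axis i 1"])
    have "diag_at i z (axis i 1) $ i \<noteq> axis i 1 $ i"
      using assms by (simp add: diag_at_nth axis_def)
    then show "diag_at i z (axis i 1) \<noteq> axis i 1"
      by metis
    fix v
    have "diag_at i z v - v = (v $ i) *s (diag_at i z (axis i 1) - axis i 1)"
      using assms by (auto simp: vec_eq_iff diag_at_nth axis_def algebra_simps)
    then show "\<exists>a. diag_at i z v - v = a *s (diag_at i z (axis i 1) - axis i 1)"
      by blast
  qed
  ultimately show ?thesis
    using lin assms(3) unfolding complex_reflection_def by blast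
qed

lemma diag_at_one [simp]: "diag_at i 1 = id"
  by (auto simp: fun_eq_iff vec_eq_iff diag_at_nth)

text \<open>The columns of the matrix of \<open>f - id\<close> are proportional. If
  \<open>\<pi> = id\<close>, at most one is nonzero; if \<open>\<pi>\<close> moves \<open>i\<close>,
  the column at \<open>i\<close> has support \<open>{i, \<pi> i}\<close>, so nothing else moves and
  \<open>\<pi>\<close> is a transposition.\<close>

lemma complex_reflection_monomial_map_cases:
  fixes \<theta> :: "'n::finite \<Rightarrow> complex"
  assumes refl: "complex_reflection (monomial_map \<theta> \<pi>)" and "bij \<pi>" and nz: "\<And>i. \<theta> i \<noteq> 0"
  obtains (diag) i where "\<pi> = id" "\<theta> = (\<lambda>_. 1)(i := \<theta> i)"
  | (swap) i j where "i \<noteq> j" "\<pi> = Transposition.transpose i j" "monomial_map \<theta> \<pi> = swap_map i j (\<theta> j)"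
      "\<theta> = (\<lambda>_. 1)(i := inverse (\<theta> j), j := \<theta> j)"
proof -
  have inj: "inj \<pi>"
    using \<open>bij \<pi>\<close> by (rule bij_is_inj)
  obtain w where "\<forall>v. \<exists>a. monomial_map \<theta> \<pi> v - v = a *s w"
    using dim_fix_imp_line refl unfolding complex_reflection_def by blast
  then have "\<forall>j. \<exists>a. monomial_map \<theta> \<pi> (axis j 1) - axis j 1 = a *s w"
    by blast
  then obtain a where a0: "\<And>j. monomial_map \<theta> \<pi> (axis j 1) - axis j 1 = a j *s w"
    by metis
  then have a: "(if x = \<pi> j then \<theta> (\<pi> j) else 0) - (if x = j then 1 else 0) = a j * w $ x" for j x
  proof -
    have "axis (\<pi> j) (\<theta> (\<pi> j)) $ x - axis j 1 $ x = a j * w $ x"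
      using arg_cong[OF a0[of j], of "\<lambda>v. v $ x"] \<open>bij \<pi>\<close> by (simp add: monomial_map_axis)
    then show ?thesis
      by (simp add: axis_def)
  qed
  show ?thesis
  proof (cases "\<pi> = id")
    case True
    show ?thesis
    proof (cases "\<exists>i. \<theta> i \<noteq> 1")
      case False
      then have "\<theta> = (\<lambda>_. 1)(i := \<theta> i)" for i
        by (auto simp: fun_eq_iff)
      then show ?thesis
        using True diag by blast
    next
      case th: True
      then obtain i where i: "\<theta> i \<noteq> 1"
        by blast
      have "a i \<noteq> 0"
        using a[of i i] i True by auto
      have "w $ x = 0" if "x \<noteq> i" for x
        using a[of x i] that True \<open>a i \<noteq> 0\<close> by auto
      then have "\<theta> j = 1" if "j \<noteq> i" for j
        using a[of j j] that True by auto
      then have "\<theta> = (\<lambda>_. 1)(i := \<theta> i)"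
        by (auto simp: fun_eq_iff)
      then show ?thesis
        using True diag by blast
    qed
  next
    case False
    then obtain i where i: "\<pi> i \<noteq> i"
      by (auto simp: fun_eq_iff)
    define k where "k = \<pi> i"
    have ai: "a i \<noteq> 0"
      using a[of i i] i by auto
    have w0: "w $ x = 0" if "x \<noteq> i" "x \<noteq> k" for x
      using a[of x i] that ai by (auto simp: k_def)
    have fixed: "\<pi> j = j" "\<theta> j = 1" if "j \<noteq> i" "j \<noteq> k" for j
    proof -
      show "\<pi> j = j"
        using a[of j j] w0[OF that] by (auto split: if_splits)
      then show "\<theta> j = 1"
        using a[of j j] w0[OF that] by auto
    qed
    have ik: "i \<noteq> k" "\<pi> i = k"
      using i by (auto simp: k_def)
    have "\<pi> k \<noteq> k"
      using inj ik by (metis injD)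
    then have ki: "\<pi> k = i"
      using fixed(1)[of "\<pi> k"] inj by (metis injD)
    \<comment> \<open>On the two moved coordinates \<open>f - id\<close> has diagonal entries -1 and
      off-diagonal entries \<open>\<theta> i\<close> and \<open>\<theta> k\<close>; rank one makes
      this minor vanish, so \<open>\<theta> i * \<theta> k = 1\<close>.\<close>
    have ww: "\<theta> k = a i * w $ k" "\<theta> i = a k * w $ i" and "a i * w $ i = - 1" "a k * w $ k = - 1"
      using a[of k i] a[of i i] a[of k k] a[of i k] ik ki by auto
    have "\<theta> i * \<theta> k = (a k * w $ k) * (a i * w $ i)"
      by (simp only: ww mult_ac)
    then have "\<theta> i * \<theta> k = 1"
      unfolding \<open>a i * w $ i = - 1\<close> \<open>a k * w $ k = - 1\<close> by simp
    then have th: "\<theta> = (\<lambda>_. 1)(i := inverse (\<theta> k), k := \<theta> k)"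
      using fixed(2) nz by (auto simp: fun_eq_iff field_simps)
    have "\<pi> = Transposition.transpose i k"
      using fixed(1) ik ki by (auto simp: fun_eq_iff Transposition.transpose_def)
    moreover from this th have "monomial_map \<theta> \<pi> = swap_map i k (\<theta> k)"
      unfolding swap_map_def by metis
    ultimately show ?thesis
      using swap ik(1) th by blast
  qed
qed


section \<open>The diagonal parts and the label groups\<close>

definition A_fun :: "nat \<Rightarrow> nat \<Rightarrow> ('n::finite \<Rightarrow> complex) set" where
  "A_fun m p = {\<theta>. (\<forall>i. \<theta> i ^ m = 1) \<and> (\<Prod>i\<in>UNIV. \<theta> i) ^ (m div p) = 1}"

lemma A_group_eq: "A_group m p = diag_map ` A_fun m p"
  by (auto simp: A_group_def A_fun_def prod_power_distrib)

lemma root_of_unity_nonzero: "(z :: complex) ^ m = 1 \<Longrightarrow> m > 0 \<Longrightarrow> z \<noteq> 0"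
  by (auto simp: zero_power)

lemma A_fun_nonzero: "m > 0 \<Longrightarrow> \<theta> \<in> A_fun m p \<Longrightarrow> \<theta> i \<noteq> 0"
  using root_of_unity_nonzero[of "\<theta> i" m] by (auto simp: A_fun_def)

lemma label_perms_UNIV: "label_perms c UNIV = {\<pi>. bij \<pi> \<and> (\<forall>i. c (\<pi> i) = c i)}"
  by (simp add: label_perms_def permutes_UNIV_iff)

text \<open>Specialises to the groups of the proof: constant \<open>c\<close> gives G(m,p,n),
  \<open>c = id\<close> its diagonal subgroup, and \<open>p = 1\<close> with
  \<open>c = block_of P\<close> the product over blocks. The determinant condition is imposed on the
  whole product, not on each class.\<close>

definition label_group :: "nat \<Rightarrow> nat \<Rightarrow> ('n::finite \<Rightarrow> 'r) \<Rightarrow> (complex ^ 'n \<Rightarrow> complex ^ 'n) set" where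
  "label_group m p c = monomial_set (A_fun m p) (label_perms c UNIV)"

lemma G_group_eq:
  "(G_group m p :: (complex ^ 'n::finite \<Rightarrow> complex ^ 'n) set) = label_group m p (\<lambda>_. ())"
proof -
  have "(G_group m p :: (complex ^ 'n \<Rightarrow> complex ^ 'n) set) = {diag_map \<theta> \<circ> perm_map \<pi> | \<theta> \<pi>. \<theta> \<in> A_fun m p \<and> bij \<pi>}"
    by (auto simp: G_group_def A_group_eq set_mult_def permutes_UNIV_iff)
  also have "\<dots> = {monomial_map \<theta> \<pi> | \<theta> \<pi>. \<theta> \<in> A_fun m p \<and> bij \<pi>}"
  proof -
    have "diag_map \<theta> \<circ> perm_map \<pi> = monomial_map \<theta> \<pi>" if "bij \<pi>" for \<theta> and \<pi> :: "'n \<Rightarrow> 'n"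
      using that by (simp add: diag_map_eq perm_map_eq monomial_map_comp)
    then show ?thesis
      by (intro Collect_cong ex_cong1) auto
  qed
  also have "\<dots> = label_group m p (\<lambda>_. ())"
    by (simp add: label_group_def monomial_set_def label_perms_UNIV)
  finally show ?thesis .
qed

lemma finite_roots_functions:
  assumes "m > 0"
  shows "finite {\<theta> :: 'n::finite \<Rightarrow> complex. \<forall>i. \<theta> i ^ m = 1}"
proof -
  have "finite (PiE (UNIV :: 'n set) (\<lambda>_. {z :: complex. z ^ m = 1}))"
    using assms by (intro finite_PiE finite_roots_unity) auto
  then show ?thesis
    by (simp add: PiE_UNIV_domain Pi_def)
qed

lemma finite_A_fun: "m > 0 \<Longrightarrow> finite (A_fun m p :: ('n::finite \<Rightarrow> complex) set)"
  by (rule finite_subset[OF _ finite_roots_functions[of m]]) (auto simp: A_fun_def)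

lemma finite_label_group: "m > 0 \<Longrightarrow> finite (label_group m p c)"
  by (simp add: label_group_def finite_monomial_set finite_A_fun)

lemma card_label_group:
  assumes "m > 0"
  shows "card (label_group m p (c :: 'n::finite \<Rightarrow> 'r)) = card (A_fun m p :: ('n \<Rightarrow> complex) set) * card (label_perms c UNIV)"
  unfolding label_group_def
  using assms by (intro card_monomial_set) (auto simp: label_perms_UNIV A_fun_nonzero)

text \<open>Trading the entry at one index \<open>e\<close> for the product of all entries makes the
  coordinates independent: \<open>m\<close> choices away from \<open>e\<close>, and
  \<open>m div p\<close> at \<open>e\<close>.\<close>

lemma card_A_fun:
  assumes "m > 0" "p dvd m"
  shows "card (A_fun m p :: ('n::finite \<Rightarrow> complex) set) = m ^ (CARD('n) - 1) * (m div p)"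
proof -
  obtain e :: 'n where True
    by simp
  define R where "R i = {z :: complex. z ^ (if i = e then m div p else m) = 1}" for i
  let ?P = "PiE UNIV R"
  let ?q = "\<lambda>\<theta>. \<Prod>i\<in>UNIV - {e}. \<theta> i :: complex"
  have p: "p > 0" "m = p * (m div p)" "m div p > 0"
    using assms by (auto intro: dvd_pos_nat simp: dvd_imp_le)
  have split: "(\<Prod>i\<in>UNIV. \<theta> i) = \<theta> e * ?q \<theta>" for \<theta> :: "'n \<Rightarrow> complex"
    by (rule prod.remove) auto
  have upd: "?q (\<theta>(e := z)) = ?q \<theta>" for \<theta> :: "'n \<Rightarrow> complex" and z
    by (intro prod.cong) auto
  have qm: "?q \<theta> ^ m = 1" if "\<And>i. i \<noteq> e \<Longrightarrow> \<theta> i ^ m = 1" for \<theta> :: "'n \<Rightarrow> complex"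
    unfolding prod_power_distrib using that by (intro prod.neutral) auto
  have q0: "?q \<theta> \<noteq> 0" if "\<And>i. i \<noteq> e \<Longrightarrow> \<theta> i ^ m = 1" for \<theta> :: "'n \<Rightarrow> complex"
    using qm[OF that] assms(1) by (rule root_of_unity_nonzero)
  have "bij_betw (\<lambda>\<theta>. \<theta>(e := \<Prod>i\<in>UNIV. \<theta> i)) (A_fun m p) ?P"
  proof (rule bij_betw_byWitness[where f' = "\<lambda>\<eta>. \<eta>(e := \<eta> e / ?q \<eta>)"])
    show "\<forall>\<theta>\<in>A_fun m p. (\<theta>(e := prod \<theta> UNIV))(e := (\<theta>(e := prod \<theta> UNIV)) e / ?q (\<theta>(e := prod \<theta> UNIV))) = \<theta>"
    proof
      fix \<theta> :: "'n \<Rightarrow> complex" assume "\<theta> \<in> A_fun m p"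
      then have "?q \<theta> \<noteq> 0"
        by (intro q0) (auto simp: A_fun_def)
      then show "(\<theta>(e := prod \<theta> UNIV))(e := (\<theta>(e := prod \<theta> UNIV)) e / ?q (\<theta>(e := prod \<theta> UNIV))) = \<theta>"
        unfolding upd by (auto simp: split)
    qed
    have Pm: "\<eta> i ^ m = 1" if "\<eta> \<in> ?P" "i \<noteq> e" for \<eta> i
      using that by (auto simp: R_def PiE_UNIV_domain Pi_def split: if_splits)
    show "\<forall>\<eta>\<in>?P. (\<eta>(e := \<eta> e / ?q \<eta>))(e := prod (\<eta>(e := \<eta> e / ?q \<eta>)) UNIV) = \<eta>"
    proof
      fix \<eta> assume "\<eta> \<in> ?P"
      then have "?q \<eta> \<noteq> 0"
        by (intro q0 Pm)
      then show "(\<eta>(e := \<eta> e / ?q \<eta>))(e := prod (\<eta>(e := \<eta> e / ?q \<eta>)) UNIV) = \<eta>"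
        unfolding split upd by auto
    qed
    show "(\<lambda>\<theta>. \<theta>(e := prod \<theta> UNIV)) ` A_fun m p \<subseteq> ?P"
      by (auto simp: A_fun_def R_def PiE_UNIV_domain Pi_def)
    show "(\<lambda>\<eta>. \<eta>(e := \<eta> e / ?q \<eta>)) ` ?P \<subseteq> A_fun m p"
    proof clarify
      fix \<eta> assume \<eta>: "\<eta> \<in> ?P"
      have q: "?q \<eta> \<noteq> 0" "?q \<eta> ^ m = 1"
        by (rule q0, erule Pm[OF \<eta>]) (rule qm, erule Pm[OF \<eta>])
      have e: "\<eta> e ^ (m div p) = 1"
        using \<eta> by (auto simp: R_def PiE_UNIV_domain Pi_def dest!: spec[of _ e])
      then have "\<eta> e ^ m = 1"
        using p(2) by (metis mult.commute power_mult power_one)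
      then have "(\<eta>(e := \<eta> e / ?q \<eta>)) i ^ m = 1" for i
        using q Pm[OF \<eta>] by (auto simp: power_divide)
      moreover have "prod (\<eta>(e := \<eta> e / ?q \<eta>)) UNIV = \<eta> e"
        unfolding split upd using q by simp
      ultimately show "\<eta>(e := \<eta> e / ?q \<eta>) \<in> A_fun m p"
        using e by (simp add: A_fun_def)
    qed
  qed
  then have "card (A_fun m p :: ('n \<Rightarrow> complex) set) = card ?P"
    by (rule bij_betw_same_card)
  also have "\<dots> = (\<Prod>i\<in>UNIV. card (R i))"
    by (rule card_PiE) simp
  also have "\<dots> = card (R e) * (\<Prod>i\<in>UNIV - {e}. card (R i))"
    by (rule prod.remove) auto
  also have "(\<Prod>i\<in>UNIV - {e}. card (R i)) = (\<Prod>i\<in>UNIV - {e}. m)"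
    using assms(1) by (intro prod.cong refl) (auto simp: R_def card_roots_unity_eq)
  also have "card (R e) = m div p"
    using p(3) by (simp add: R_def card_roots_unity_eq)
  finally show ?thesis
    by (simp add: card_Diff_subset mult.commute)
qed

text \<open>The value involves \<open>m\<close> and \<open>p\<close> only through their
  multiplicities, so it is unchanged when they are replaced by their l-parts.\<close>

lemma multiplicity_card_A_fun:
  assumes "prime l" "m > 0" "p dvd m"
  shows "multiplicity l (card (A_fun m p :: ('n::finite \<Rightarrow> complex) set)) =
    (CARD('n) - 1) * multiplicity l m + (multiplicity l m - multiplicity l p)"
proof -
  obtain r where r: "m = p * r"
    using assms(3) by blast
  then have "p > 0" "r > 0"
    using assms(2) by auto
  moreover have "multiplicity l m = multiplicity l p + multiplicity l r"
    unfolding r using assms(1) \<open>p > 0\<close> \<open>r > 0\<close> by (intro prime_elem_multiplicity_mult_distrib) auto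
  moreover have "multiplicity l (card (A_fun m p :: ('n \<Rightarrow> complex) set)) =
      multiplicity l (m ^ (CARD('n) - 1)) + multiplicity l r"
    unfolding card_A_fun[OF assms(2,3)] using assms(1,2) \<open>p > 0\<close> \<open>r > 0\<close>
    by (subst prime_elem_multiplicity_mult_distrib) (auto simp: r)
  ultimately show ?thesis
    using assms(1,2) by (simp add: prime_elem_multiplicity_power_distrib)
qed

section \<open>Subgroup property and generation of label groups\<close>

lemma prod_comp_bij:
  fixes \<theta> :: "'n::finite \<Rightarrow> complex"
  assumes "bij \<pi>"
  shows "(\<Prod>i\<in>UNIV. \<theta> (\<pi> i)) = (\<Prod>i\<in>UNIV. \<theta> i)"
  using prod.reindex_bij_betw[OF assms] .

lemma label_perms_inv:
  assumes "\<pi> \<in> label_perms c UNIV"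
  shows "inv_into UNIV \<pi> \<in> label_perms c UNIV"
proof -
  have "c (inv_into UNIV \<pi> i) = c i" for i
    using assms by (metis (mono_tags, lifting) bij_inv_eq_iff label_perms_UNIV mem_Collect_eq)
  then show ?thesis
    using assms by (auto simp: label_perms_UNIV bij_imp_bij_inv)
qed

lemma subgroup_label_group:
  assumes "m > 0"
  shows "subgroup (label_group m p c) GL"
  unfolding label_group_def
proof (rule subgroup_monomial_set)
  show "inv_into UNIV \<pi> \<in> label_perms c UNIV" if "\<pi> \<in> label_perms c UNIV" for \<pi>
    using label_perms_inv[OF that] .
  show "(\<lambda>i. \<theta> (\<pi> i)) \<in> A_fun m p" if "\<theta> \<in> A_fun m p" "\<pi> \<in> label_perms c UNIV" for \<theta> \<pi>
    using that by (auto simp: A_fun_def label_perms_UNIV prod_comp_bij)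
  show "(\<lambda>i. \<theta> i * \<eta> i) \<in> A_fun m p" if "\<theta> \<in> A_fun m p" "\<eta> \<in> A_fun m p" for \<theta> \<eta>
    using that by (auto simp: A_fun_def power_mult_distrib prod.distrib)
  show "(\<lambda>i. inverse (\<theta> i)) \<in> A_fun m p" if "\<theta> \<in> A_fun m p" for \<theta>
  proof -
    have "(\<Prod>i\<in>UNIV. inverse (\<theta> i)) = inverse (\<Prod>i\<in>UNIV. \<theta> i)"
      using prod_inversef[of \<theta> UNIV] by (simp add: comp_def)
    then show ?thesis
      using that by (simp add: A_fun_def power_inverse)
  qed
  show "\<theta> i \<noteq> 0" if "\<theta> \<in> A_fun m p" for \<theta> i
    using A_fun_nonzero[OF assms that] .
qed (auto simp: A_fun_def label_perms_UNIV bij_comp)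

text \<open>Stated for an arbitrary index set: with \<open>a\<close> and \<open>b\<close> mutually
  inverse, the product is 1 if the set contains both or neither of \<open>i\<close>,
  \<open>j\<close>, and otherwise an entry survives. This is how components are told apart.\<close>

lemma prod_two_updates:
  fixes a b :: complex
  assumes "finite C" "i \<noteq> j"
  shows "(\<Prod>x\<in>C. ((\<lambda>_. 1)(i := a, j := b)) x) = (if i \<in> C then a else 1) * (if j \<in> C then b else 1)"
proof -
  have "((\<lambda>_. 1)(i := a, j := b)) x = (if x = i then a else 1) * (if x = j then b else 1)" for x
    using assms(2) by auto
  then show ?thesis
    using assms(1) by (simp only: prod.distrib) simp
qed

lemma prod_one_update:
  fixes a :: complex
  assumes "finite C"
  shows "(\<Prod>x\<in>C. ((\<lambda>_. 1)(i := a)) x) = (if i \<in> C then a else 1)"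
  using assms by (simp add: fun_upd_def)

lemma swap_map_in_label_group:
  assumes "i \<noteq> j" "d i = d j" "z ^ q = 1" "q > 0"
  shows "swap_map i j z \<in> label_group q s d"
  unfolding swap_map_def label_group_def
proof (rule monomial_setI)
  have "z \<noteq> 0"
    using root_of_unity_nonzero[OF assms(3,4)] .
  then have "(\<Prod>x\<in>UNIV. ((\<lambda>_. 1)(i := inverse z, j := z)) x) = 1"
    using prod_two_updates[OF finite assms(1), where C = UNIV] by simp
  then show "(\<lambda>_. 1)(i := inverse z, j := z) \<in> A_fun q s"
    using assms(3) by (auto simp: A_fun_def power_inverse)
  show "Transposition.transpose i j \<in> label_perms d UNIV"
    using assms(2) by (auto simp: label_perms_UNIV Transposition.transpose_def)
qed

lemma diag_at_in_label_group:
  assumes "z ^ q = 1" "z ^ (q div s) = 1"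
  shows "diag_at i z \<in> label_group q s d"
  unfolding diag_at_def label_group_def using assms
  by (intro monomial_setI) (auto simp: A_fun_def label_perms_UNIV prod_one_update[where C = UNIV])

text \<open>The map is \<open>\<pi>\<close> conjugated by the diagonal map of \<open>D\<close>, and
  the given swaps are transpositions conjugated likewise. Transpositions within classes generate;
  the induction counts moved points.\<close>

lemma twisted_perms_in_subgroup:
  fixes D :: "'n::finite \<Rightarrow> complex"
  assumes K: "subgroup K GL" and D: "\<And>i. D i \<noteq> 0"
    and swaps: "\<And>i j. i \<noteq> j \<Longrightarrow> c i = c j \<Longrightarrow> swap_map i j (D j / D i) \<in> K"
    and "\<pi> \<in> label_perms c UNIV"
  shows "monomial_map (\<lambda>i. D i / D (inv_into UNIV \<pi> i)) \<pi> \<in> K"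
  using \<open>\<pi> \<in> label_perms c UNIV\<close>
proof (induction "card {x. \<pi> x \<noteq> x}" arbitrary: \<pi> rule: less_induct)
  case less
  have \<pi>: "bij \<pi>" "\<And>x. c (\<pi> x) = c x"
    using less.prems by (auto simp: label_perms_UNIV)
  show ?case
  proof (cases "\<pi> = id")
    case True
    then show ?thesis
      using subgroup.one_closed[OF K] D by simp
  next
    case False
    then obtain i where i: "\<pi> i \<noteq> i"
      by (auto simp: fun_eq_iff)
    define k where "k = \<pi> i"
    \<comment> \<open>Following \<open>\<pi>\<close> by the transposition of \<open>i\<close> and
      \<open>\<pi> i\<close> fixes \<open>i\<close> and keeps every point fixed by
      \<open>\<pi>\<close>.\<close>
    define \<rho> where "\<rho> = Transposition.transpose i k \<circ> \<pi>"
    have \<rho>: "bij \<rho>" "\<pi> = Transposition.transpose i k \<circ> \<rho>"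
      using \<pi>(1) by (simp_all add: \<rho>_def bij_comp flip: comp_assoc)
    have "c (\<rho> x) = c x" for x
      using \<pi>(2) by (auto simp: \<rho>_def k_def Transposition.transpose_def) metis
    then have lab: "\<rho> \<in> label_perms c UNIV"
      using \<rho>(1) by (simp add: label_perms_UNIV)
    have "\<rho> x = x" if "\<pi> x = x" for x
      using that i \<pi>(1) by (auto simp: \<rho>_def k_def Transposition.transpose_def dest: bij_is_inj injD)
    then have "{x. \<rho> x \<noteq> x} \<subseteq> {x. \<pi> x \<noteq> x}"
      by blast
    moreover have "i \<notin> {x. \<rho> x \<noteq> x}" "i \<in> {x. \<pi> x \<noteq> x}"
      using i by (auto simp: \<rho>_def k_def)
    ultimately have "{x. \<rho> x \<noteq> x} \<subset> {x. \<pi> x \<noteq> x}"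
      by blast
    then have "card {x. \<rho> x \<noteq> x} < card {x. \<pi> x \<noteq> x}"
      by (intro psubset_card_mono) auto
    from less.hyps[OF this lab]
    have IH: "monomial_map (\<lambda>x. D x / D (inv_into UNIV \<rho> x)) \<rho> \<in> K" .
    have "swap_map i k (D k / D i) = monomial_map (\<lambda>x. D x / D (Transposition.transpose i k x)) (Transposition.transpose i k)"
      unfolding swap_map_def using D i
      by (intro arg_cong2[where f = monomial_map]) (auto simp: fun_eq_iff k_def Transposition.transpose_def)
    then have "swap_map i k (D k / D i) \<circ> monomial_map (\<lambda>x. D x / D (inv_into UNIV \<rho> x)) \<rho> =
        monomial_map (\<lambda>x. D x / D (inv_into UNIV \<pi> x)) \<pi>"
      using \<rho> D by (simp add: monomial_map_comp o_inv_distrib)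
    then show ?thesis
      using subgroup.m_closed[OF K swaps[of i k] IH] i \<pi>(2)[of i] by (simp add: k_def)
  qed
qed

text \<open>Each entry away from \<open>e\<close> is produced by a pair \<open>z\<close>,
  \<open>inverse z\<close>. What is left to supply at \<open>e\<close> is the product of all
  entries, a q-th root of unity satisfying the determinant condition, which \<open>last\<close>
  provides.\<close>

lemma diag_maps_in_subgroup:
  fixes e :: "'n::finite"
  assumes K: "subgroup K GL" and "q > 0"
    and pairs: "\<And>i z. i \<noteq> e \<Longrightarrow> z ^ q = 1 \<Longrightarrow> monomial_map ((\<lambda>_. 1)(i := z, e := inverse z)) id \<in> K"
    and last: "\<And>z. z ^ q = 1 \<Longrightarrow> z ^ (q div s) = 1 \<Longrightarrow> diag_at e z \<in> K"
    and \<theta>: "\<theta> \<in> A_fun q s"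
  shows "monomial_map \<theta> id \<in> K"
proof -
  have nz: "\<theta> i \<noteq> 0" for i
    using \<theta> \<open>q > 0\<close> by (rule A_fun_nonzero[rotated])
  \<comment> \<open>Position \<open>e\<close> carries the inverse of the entries placed so far,
    keeping the total product 1.\<close>
  have partial: "monomial_map (\<lambda>i. if i \<in> F then \<theta> i else if i = e then inverse (\<Prod>j\<in>F. \<theta> j) else 1) id \<in> K"
    if "finite F" "e \<notin> F" for F
    using that
  proof (induction F rule: finite_induct)
    case empty
    have "(\<lambda>i. if i \<in> {} then \<theta> i else if i = e then inverse (\<Prod>j\<in>{}. \<theta> j) else 1) = (\<lambda>_. 1)"
      by auto
    then show ?case
      using subgroup.one_closed[OF K] by (simp only: monomial_map_one GL_simps)
  next
    case (insert a F)
    let ?f = "\<lambda>F. monomial_map (\<lambda>i. if i \<in> F then \<theta> i else if i = e then inverse (\<Prod>j\<in>F. \<theta> j) else 1) id"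
    let ?g = "monomial_map ((\<lambda>_. 1)(a := \<theta> a, e := inverse (\<theta> a))) id"
    have "?g \<in> K"
      using insert.prems \<theta> by (intro pairs) (auto simp: A_fun_def)
    moreover have "?f F \<in> K"
      using insert.IH insert.prems by blast
    ultimately have "?g \<circ> ?f F \<in> K"
      by (rule subgroup_GL_comp[OF K])
    also have "?g \<circ> ?f F = ?f (insert a F)"
      using insert by (auto simp: monomial_map_comp intro!: arg_cong2[where f = monomial_map])
    finally show ?case .
  qed
  let ?F = "UNIV - {e}"
  have split: "(\<Prod>i\<in>UNIV. \<theta> i) = \<theta> e * (\<Prod>i\<in>?F. \<theta> i)"
    by (rule prod.remove) auto
  have "(\<Prod>i\<in>UNIV. \<theta> i) ^ q = 1"
    using \<theta> by (simp add: A_fun_def prod_power_distrib)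
  then have "diag_at e (\<Prod>i\<in>UNIV. \<theta> i) \<in> K"
    using \<theta> by (intro last) (auto simp: A_fun_def)
  moreover have "monomial_map (\<lambda>i. if i \<in> ?F then \<theta> i else if i = e then inverse (\<Prod>j\<in>?F. \<theta> j) else 1) id \<in> K"
    by (rule partial) auto
  ultimately have "diag_at e (\<Prod>i\<in>UNIV. \<theta> i) \<circ>
      monomial_map (\<lambda>i. if i \<in> ?F then \<theta> i else if i = e then inverse (\<Prod>j\<in>?F. \<theta> j) else 1) id \<in> K"
    by (rule subgroup_GL_comp[OF K])
  also have "diag_at e (\<Prod>i\<in>UNIV. \<theta> i) \<circ>
      monomial_map (\<lambda>i. if i \<in> ?F then \<theta> i else if i = e then inverse (\<Prod>j\<in>?F. \<theta> j) else 1) id = monomial_map \<theta> id"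
    using nz unfolding split diag_at_def
    by (auto simp: monomial_map_comp intro!: arg_cong2[where f = monomial_map])
  finally show ?thesis .
qed

lemma label_group_le_subgroup:
  fixes e :: "'n::finite"
  assumes K: "subgroup K GL" and "q > 0"
    and "\<And>i j. i \<noteq> j \<Longrightarrow> d i = d j \<Longrightarrow> swap_map i j 1 \<in> K"
    and "\<And>i z. i \<noteq> e \<Longrightarrow> z ^ q = 1 \<Longrightarrow> monomial_map ((\<lambda>_. 1)(i := z, e := inverse z)) id \<in> K"
    and "\<And>z. z ^ q = 1 \<Longrightarrow> z ^ (q div s) = 1 \<Longrightarrow> diag_at e z \<in> K"
  shows "label_group q s d \<subseteq> K"
proof
  fix f assume "f \<in> label_group q s d"
  then obtain \<theta> \<pi> where f: "f = monomial_map \<theta> \<pi>" "\<theta> \<in> A_fun q s" "\<pi> \<in> label_perms d UNIV"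
    by (auto simp: label_group_def monomial_set_def)
  have "monomial_map \<theta> id \<in> K"
    using diag_maps_in_subgroup[OF assms(1,2,4,5) f(2)] .
  moreover have "monomial_map (\<lambda>_. 1) \<pi> \<in> K"
    using twisted_perms_in_subgroup[OF K _ _ f(3), of "\<lambda>_. 1"] assms(3) by simp
  ultimately have "monomial_map \<theta> id \<circ> monomial_map (\<lambda>_. 1) \<pi> \<in> K"
    by (rule subgroup_GL_comp[OF K])
  then show "f \<in> K"
    using f by (simp add: monomial_map_comp label_perms_UNIV)
qed

lemma diag_pair_eq:
  assumes "i \<noteq> e"
  shows "diag_at i z \<circ> diag_at e y = monomial_map ((\<lambda>_. 1)(i := z, e := y)) id"
  using assms unfolding diag_at_def by (auto simp: monomial_map_comp intro!: arg_cong2[where f = monomial_map])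

text \<open>The delicate generators are the diagonal pairs \<open>z\<close>,
  \<open>inverse z\<close>. For \<open>s = 1\<close> both factors are reflections or trivial; with a
  single class the pair is a product of two swaps. Hence the disjunction.\<close>

lemma reflection_subgroup_label_group:
  fixes d :: "'n::finite \<Rightarrow> 'r"
  assumes "q > 0" "s = 1 \<or> (\<forall>i j. d i = d j)" "label_group q s d \<subseteq> G"
  shows "reflection_subgroup G (label_group q s d)"
proof -
  let ?L = "label_group q s d"
  let ?S = "{f \<in> ?L. complex_reflection f}"
  have L: "subgroup ?L GL"
    using subgroup_label_group[OF assms(1)] .
  have K: "subgroup (generate GL ?S) GL"
    by (rule GL.generate_is_subgroup) (auto intro: complex_reflection_in_GL)
  have diag: "diag_at i z \<in> generate GL ?S" if "z ^ q = 1" "z ^ (q div s) = 1" for i :: 'n and z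
  proof (cases "z = 1")
    case True
    then show ?thesis
      using subgroup.one_closed[OF K] by simp
  next
    case False
    then show ?thesis
      using complex_reflection_diag_at[of z q i] diag_at_in_label_group[OF that, of i d] that assms(1)
      by (intro generate.incl) auto
  qed
  have swap: "swap_map i j z \<in> generate GL ?S" if "i \<noteq> j" "d i = d j" "z ^ q = 1" for i j z
  proof -
    have "z \<noteq> 0"
      using that(3) assms(1) by (rule root_of_unity_nonzero)
    then show ?thesis
      using complex_reflection_swap_map[OF that(1)] swap_map_in_label_group[OF that assms(1)]
      by (intro generate.incl) auto
  qed
  obtain e :: 'n where True
    by simp
  have "?L \<subseteq> generate GL ?S"
  proof (rule label_group_le_subgroup[OF K assms(1), of d e])
    show "monomial_map ((\<lambda>_. 1)(i := z, e := inverse z)) id \<in> generate GL ?S"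
      if "i \<noteq> e" "z ^ q = 1" for i z
      using assms(2)
    proof
      assume "s = 1"
      then have "diag_at i z \<in> generate GL ?S" "diag_at e (inverse z) \<in> generate GL ?S"
        using that(2) diag[of z i] diag[of "inverse z" e] by (simp_all add: power_inverse)
      then show ?thesis
        using subgroup_GL_comp[OF K] unfolding diag_pair_eq[OF that(1), symmetric] by blast
    next
      assume d: "\<forall>i j. d i = d j"
      have "swap_map i e (inverse z) \<circ> swap_map i e 1 \<in> generate GL ?S"
        using d that by (intro subgroup_GL_comp[OF K] swap) (auto simp: power_inverse)
      moreover have "swap_map i e (inverse z) \<circ> swap_map i e 1 = diag_at i z \<circ> diag_at e (inverse z)"
        using that(1) by (auto simp: fun_eq_iff vec_eq_iff swap_map_nth diag_at_nth)
      ultimately show ?thesis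
        unfolding diag_pair_eq[OF that(1)] by simp
    qed
  qed (auto intro: swap diag)
  moreover have "generate GL ?S \<subseteq> ?L"
    by (rule GL.generate_subgroup_incl[OF _ L]) auto
  ultimately have "?L = generate GL ?S"
    by (intro equalityI)
  then show ?thesis
    using L assms(3) unfolding reflection_subgroup_def by (intro conjI exI[of _ ?S]) auto
qed

text \<open>Replaces the generated group by explicit monomial maps, whose number is known.\<close>

lemma block_product_eq:
  fixes P :: "'n::finite set set"
  assumes "q > 0" and P: "partition_on UNIV P"
  shows "block_product q P = label_group q 1 (block_of P)"
proof
  let ?L = "label_group q 1 (block_of P)"
  define gens where "gens B = {perm_map \<pi> | \<pi>. \<pi> permutes B} \<union>
      {diag_map \<theta> | \<theta>. (\<forall>i\<in>B. \<theta> i ^ q = 1) \<and> (\<forall>i. i \<notin> B \<longrightarrow> \<theta> i = 1)}" for B :: "'n set"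
  have block: "block_group q B = generate GL (gens B)" for B :: "'n set"
    by (simp add: block_group_def gens_def)
  have L: "subgroup ?L GL"
    using subgroup_label_group[OF assms(1)] .
  have "gens B \<subseteq> ?L" if B: "B \<in> P" for B
  proof
    fix f assume "f \<in> gens B"
    then consider \<pi> where "f = perm_map \<pi>" "\<pi> permutes B"
      | \<theta> where "f = diag_map \<theta>" "\<forall>i\<in>B. \<theta> i ^ q = 1" "\<forall>i. i \<notin> B \<longrightarrow> \<theta> i = 1"
      by (auto simp: gens_def)
    then show "f \<in> ?L"
    proof cases
      case 1
      have "bij \<pi>"
        using 1(2) by (rule permutes_bij)
      moreover have "block_of P (\<pi> i) = block_of P i" for i
        using 1(2) block_of_eq[OF P B] permutes_in_image[OF 1(2)] permutes_not_in[OF 1(2)]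
        by (cases "i \<in> B") auto
      ultimately show ?thesis
        unfolding 1(1) label_group_def
        by (auto simp: perm_map_eq A_fun_def label_perms_UNIV intro!: monomial_setI)
    next
      case 2
      then have "\<theta> i ^ q = 1" for i
        by (cases "i \<in> B") auto
      then show ?thesis
        unfolding 2(1) label_group_def
        by (auto simp: diag_map_eq A_fun_def label_perms_UNIV prod_power_distrib intro!: monomial_setI)
    qed
  qed
  then have sub: "block_group q B \<subseteq> ?L" if "B \<in> P" for B
    unfolding block using that by (intro GL.generate_subgroup_incl[OF _ L]) auto
  then show "block_product q P \<subseteq> ?L"
    unfolding block_product_def by (intro GL.generate_subgroup_incl[OF _ L]) auto
  have K: "subgroup (block_product q P) GL"
    unfolding block_product_def using sub subgroup.subset[OF L]
    by (intro GL.generate_is_subgroup) blast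
  have gen: "f \<in> block_product q P" if "f \<in> gens B" "B \<in> P" for f B
    using that unfolding block_product_def block by (auto intro!: generate.incl)
  have diag: "diag_at i z \<in> block_product q P" if "z ^ q = 1" for i :: 'n and z
    using that block_of_in[OF P, of i]
    by (intro gen[of _ "block_of P i"]) (auto simp: gens_def diag_at_def diag_map_eq)
  obtain e :: 'n where True
    by simp
  show "?L \<subseteq> block_product q P"
  proof (rule label_group_le_subgroup[OF K assms(1), of _ e])
    show "swap_map i j 1 \<in> block_product q P" if "i \<noteq> j" "block_of P i = block_of P j" for i j
    proof (rule gen)
      have "Transposition.transpose i j permutes block_of P i"
        using block_of_in[OF P, of i] block_of_in[OF P, of j] that by (intro permutes_swap_id) auto
      moreover have "swap_map i j 1 = perm_map (Transposition.transpose i j)"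
        by (simp add: perm_map_eq swap_map_def fun_upd_idem)
      ultimately show "swap_map i j 1 \<in> gens (block_of P i)"
        by (auto simp: gens_def)
    qed (rule block_of_in[OF P UNIV_I])
    show "monomial_map ((\<lambda>_. 1)(i := z, e := inverse z)) id \<in> block_product q P"
      if "i \<noteq> e" "z ^ q = 1" for i z
    proof -
      have "diag_at i z \<circ> diag_at e (inverse z) \<in> block_product q P"
        using that(2) by (intro subgroup_GL_comp[OF K] diag) (auto simp: power_inverse)
      then show ?thesis
        unfolding diag_pair_eq[OF that(1)] .
    qed
  qed (auto intro: diag)
qed


section \<open>Conjugation by diagonal maps\<close>

lemma conjugate_label_group_diag:
  assumes "\<And>i. D i \<noteq> 0"
  shows "conjugate_subgroup (diag_map D) (label_group q s d) =
    {monomial_map (\<lambda>i. D i * \<theta> i / D (inv_into UNIV \<pi> i)) \<pi> | \<theta> \<pi>. \<theta> \<in> A_fun q s \<and> \<pi> \<in> label_perms d UNIV}"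
proof -
  have eq: "diag_map D \<circ> monomial_map \<theta> \<pi> \<circ> inv\<^bsub>GL\<^esub> (diag_map D) =
      monomial_map (\<lambda>i. D i * \<theta> i / D (inv_into UNIV \<pi> i)) \<pi>" if "\<pi> \<in> label_perms d UNIV" for \<theta> \<pi>
    using that[unfolded label_perms_UNIV] assms
    by (simp add: diag_map_eq GL_inv_monomial_map monomial_map_comp divide_inverse comp_def[of _ id] flip: id_def)
  show ?thesis
    unfolding conjugate_subgroup_image label_group_def monomial_set_def
  proof (intro equalityI subsetI)
    fix f assume "f \<in> (\<lambda>h. diag_map D \<circ> h \<circ> inv\<^bsub>GL\<^esub> (diag_map D)) `
      {monomial_map \<theta> \<pi> | \<theta> \<pi>. \<theta> \<in> A_fun q s \<and> \<pi> \<in> label_perms d UNIV}"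
    then show "f \<in> {monomial_map (\<lambda>i. D i * \<theta> i / D (inv_into UNIV \<pi> i)) \<pi> | \<theta> \<pi>.
        \<theta> \<in> A_fun q s \<and> \<pi> \<in> label_perms d UNIV}"
      using eq by blast
  next
    fix f assume "f \<in> {monomial_map (\<lambda>i. D i * \<theta> i / D (inv_into UNIV \<pi> i)) \<pi> | \<theta> \<pi>.
        \<theta> \<in> A_fun q s \<and> \<pi> \<in> label_perms d UNIV}"
    then obtain \<theta> \<pi> where f: "f = monomial_map (\<lambda>i. D i * \<theta> i / D (inv_into UNIV \<pi> i)) \<pi>"
        "\<theta> \<in> A_fun q s" "\<pi> \<in> label_perms d UNIV"
      by blast
    then show "f \<in> (\<lambda>h. diag_map D \<circ> h \<circ> inv\<^bsub>GL\<^esub> (diag_map D)) `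
        {monomial_map \<theta> \<pi> | \<theta> \<pi>. \<theta> \<in> A_fun q s \<and> \<pi> \<in> label_perms d UNIV}"
      using eq[OF f(3), of \<theta>] by (intro image_eqI[of _ _ "monomial_map \<theta> \<pi>"]) auto
  qed
qed

lemma diag_map_in_GL: "(\<And>i. D i \<noteq> 0) \<Longrightarrow> diag_map D \<in> carrier GL"
  by (simp add: diag_map_eq monomial_map_in_GL)

lemma diag_map_comp: "diag_map D \<circ> diag_map E = diag_map (\<lambda>i. D i * E i)"
  by (simp add: diag_map_eq monomial_map_comp)

text \<open>A factor \<open>v\<close> constant on classes cancels, since \<open>\<pi>\<close>
  preserves labels; the quotients of \<open>u\<close> at \<open>i\<close> and at its preimage are
  q-th roots with total product 1, so the determinant condition survives. Equal finite orders turn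
  the inclusion into equality.\<close>

lemma conjugate_label_group_eq:
  fixes d :: "'n::finite \<Rightarrow> 'r"
  assumes "q > 0" "\<And>i. u i ^ q = 1" "\<And>r. v r \<noteq> 0"
  shows "conjugate_subgroup (diag_map (\<lambda>i. u i * v (d i))) (label_group q s d) = label_group q s d"
proof -
  let ?D = "\<lambda>i. u i * v (d i)"
  have u: "u i \<noteq> 0" for i
    using assms(1,2) by (metis root_of_unity_nonzero)
  have "conjugate_subgroup (diag_map ?D) (label_group q s d) \<subseteq> label_group q s d"
  proof
    fix f assume "f \<in> conjugate_subgroup (diag_map ?D) (label_group q s d)"
    then obtain \<theta> \<pi> where f: "f = monomial_map (\<lambda>i. ?D i * \<theta> i / ?D (inv_into UNIV \<pi> i)) \<pi>"
        "\<theta> \<in> A_fun q s" "\<pi> \<in> label_perms d UNIV"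
      using u assms(3) by (subst (asm) conjugate_label_group_diag) auto
    let ?\<rho> = "inv_into UNIV \<pi>"
    have \<rho>: "bij ?\<rho>" "d (?\<rho> i) = d i" for i
      using label_perms_inv[OF f(3)] by (auto simp: label_perms_UNIV)
    have "(\<lambda>i. ?D i * \<theta> i / ?D (?\<rho> i)) = (\<lambda>i. u i * \<theta> i / u (?\<rho> i))"
      using \<rho>(2) assms(3) by (auto simp: fun_eq_iff)
    moreover have "(\<lambda>i. u i * \<theta> i / u (?\<rho> i)) \<in> A_fun q s"
      using f(2) assms(2) u prod_comp_bij[OF \<rho>(1), of u]
      by (auto simp: A_fun_def power_mult_distrib power_divide prod.distrib prod_dividef)
    ultimately show "f \<in> label_group q s d"
      using f(1,3) by (simp add: label_group_def monomial_setI)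
  qed
  moreover have "card (conjugate_subgroup (diag_map ?D) (label_group q s d)) = card (label_group q s d)"
    using u assms(3) by (intro card_conjugate_subgroup diag_map_in_GL) auto
  ultimately show ?thesis
    using finite_label_group[OF assms(1)] by (intro card_subset_eq) auto
qed

text \<open>The freedom in a diagonal conjugator: its determinant may be changed by q-th roots of
  unity and by scaling whole classes, while the conjugate stays the same.\<close>

lemma conjugate_label_group_cong:
  fixes d :: "'n::finite \<Rightarrow> 'r"
  assumes "q > 0" "\<And>i. u i ^ q = 1" "\<And>r. v r \<noteq> 0" "\<And>i. D i \<noteq> 0" "\<And>i. D' i = D i * (u i * v (d i))"
  shows "conjugate_subgroup (diag_map D') (label_group q s d) = conjugate_subgroup (diag_map D) (label_group q s d)"
proof -
  have "u i \<noteq> 0" for i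
    using assms(1,2) by (metis root_of_unity_nonzero)
  then have "conjugate_subgroup (diag_map D \<circ> diag_map (\<lambda>i. u i * v (d i))) (label_group q s d) =
      conjugate_subgroup (diag_map D) (label_group q s d)"
    using assms by (subst conjugate_subgroup_comp) (auto simp: conjugate_label_group_eq intro!: diag_map_in_GL)
  moreover have "D' = (\<lambda>i. D i * (u i * v (d i)))"
    using assms(5) by (rule ext)
  then have "diag_map D \<circ> diag_map (\<lambda>i. u i * v (d i)) = diag_map D'"
    by (simp add: diag_map_comp)
  ultimately show ?thesis
    by simp
qed


section \<open>The structure of a reflection subgroup\<close>

text \<open>The reflections of the second kind in \<open>K\<close> connect the basis vectors; conjugating one such
  reflection by another shows that adjacency is already transitive, so the components are read off
  without choosing paths.\<close>

lemma reflection_subgroup_structure: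
  fixes K :: "(complex ^ 'n::finite \<Rightarrow> complex ^ 'n) set"
  assumes "m > 0" "reflection_subgroup (G_group m p) K"
  obtains c :: "'n \<Rightarrow> 'n" and D :: "'n \<Rightarrow> complex" where
    "\<And>i. D i ^ m = 1"
    "\<And>i j. i \<noteq> j \<Longrightarrow> c i = c j \<Longrightarrow> swap_map i j (D j / D i) \<in> K"
    "K \<subseteq> monomial_set {\<theta>. (\<forall>i. \<theta> i ^ m = 1) \<and> (\<forall>r. (\<Prod>i | c i = r. \<theta> i) ^ (m div p) = 1)} (label_perms c UNIV)"
proof -
  have K: "subgroup K GL" "K \<subseteq> G_group m p"
    using assms(2) by (auto simp: reflection_subgroup_def)
  obtain S where S: "\<And>f. f \<in> S \<Longrightarrow> complex_reflection f" "K = generate GL S"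
    using assms(2) by (auto simp: reflection_subgroup_def)
  note nz = root_of_unity_nonzero[OF _ assms(1)]
  \<comment> \<open>Equality is added by hand because an exchange of basis lines needs two different
    indices.\<close>
  define E where "E i j \<longleftrightarrow> i = j \<or> (\<exists>z. z ^ m = 1 \<and> swap_map i j z \<in> K)" for i j
  have swap_sym: "swap_map j i (inverse z) \<in> K" if "i \<noteq> j" "swap_map i j z \<in> K" for i j z
    using that swap_map_commute[OF that(1)] by simp
  have swap_trans: "swap_map i k (z * y) \<in> K"
    if "i \<noteq> j" "j \<noteq> k" "i \<noteq> k" "z ^ m = 1" "y ^ m = 1" "swap_map i j z \<in> K" "swap_map j k y \<in> K" for i j k y z
  proof -
    have "swap_map j k y \<circ> swap_map i j z \<circ> swap_map j k y \<in> K"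
      using that by (intro subgroup_GL_comp[OF K(1)])
    then show ?thesis
      using swap_map_comp[OF that(1,2,3) nz[OF that(5)] nz[OF that(4)]] by simp
  qed
  have E_sym: "E j i" if Eij: "E i j" for i j
  proof (cases "i = j")
    case False
    then obtain z where "z ^ m = 1" "swap_map i j z \<in> K"
      using Eij by (auto simp: E_def)
    then have "inverse z ^ m = 1" "swap_map j i (inverse z) \<in> K"
      using swap_sym[OF False] by (auto simp: power_inverse)
    then show ?thesis
      unfolding E_def by blast
  qed (simp add: E_def)
  have E_trans: "E i k" if Eijk: "E i j" "E j k" for i j k
  proof (cases "i = j \<or> j = k \<or> i = k")
    case False
    then obtain z y where "z ^ m = 1" "swap_map i j z \<in> K" "y ^ m = 1" "swap_map j k y \<in> K"
      using Eijk by (auto simp: E_def)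
    then have "(z * y) ^ m = 1" "swap_map i k (z * y) \<in> K"
      using False swap_trans by (auto simp: power_mult_distrib)
    then show ?thesis
      unfolding E_def by blast
  qed (use Eijk in \<open>auto simp: E_def\<close>)
  \<comment> \<open>Related points have the same predicate \<open>E i\<close>, so the choice yields
    one common representative per component.\<close>
  define c where "c i = (SOME j. E i j)" for i
  have Ec: "E i (c i)" for i
    unfolding c_def by (rule someI[of _ i]) (simp add: E_def)
  have c_eq: "c i = c j \<longleftrightarrow> E i j" for i j
  proof
    assume "c i = c j"
    then show "E i j"
      using Ec[of i] Ec[of j] E_sym E_trans by metis
  next
    assume "E i j"
    then have "E i = E j"
      using E_sym E_trans by blast
    then show "c i = c j"
      by (simp add: c_def)
  qed
  \<comment> \<open>\<open>D i\<close> labels an edge from the representative to \<open>i\<close>,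
    and is 1 at the representative; the quotients \<open>D j / D i\<close> are then edge labels
    inside the component.\<close>
  define D where "D i = (if i = c i then 1 else SOME z. z ^ m = 1 \<and> swap_map (c i) i z \<in> K)" for i
  have D: "D i ^ m = 1 \<and> (i \<noteq> c i \<longrightarrow> swap_map (c i) i (D i) \<in> K)" for i
  proof (cases "i = c i")
    case False
    then have "\<exists>z. z ^ m = 1 \<and> swap_map (c i) i z \<in> K"
      using E_sym[OF Ec[of i]] by (auto simp: E_def)
    from someI_ex[OF this] show ?thesis
      using False by (simp add: D_def)
  qed (simp add: D_def)
  show ?thesis
  proof (rule that)
    show "D i ^ m = 1" for i
      using D by blast
    show "swap_map i j (D j / D i) \<in> K" if "i \<noteq> j" "c i = c j" for i j
    proof -
      define r where "r = c i"
      have r: "c i = r" "c j = r"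
        using that by (auto simp: r_def)
      consider "i = r" | "j = r" | "i \<noteq> r" "j \<noteq> r"
        by blast
      then show ?thesis
      proof cases
        case 1
        then have "D i = 1"
          using r by (simp add: D_def)
        then show ?thesis
          using D[of j] r 1 that by auto
      next
        case 2
        then have "D j = 1"
          using r by (simp add: D_def)
        moreover have "swap_map i r (inverse (D i)) \<in> K"
          using D[of i] r 2 that by (intro swap_sym) auto
        ultimately show ?thesis
          using 2 by (simp add: divide_inverse)
      next
        case 3
        have "swap_map i r (inverse (D i)) \<in> K"
          using D[of i] r 3 by (intro swap_sym) auto
        moreover have "swap_map r j (D j) \<in> K"
          using D[of j] r 3 by auto
        ultimately have "swap_map i j (inverse (D i) * D j) \<in> K"
          using 3 that D[of i] D[of j] by (intro swap_trans[of i r j]) (auto simp: power_inverse)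
        then show ?thesis
          by (simp add: divide_inverse mult.commute)
      qed
    qed
    \<comment> \<open>A diagonal reflection changes one entry, and a swap has product 1 on its
      component. So the determinant condition holds on every component separately, which is stronger
      than membership in G(m,p,n).\<close>
    let ?\<Theta> = "{\<theta> :: 'n \<Rightarrow> complex. (\<forall>i. \<theta> i ^ m = 1) \<and> (\<forall>r. (\<Prod>i | c i = r. \<theta> i) ^ (m div p) = 1)}"
    have T: "subgroup (monomial_set ?\<Theta> (label_perms c UNIV)) GL"
    proof (rule subgroup_monomial_set)
      show "\<theta> i \<noteq> 0" if "\<theta> \<in> ?\<Theta>" for \<theta> :: "'n \<Rightarrow> complex" and i
        using that nz[of "\<theta> i"] by simp
      show "inv_into UNIV \<pi> \<in> label_perms c UNIV" if "\<pi> \<in> label_perms c UNIV" for \<pi>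
        using label_perms_inv[OF that] .
      show "(\<lambda>i. \<theta> (\<pi> i)) \<in> ?\<Theta>" if "\<theta> \<in> ?\<Theta>" "\<pi> \<in> label_perms c UNIV" for \<theta> \<pi>
      proof -
        have "bij_betw \<pi> {i. c i = r} {i. c i = r}" for r
        proof (rule bij_betw_byWitness[where f' = "inv_into UNIV \<pi>"])
          show "\<pi> ` {i. c i = r} \<subseteq> {i. c i = r}" "inv_into UNIV \<pi> ` {i. c i = r} \<subseteq> {i. c i = r}"
            using that(2) label_perms_inv[OF that(2)] by (auto simp: label_perms_UNIV)
        qed (use that(2) in \<open>auto simp: label_perms_UNIV bij_is_inj bij_is_surj surj_f_inv_f\<close>)
        then have "(\<Prod>i | c i = r. \<theta> (\<pi> i)) = (\<Prod>i | c i = r. \<theta> i)" for r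
          by (rule prod.reindex_bij_betw)
        then show ?thesis
          using that(1) by simp
      qed
      show "(\<lambda>i. \<theta> i * \<eta> i) \<in> ?\<Theta>" if "\<theta> \<in> ?\<Theta>" "\<eta> \<in> ?\<Theta>" for \<theta> \<eta>
        using that by (simp add: power_mult_distrib prod.distrib)
      show "(\<lambda>i. inverse (\<theta> i)) \<in> ?\<Theta>" if "\<theta> \<in> ?\<Theta>" for \<theta>
      proof -
        have "(\<Prod>i | c i = r. inverse (\<theta> i)) = inverse (\<Prod>i | c i = r. \<theta> i)" for r
          using prod_inversef[of \<theta> "{i. c i = r}"] by (simp add: comp_def)
        then show ?thesis
          using that by (simp add: power_inverse)
      qed
    qed (auto simp: label_perms_UNIV bij_comp)
    have "S \<subseteq> monomial_set ?\<Theta> (label_perms c UNIV)"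
    proof
      fix f assume "f \<in> S"
      then have f: "complex_reflection f" "f \<in> K"
        using S by (auto intro: generate.incl)
      then have "f \<in> label_group m p (\<lambda>_. ())"
        using K(2) G_group_eq by blast
      then obtain \<theta> \<pi> where \<theta>: "f = monomial_map \<theta> \<pi>" "\<theta> \<in> A_fun m p" "bij \<pi>"
        by (auto simp: label_group_def monomial_set_def label_perms_UNIV)
      have th: "\<theta> i ^ m = 1" "(\<Prod>i\<in>UNIV. \<theta> i) ^ (m div p) = 1" for i
        using \<theta>(2) by (auto simp: A_fun_def)
      from f(1)[unfolded \<theta>(1)] \<theta>(3) nz[OF th(1)] show "f \<in> monomial_set ?\<Theta> (label_perms c UNIV)"
      proof (cases rule: complex_reflection_monomial_map_cases)
        case (diag i)
        have "(\<Prod>x\<in>C. \<theta> x) = (if i \<in> C then \<theta> i else 1)" for C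
          using prod_one_update[of C i "\<theta> i"] diag(2)[symmetric] by simp
        then have "\<theta> \<in> ?\<Theta>"
          using th by auto
        then show ?thesis
          using diag(1) \<theta>(1) by (auto simp: label_perms_UNIV intro!: monomial_setI)
      next
        case (swap i j)
        have "(\<Prod>x\<in>C. \<theta> x) = (if i \<in> C then inverse (\<theta> j) else 1) * (if j \<in> C then \<theta> j else 1)" for C
          using prod_two_updates[of C i j "inverse (\<theta> j)" "\<theta> j"] swap(1) swap(4)[symmetric] by simp
        moreover have "E i j"
          using swap f(2) th(1) unfolding E_def \<theta>(1) by metis
        then have "c i = c j"
          using c_eq by simp
        ultimately have "\<theta> \<in> ?\<Theta>"
          using th nz[OF th(1), of j] by auto
        moreover have "\<pi> \<in> label_perms c UNIV"
          using \<open>c i = c j\<close> swap(2) by (auto simp: label_perms_UNIV Transposition.transpose_def)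
        ultimately show ?thesis
          using \<theta>(1) by (simp add: monomial_setI)
      qed
    qed
    then show "K \<subseteq> monomial_set ?\<Theta> (label_perms c UNIV)"
      unfolding S(2) by (rule GL.generate_subgroup_incl[OF _ T])
  qed
qed

text \<open>An element factors as a diagonal map times a twisted permutation, both in
  \<open>K\<close>. The labelling \<open>d\<close> may be finer than \<open>c\<close>, which lets
  components be subdivided into blocks.\<close>

lemma conjugate_label_group_le:
  fixes D :: "'n::finite \<Rightarrow> complex"
  assumes K: "subgroup K GL" and D: "\<And>i. D i \<noteq> 0"
    and swaps: "\<And>i j. i \<noteq> j \<Longrightarrow> c i = c j \<Longrightarrow> swap_map i j (D j / D i) \<in> K"
    and diag: "label_group q s (id :: 'n \<Rightarrow> 'n) \<subseteq> K"
    and labels: "\<And>i j. d i = d j \<Longrightarrow> c i = c j"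
  shows "conjugate_subgroup (diag_map D) (label_group q s d) \<subseteq> K"
proof
  fix f assume "f \<in> conjugate_subgroup (diag_map D) (label_group q s d)"
  then obtain \<theta> \<pi> where f: "f = monomial_map (\<lambda>i. D i * \<theta> i / D (inv_into UNIV \<pi> i)) \<pi>"
      "\<theta> \<in> A_fun q s" "\<pi> \<in> label_perms d UNIV"
    using conjugate_label_group_diag[of D q s d, OF D] by blast
  then have "\<pi> \<in> label_perms c UNIV"
    using labels unfolding label_perms_UNIV by blast
  from twisted_perms_in_subgroup[OF K D swaps this]
  have "monomial_map (\<lambda>i. D i / D (inv_into UNIV \<pi> i)) \<pi> \<in> K" .
  moreover have "monomial_map \<theta> id \<in> K"
    using diag f(2) by (auto simp: label_group_def label_perms_UNIV intro!: monomial_setI subsetD[OF diag])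
  ultimately have "monomial_map \<theta> id \<circ> monomial_map (\<lambda>i. D i / D (inv_into UNIV \<pi> i)) \<pi> \<in> K"
    by (intro subgroup_GL_comp[OF K])
  moreover have "monomial_map \<theta> id \<circ> monomial_map (\<lambda>i. D i / D (inv_into UNIV \<pi> i)) \<pi> = f"
    using f(1,3) by (simp add: monomial_map_comp label_perms_UNIV mult.commute)
  ultimately show "f \<in> K"
    by simp
qed

text \<open>A permutation matrix transports one labelling to another; what matters is which points
  share a label, not the label values.\<close>

lemma conjugate_label_group_perm:
  assumes "bij \<sigma>" "\<And>i j. e (\<sigma> i) = e (\<sigma> j) \<longleftrightarrow> d i = d j"
  shows "conjugate_subgroup (monomial_map (\<lambda>_. 1) \<sigma>) (label_group q s d) \<subseteq> label_group q s e"
proof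
  fix f assume "f \<in> conjugate_subgroup (monomial_map (\<lambda>_. 1) \<sigma>) (label_group q s d)"
  then obtain \<theta> \<pi> where f: "f = monomial_map (\<lambda>_. 1) \<sigma> \<circ> monomial_map \<theta> \<pi> \<circ> inv\<^bsub>GL\<^esub> (monomial_map (\<lambda>_. 1) \<sigma>)"
      "\<theta> \<in> A_fun q s" "\<pi> \<in> label_perms d UNIV"
    by (auto simp: conjugate_subgroup_image label_group_def monomial_set_def)
  have \<pi>: "bij \<pi>" "\<And>i. d (\<pi> i) = d i"
    using f(3) by (auto simp: label_perms_UNIV)
  have "f = monomial_map (\<lambda>i. \<theta> (inv_into UNIV \<sigma> i)) (\<sigma> \<circ> \<pi> \<circ> inv_into UNIV \<sigma>)"
    unfolding f(1) using assms(1) \<pi>(1)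
    by (simp add: GL_inv_monomial_map monomial_map_comp bij_imp_bij_inv bij_comp)
  moreover have "(\<lambda>i. \<theta> (inv_into UNIV \<sigma> i)) \<in> A_fun q s"
    using f(2) prod_comp_bij[OF bij_imp_bij_inv[OF assms(1)], of \<theta>] by (simp add: A_fun_def)
  moreover have "e ((\<sigma> \<circ> \<pi> \<circ> inv_into UNIV \<sigma>) i) = e i" for i
  proof -
    have "e (\<sigma> (\<pi> (inv_into UNIV \<sigma> i))) = e (\<sigma> (inv_into UNIV \<sigma> i))"
      using assms(2) \<pi>(2) by blast
    then show ?thesis
      using assms(1) by (simp add: bij_is_surj surj_f_inv_f)
  qed
  ultimately show "f \<in> label_group q s e"
    using assms(1) \<pi>(1)
    by (auto simp: label_group_def label_perms_UNIV bij_comp bij_imp_bij_inv intro!: monomial_setI)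
qed


section \<open>The \<open>l\<close>-parts\<close>

lemma A_fun_mono:
  assumes "q dvd m" "q div s dvd m div p"
  shows "A_fun q s \<subseteq> A_fun m p"
  using assms unfolding A_fun_def by (auto elim!: dvdE simp: power_mult)

lemma label_group_mono:
  fixes d :: "'n::finite \<Rightarrow> 'r" and c :: "'n \<Rightarrow> 't"
  assumes "A_fun q s \<subseteq> (A_fun m p :: ('n \<Rightarrow> complex) set)" "\<And>i j. d i = d j \<Longrightarrow> c i = c j"
  shows "label_group q s d \<subseteq> label_group m p c"
proof
  fix f assume "f \<in> label_group q s d"
  then obtain \<theta> \<pi> where f: "f = monomial_map \<theta> \<pi>" "\<theta> \<in> A_fun q s" "\<pi> \<in> label_perms d UNIV"
    by (auto simp: label_group_def monomial_set_def)
  moreover have "\<theta> \<in> A_fun m p"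
    using f(2) assms(1) by blast
  moreover have "\<pi> \<in> label_perms c UNIV"
    using f(3) assms(2) unfolding label_perms_UNIV by blast
  ultimately show "f \<in> label_group m p c"
    by (simp add: label_group_def monomial_setI)
qed

lemma l_part_dvd:
  fixes l m p :: nat
  assumes "prime l" "m > 0" "p dvd m"
  shows "l ^ multiplicity l p dvd l ^ multiplicity l m"
    "l ^ multiplicity l m div l ^ multiplicity l p dvd m div p"
    "multiplicity l m = multiplicity l p + multiplicity l (m div p)"
proof -
  obtain r where r: "m = p * r"
    using assms(3) by blast
  then have pos: "p > 0" "r > 0"
    using assms(2) by auto
  have l: "l > 0"
    using assms(1) prime_gt_0_nat by blast
  have mult: "multiplicity l m = multiplicity l p + multiplicity l r"
    unfolding r using assms(1) pos by (intro prime_elem_multiplicity_mult_distrib) auto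
  then show "l ^ multiplicity l p dvd l ^ multiplicity l m"
    by (simp add: le_imp_power_dvd)
  have "l ^ multiplicity l m div l ^ multiplicity l p = l ^ multiplicity l r"
    using l by (simp add: mult power_add)
  then show "l ^ multiplicity l m div l ^ multiplicity l p dvd m div p"
    using pos by (simp add: r multiplicity_dvd)
  show "multiplicity l m = multiplicity l p + multiplicity l (m div p)"
    using mult pos by (simp add: r)
qed

lemma multiplicity_card_label_group:
  fixes c :: "'n::finite \<Rightarrow> 'r"
  assumes "prime l" "m > 0" "p dvd m"
  shows "multiplicity l (card (label_group m p c)) =
    (CARD('n) - 1) * multiplicity l m + (multiplicity l m - multiplicity l p) +
    multiplicity l (card (label_perms c (UNIV :: 'n set)))"
proof -
  have "p > 0"
    using assms by (auto intro: dvd_pos_nat)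
  then have "card (A_fun m p :: ('n \<Rightarrow> complex) set) \<noteq> 0"
    using assms(2,3) by (auto simp: card_A_fun dvd_imp_le elim!: dvdE)
  moreover have "id \<in> label_perms c UNIV"
    by (simp add: label_perms_UNIV)
  then have "card (label_perms c (UNIV :: 'n set)) \<noteq> 0"
    by (auto simp: card_eq_0_iff)
  ultimately show ?thesis
    unfolding card_label_group[OF assms(2)] multiplicity_card_A_fun[OF assms, symmetric]
    using assms(1) by (intro prime_elem_multiplicity_mult_distrib) auto
qed

text \<open>The labelling \<open>id\<close> admits only the identity permutation, so this is the
  diagonal part of G(q,s,n) for the l-parts q, s of \<open>m\<close>, \<open>p\<close>, and its
  order is a power of \<open>l\<close>.\<close>

lemma l_diagonal_le_sylow:
  fixes P :: "(complex ^ 'n::finite \<Rightarrow> complex ^ 'n) set"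
  assumes "prime l" "m > 0" "p dvd m" "sylow_subgroup l (G_group m p) P"
  shows "label_group (l ^ multiplicity l m) (l ^ multiplicity l p) (id :: 'n \<Rightarrow> 'n) \<subseteq> P"
proof -
  let ?q = "l ^ multiplicity l m" and ?s = "l ^ multiplicity l p"
  let ?N = "label_group ?q ?s (id :: 'n \<Rightarrow> 'n)"
  have q: "?q > 0"
    using assms(1) prime_gt_0_nat by simp
  have id: "label_perms (id :: 'n \<Rightarrow> 'n) UNIV = {id}"
    by (auto simp: label_perms_UNIV)
  have "card ?N = card (A_fun ?q ?s :: ('n \<Rightarrow> complex) set) * card (label_perms (id :: 'n \<Rightarrow> 'n) UNIV)"
    by (rule card_label_group[OF q])
  also have "\<dots> = ?q ^ (CARD('n) - 1) * (?q div ?s)"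
    unfolding id card_A_fun[OF q l_part_dvd(1)[OF assms(1,2,3)]] by simp
  also have "?q div ?s = l ^ multiplicity l (m div p)"
    using l_part_dvd(3)[OF assms(1,2,3)] prime_gt_0_nat[OF assms(1)] by (simp add: power_add)
  finally have card: "card ?N = l ^ (multiplicity l m * (CARD('n) - 1) + multiplicity l (m div p))"
    by (simp only: power_add power_mult)
  show ?thesis
  proof (rule normal_prime_power_le_sylow_subgroup[OF assms(1) _ _ _ _ _ card assms(4)])
    show "subgroup (G_group m p :: (complex ^ 'n \<Rightarrow> complex ^ 'n) set) GL"
      using subgroup_label_group[OF assms(2)] by (simp add: G_group_eq)
    show "finite (G_group m p :: (complex ^ 'n \<Rightarrow> complex ^ 'n) set)"
      using finite_label_group[OF assms(2)] by (simp add: G_group_eq)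
    show "subgroup ?N GL"
      using subgroup_label_group[OF q] .
    show "?N \<subseteq> G_group m p"
      unfolding G_group_eq
      by (intro label_group_mono A_fun_mono l_part_dvd[OF assms(1,2,3)] multiplicity_dvd refl)
    fix g h :: "complex ^ 'n \<Rightarrow> complex ^ 'n" assume "g \<in> G_group m p" "h \<in> ?N"
    then obtain \<eta> \<pi> \<theta> where g: "g = monomial_map \<eta> \<pi>" "\<eta> \<in> A_fun m p" "bij \<pi>" and h: "h = monomial_map \<theta> id" "\<theta> \<in> A_fun ?q ?s"
      unfolding G_group_eq by (auto simp: label_group_def monomial_set_def id) (auto simp: label_perms_UNIV)
    have nz: "\<eta> i \<noteq> 0" for i
      using g(2) by (rule A_fun_nonzero[OF assms(2)])
    \<comment> \<open>Diagonal entries commute, so those of \<open>g\<close> cancel and only a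
      permutation of the entries of \<open>h\<close> remains.\<close>
    have cancel: "(\<lambda>i. \<eta> i * \<theta> (inv_into UNIV \<pi> i) * inverse (\<eta> i)) = (\<lambda>i. \<theta> (inv_into UNIV \<pi> i))"
      using nz by (simp add: fun_eq_iff)
    have "g \<circ> h \<circ> inv\<^bsub>GL\<^esub> g = monomial_map (\<lambda>i. \<theta> (inv_into UNIV \<pi> i)) id"
      using g(1,3) h(1) nz cancel
      by (simp add: GL_inv_monomial_map monomial_map_comp bij_imp_bij_inv bij_is_surj surj_f_inv_f surj_iff[THEN iffD1])
    moreover have "(\<lambda>i. \<theta> (inv_into UNIV \<pi> i)) \<in> A_fun ?q ?s"
      using h(2) prod_comp_bij[OF bij_imp_bij_inv[OF g(3)], of \<theta>] by (simp add: A_fun_def)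
    ultimately show "g \<circ> h \<circ> inv\<^bsub>GL\<^esub> g \<in> ?N"
      by (simp add: label_group_def id monomial_setI)
  qed
qed

lemma multiplicity_power_self:
  "prime (l :: nat) \<Longrightarrow> multiplicity l (l ^ a) = a"
  by (simp add: multiplicity_same_power prime_gt_1_nat prime_gt_0_nat)

text \<open>Passing to l-parts keeps the l-part of the diagonal order, so only the permutation part
  has to match \<open>n!\<close>.\<close>

lemma label_group_contains_sylow:
  fixes d :: "'n::finite \<Rightarrow> 'r"
  assumes "prime l" "m > 0" "p dvd m"
    and "multiplicity l (card (label_perms d (UNIV :: 'n set))) = multiplicity l (fact CARD('n) :: nat)"
  shows "contains_sylow l (G_group m p) (label_group (l ^ multiplicity l m) (l ^ multiplicity l p) d)"
proof (rule contains_sylowI[OF assms(1)])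
  let ?q = "l ^ multiplicity l m" and ?s = "l ^ multiplicity l p"
  have q: "?q > 0"
    using assms(1) prime_gt_0_nat by simp
  show "subgroup (label_group ?q ?s d) GL" "finite (label_group ?q ?s d)"
    using subgroup_label_group[OF q] finite_label_group[OF q] by auto
  show "label_group ?q ?s d \<subseteq> G_group m p"
    unfolding G_group_eq
    by (intro label_group_mono A_fun_mono l_part_dvd[OF assms(1,2,3)] multiplicity_dvd refl)
  have "card (label_perms (\<lambda>_. ()) (UNIV :: 'n set)) = fact CARD('n)"
    using card_permutations[of "UNIV :: 'n set", OF refl] by (simp add: label_perms_def)
  then show "multiplicity l (card (label_group ?q ?s d)) =
      multiplicity l (card (G_group m p :: (complex ^ 'n \<Rightarrow> complex ^ 'n) set))"
    unfolding G_group_eq multiplicity_card_label_group[OF assms(1,2,3)]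
      multiplicity_card_label_group[OF assms(1) q l_part_dvd(1)[OF assms(1,2,3)]]
    by (simp add: multiplicity_power_self[OF assms(1)] assms(4))
qed


section \<open>Adjusting determinants by roots of unity\<close>

lemma power_eq_of_cong:
  fixes z :: complex
  assumes "z ^ m = 1" "[a = b] (mod m)"
  shows "z ^ a = z ^ b"
proof -
  have "z ^ a = z ^ (a mod m)" for a
  proof -
    have "z ^ a = (z ^ m) ^ (a div m) * z ^ (a mod m)"
      by (simp flip: power_mult power_add)
    then show ?thesis
      using assms(1) by simp
  qed
  then show ?thesis
    using assms(2) by (metis cong_def)
qed

text \<open>As \<open>r\<close> is invertible modulo \<open>p\<close>, a suitable power of
  \<open>w\<close> serves as \<open>z\<close>. In the application \<open>w\<close> is the
  determinant of a diagonal map and \<open>r\<close> the size of a block.\<close>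

lemma exists_root_scaling:
  fixes w :: complex
  assumes "p > 0" "p dvd m" "w ^ m = 1" "coprime r p"
  shows "\<exists>z. z ^ m = 1 \<and> (w * z ^ r) ^ (m div p) = 1"
proof -
  obtain x where "[r * x = Suc 0] (mod p)"
    using cong_solve_coprime_nat[OF assms(4)] by blast
  then have "[1 + r * x * (p - 1) = 1 + Suc 0 * (p - 1)] (mod p)"
    by (intro cong_add cong_mult) auto
  then have "p dvd 1 + r * x * (p - 1)"
    using assms(1) by (simp add: cong_dvd_iff)
  then obtain y where y: "1 + r * x * (p - 1) = p * y"
    by blast
  \<comment> \<open>The exponent \<open>p - 1\<close> represents -1 modulo \<open>p\<close> and
    \<open>x\<close> inverts \<open>r\<close>, so the exponent of \<open>w\<close> in
    \<open>w * z ^ r\<close> is divisible by \<open>p\<close>.\<close>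
  define z where "z = w ^ (x * (p - 1))"
  have "w * z ^ r = w ^ (1 + r * x * (p - 1))"
    by (simp add: z_def mult_ac flip: power_mult)
  also have "\<dots> = w ^ (p * y)"
    by (simp only: y)
  finally have "(w * z ^ r) ^ (m div p) = (w ^ (p * (m div p))) ^ y"
    by (simp add: mult_ac flip: power_mult)
  then have "(w * z ^ r) ^ (m div p) = 1"
    using assms(2,3) by simp
  moreover have "z ^ m = (w ^ m) ^ (x * (p - 1))"
    by (simp add: z_def mult.commute flip: power_mult)
  ultimately show ?thesis
    using assms(3) by auto
qed

text \<open>Scalars change the determinant by \<open>n\<close>-th powers and diagonal maps of \<open>l\<close>-power order normalise
  the group, so only the exponent modulo \<open>gcd (p / l\<^bsup>\<nu>(p)\<^esup>) n\<close> survives.\<close>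

lemma exists_reduced_exponent:
  fixes \<zeta> :: complex and l m n p :: nat
  assumes "prime l" "m > 0" "p dvd m" "n > 0" "\<zeta> ^ m = 1"
  shows "\<exists>j v y. j \<le> gcd (p div l ^ multiplicity l p) n - 1 \<and> v ^ m = 1 \<and> y ^ (l ^ multiplicity l m) = 1 \<and>
    (\<zeta> ^ J * inverse (\<zeta> ^ j) * v ^ n * y) ^ (m div p) = 1"
proof -
  define s where "s = l ^ multiplicity l p"
  define q where "q = l ^ multiplicity l m"
  define p' where "p' = p div s"
  define M where "M = m div q"
  define g where "g = gcd p' n"
  have p: "p = p' * s"
    unfolding p'_def s_def by (simp add: multiplicity_dvd)
  have M: "m = M * q"
    unfolding M_def q_def by (simp add: multiplicity_dvd)
  have "p > 0"
    using assms(2,3) by (auto intro: dvd_pos_nat)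
  have "\<not> l dvd M"
    unfolding M_def q_def using assms(1,2) by (intro multiplicity_decompose) (auto simp: not_prime_unit)
  then have "coprime M l"
    using assms(1) by (metis coprime_commute prime_imp_coprime)
  then have "coprime M s"
    by (simp add: s_def)
  \<comment> \<open>\<open>M\<close> is the l-free part of \<open>m\<close>. Multiplying an exponent
    by \<open>M * t\<close> turns an m-th root of unity into a q-th one, yet keeps the exponent
    modulo \<open>s\<close>.\<close>
  then obtain t where t: "[M * t = 1] (mod s)"
    using cong_solve_coprime_nat by auto
  have "g > 0"
    using assms(4) by (simp add: g_def)
  obtain x y0 where xy: "n * x = p' * y0 + g"
    using bezout_nat[of n p'] assms(4) by (auto simp: g_def gcd.commute)
  define \<gamma> where "\<gamma> = \<zeta> ^ (J div g)"
  have \<gamma>: "\<gamma> ^ m = 1"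
    using assms(5) by (simp add: \<gamma>_def mult.commute[of "J div g"] power_mult flip: power_mult[of _ "J div g"])
  then have \<gamma>0: "\<gamma> \<noteq> 0" and \<zeta>0: "\<zeta> \<noteq> 0"
    using root_of_unity_nonzero assms(2,5) by auto
  \<comment> \<open>Splitting off the remainder \<open>j\<close> leaves \<open>\<gamma> ^ g\<close>.
    By Bezout \<open>v ^ n\<close> cancels it at the cost of the inverse of
    \<open>\<gamma> ^ (p' * y0)\<close>, and \<open>y\<close> imitates the latter power by an
    element of l-power order.\<close>
  define j where "j = J mod g"
  define v where "v = inverse (\<gamma> ^ x)"
  define y where "y = \<gamma> ^ (p' * y0 * (M * t))"
  have \<zeta>J: "\<zeta> ^ J = \<zeta> ^ j * \<gamma> ^ g"
    unfolding j_def \<gamma>_def by (simp flip: power_mult power_add)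
  have "v ^ n = inverse (\<gamma> ^ (n * x))"
    by (simp add: v_def power_inverse mult.commute flip: power_mult)
  also have "\<dots> = inverse (\<gamma> ^ (p' * y0)) * inverse (\<gamma> ^ g)"
    by (simp add: xy power_add)
  finally have prod_eq: "\<zeta> ^ J * inverse (\<zeta> ^ j) * v ^ n * y = inverse (\<gamma> ^ (p' * y0)) * y"
    using \<gamma>0 \<zeta>0 by (simp add: \<zeta>J field_simps)
  have y_power: "y ^ (m div p) = (\<gamma> ^ (p' * y0)) ^ (m div p)"
  proof -
    \<comment> \<open>Since \<open>p' * (m div p) * s = m\<close>, the congruence modulo
      \<open>s\<close> becomes one modulo \<open>m\<close>, as needed for exponents of
      \<open>\<gamma>\<close>.\<close>
    have "[p' * (m div p) * (M * t) = p' * (m div p) * 1] (mod (p' * (m div p) * s))"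
      by (rule cong_cmult_leftI[OF t])
    moreover have "p' * (m div p) * s = m"
      using assms(3) p by (metis dvd_mult_div_cancel mult.assoc mult.commute)
    ultimately have "[p' * (m div p) * (M * t) * y0 = p' * (m div p) * 1 * y0] (mod m)"
      by (intro cong_scalar_right) simp
    from power_eq_of_cong[OF \<gamma> this] show ?thesis
      by (simp add: y_def mult_ac flip: power_mult)
  qed
  have "(\<zeta> ^ J * inverse (\<zeta> ^ j) * v ^ n * y) ^ (m div p) = 1"
    unfolding prod_eq power_mult_distrib y_power using \<gamma>0 by (simp add: power_inverse)
  moreover have "y ^ q = (\<gamma> ^ m) ^ (p' * y0 * t)"
    by (simp add: y_def M mult_ac flip: power_mult)
  then have "y ^ q = 1"
    using \<gamma> by simp
  moreover have "v ^ m = inverse ((\<gamma> ^ m) ^ x)"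
    by (simp add: v_def power_inverse mult.commute flip: power_mult)
  then have "v ^ m = 1"
    using \<gamma> by simp
  moreover have "j \<le> g - 1"
    using \<open>g > 0\<close> mod_less_divisor[of g J] unfolding j_def by linarith
  ultimately show ?thesis
    unfolding g_def p'_def s_def q_def by blast
qed

section \<open>Roots of unity as powers of an exponential\<close>

lemma root_of_unity_exp:
  fixes \<alpha> :: complex
  assumes "m > 0" "\<alpha> ^ m = 1"
  shows "\<exists>J. \<alpha> = exp (2 * of_real pi * \<i> / of_nat m) ^ J"
proof -
  obtain J where "\<alpha> = exp (2 * of_real pi * \<i> * of_nat J / of_nat m)"
    using complex_roots_unity[of m] assms by auto
  then have "\<alpha> = exp (2 * of_real pi * \<i> / of_nat m) ^ J"
    by (simp add: mult_ac flip: exp_of_nat_mult)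
  then show ?thesis ..
qed

lemma primitive_root_power_eq_1:
  assumes "q > 0" "exp (2 * of_real pi * \<i> / of_nat q :: complex) ^ x = 1"
  shows "q dvd x"
proof -
  have "exp (2 * of_real pi * \<i> * of_nat x / of_nat q :: complex) = 1"
    using assms(2) by (simp add: mult_ac flip: exp_of_nat_mult)
  then show ?thesis
    using complex_root_unity_eq_1[of q x] assms(1) by simp
qed


section \<open>The two cases\<close>

text \<open>When \<open>l\<close> divides \<open>p\<close>, the diagonal \<open>l\<close>-elements have entries of order not dividing \<open>m / p\<close>, while
  the determinants of the components of \<open>K\<close> have order dividing \<open>m / p\<close>; so \<open>K\<close> has one component.\<close>

lemma sylow_reflection_subgroup_connected:
  fixes K :: "(complex ^ 'n::finite \<Rightarrow> complex ^ 'n) set" and c :: "'n \<Rightarrow> 'r"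
  assumes "prime l" "m > 0" "p dvd m" "l dvd p"
    and diag: "label_group (l ^ multiplicity l m) (l ^ multiplicity l p) (id :: 'n \<Rightarrow> 'n) \<subseteq> K"
    and K: "K \<subseteq> monomial_set {\<theta>. (\<forall>i. \<theta> i ^ m = 1) \<and> (\<forall>r. (\<Prod>i | c i = r. \<theta> i) ^ (m div p) = 1)} (label_perms c UNIV)"
  shows "c i = c j"
proof (rule ccontr)
  assume ne: "c i \<noteq> c j"
  then have "i \<noteq> j"
    by auto
  let ?q = "l ^ multiplicity l m" and ?s = "l ^ multiplicity l p"
  have q: "?q > 0"
    using assms(1) prime_gt_0_nat by simp
  define \<omega> where "\<omega> = exp (2 * of_real pi * \<i> / of_nat ?q :: complex)"
  have \<omega>: "\<omega> ^ ?q = 1"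
    using complex_root_unity[of ?q 1] q by (simp add: \<omega>_def)
  then have "\<omega> \<noteq> 0"
    using q by (rule root_of_unity_nonzero)
  \<comment> \<open>The total product is 1, so this diagonal map lies in \<open>K\<close>; but its
    product over the component of \<open>i\<close> is \<open>\<omega>\<close>, of order
    \<open>?q\<close>.\<close>
  let ?\<theta> = "(\<lambda>_. 1)(i := \<omega>, j := inverse \<omega>)"
  have "?\<theta> \<in> A_fun ?q ?s"
    using \<omega> \<open>\<omega> \<noteq> 0\<close> prod_two_updates[OF finite \<open>i \<noteq> j\<close>, where C = UNIV]
    by (auto simp: A_fun_def power_inverse)
  then have "monomial_map ?\<theta> id \<in> label_group ?q ?s (id :: 'n \<Rightarrow> 'n)"
    unfolding label_group_def by (rule monomial_setI) (simp add: label_perms_UNIV)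
  then have "monomial_map ?\<theta> id \<in> monomial_set {\<theta>. (\<forall>i. \<theta> i ^ m = 1) \<and> (\<forall>r. (\<Prod>i | c i = r. \<theta> i) ^ (m div p) = 1)}
      (label_perms c UNIV)"
    using diag K by blast
  then obtain \<theta> \<pi> where \<theta>: "monomial_map ?\<theta> id = monomial_map \<theta> \<pi>" "\<pi> \<in> label_perms c UNIV"
      "\<forall>r. (\<Prod>i | c i = r. \<theta> i) ^ (m div p) = 1"
    unfolding monomial_set_def by blast
  have "?\<theta> = \<theta>"
    using \<theta>(2) \<open>\<omega> \<noteq> 0\<close> by (intro monomial_map_inject(2)[OF \<theta>(1)]) (auto simp: label_perms_UNIV)
  then have "(\<Prod>x | c x = c i. ?\<theta> x) ^ (m div p) = 1"
    using \<theta>(3) by blast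
  then have "\<omega> ^ (m div p) = 1"
    using ne prod_two_updates[OF _ \<open>i \<noteq> j\<close>, where C = "{x. c x = c i}"] by simp
  then have dvd: "?q dvd m div p"
    unfolding \<omega>_def by (rule primitive_root_power_eq_1[OF q])
  have "p > 0" "m div p > 0"
    using assms(2,3) by (auto intro: dvd_pos_nat elim!: dvdE)
  then have "multiplicity l m \<le> multiplicity l (m div p)"
    using dvd prime_gt_1_nat[OF assms(1)] by (simp add: power_dvd_iff_le_multiplicity)
  moreover have "multiplicity l p > 0"
    using assms(1,4) \<open>p > 0\<close> by (simp add: prime_multiplicity_gt_zero_iff)
  ultimately show False
    using l_part_dvd(3)[OF assms(1,2,3)] by simp
qed

text \<open>\<open>K\<close> contains the conjugate of G(q,s,n) by some diagonal \<open>D\<close>,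
  with q, s the l-parts of \<open>m\<close>, \<open>p\<close>. Up to the admissible changes, the
  determinant of \<open>D\<close> selects an \<alpha> such that \<open>D\<close> can be replaced by
  an element of G(m,p,n) times \<theta>_\<alpha>.\<close>

lemma sylow_reflection_classes_dividing:
  fixes e1 :: "'n::finite"
  assumes "prime l" "m > 0" "p dvd m" "l dvd p"
  shows "sylow_reflection_classes l (G_group m p :: (complex ^ 'n \<Rightarrow> complex ^ 'n) set) =
    {conjugacy_class (G_group m p)
       (conjugate_subgroup (diag_map ((\<lambda>_. 1)(e1 := \<alpha>)))
          (G_group (l ^ multiplicity l m) (l ^ multiplicity l p))) | \<alpha>.
     \<alpha> \<in> {exp (2 * of_real pi * \<i> / of_nat m) ^ j | j :: nat.
            j \<le> gcd (p div l ^ multiplicity l p) CARD('n) - 1}}"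
proof -
  let ?q = "l ^ multiplicity l m" and ?s = "l ^ multiplicity l p"
  let ?G = "G_group m p :: (complex ^ 'n \<Rightarrow> complex ^ 'n) set"
  let ?L = "G_group ?q ?s :: (complex ^ 'n \<Rightarrow> complex ^ 'n) set"
  let ?\<theta> = "\<lambda>\<alpha>. (\<lambda>_. 1)(e1 := \<alpha>) :: 'n \<Rightarrow> complex"
  define \<zeta> where "\<zeta> = exp (2 * of_real pi * \<i> / of_nat m :: complex)"
  have \<zeta>: "\<zeta> ^ m = 1"
    using complex_root_unity[of m 1] assms(2) by (simp add: \<zeta>_def)
  have roots: "(\<zeta> ^ j) ^ m = 1" for j
    using \<zeta> by (metis mult.commute power_mult power_one)
  have q: "?q > 0"
    using assms(1) prime_gt_0_nat by simp
  have G: "subgroup ?G GL" "finite ?G"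
    using subgroup_label_group[OF assms(2)] finite_label_group[OF assms(2)] by (simp_all add: G_group_eq)
  have L: "subgroup ?L GL" "finite ?L"
    using subgroup_label_group[OF q] finite_label_group[OF q] by (simp_all add: G_group_eq)
  have LG: "?L \<subseteq> ?G"
    unfolding G_group_eq
    by (intro label_group_mono A_fun_mono l_part_dvd[OF assms(1,2,3)] multiplicity_dvd refl)
  have reflL: "reflection_subgroup ?G ?L"
    using LG unfolding G_group_eq by (intro reflection_subgroup_label_group q) auto
  have \<theta>GL: "diag_map (?\<theta> \<alpha>) \<in> carrier GL" if "\<alpha> \<noteq> 0" for \<alpha>
    using that by (intro diag_map_in_GL) auto
  show ?thesis
    unfolding \<zeta>_def[symmetric]
  proof (rule sylow_reflection_classes_eq[OF G, where N = "card ?L"])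
    fix \<alpha> assume "\<alpha> \<in> {\<zeta> ^ j | j. j \<le> gcd (p div ?s) CARD('n) - 1}"
    then have \<alpha>: "\<alpha> ^ m = 1"
      using roots by auto
    then have \<alpha>0: "\<alpha> \<noteq> 0"
      using assms(2) by (rule root_of_unity_nonzero)
    have "?\<theta> \<alpha> i ^ m = 1" for i
      using \<alpha> by simp
    from conjugate_label_group_eq[OF assms(2) this, where v = "\<lambda>_. 1" and d = "\<lambda>_. ()" and s = p]
    have "conjugate_subgroup (diag_map (?\<theta> \<alpha>)) ?G = ?G"
      by (simp add: G_group_eq del: fun_upd_apply)
    then show refl: "reflection_subgroup ?G (conjugate_subgroup (diag_map (?\<theta> \<alpha>)) ?L)"
      using conjugate_reflection_subgroup[OF G(1) \<theta>GL[OF \<alpha>0] _ reflL] by simp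
    show card: "card (conjugate_subgroup (diag_map (?\<theta> \<alpha>)) ?L) = card ?L"
      by (rule card_conjugate_subgroup[OF \<theta>GL[OF \<alpha>0]])
    show "contains_sylow l ?G (conjugate_subgroup (diag_map (?\<theta> \<alpha>)) ?L)"
    proof (rule contains_sylowI[OF assms(1)])
      show "multiplicity l (card (conjugate_subgroup (diag_map (?\<theta> \<alpha>)) ?L)) = multiplicity l (card ?G)"
        unfolding card
        unfolding G_group_eq multiplicity_card_label_group[OF assms(1,2,3)]
          multiplicity_card_label_group[OF assms(1) q l_part_dvd(1)[OF assms(1,2,3)]]
        by (simp add: multiplicity_power_self[OF assms(1)])
    qed (use refl L(2) in \<open>auto simp: reflection_subgroup_def conjugate_subgroup_image\<close>)
  next
    fix K assume K: "reflection_subgroup ?G K" "contains_sylow l ?G K"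
    then have KGL: "subgroup K GL"
      by (simp add: reflection_subgroup_def)
    obtain c :: "'n \<Rightarrow> 'n" and D :: "'n \<Rightarrow> complex" where cD: "\<And>i. D i ^ m = 1"
        "\<And>i j. i \<noteq> j \<Longrightarrow> c i = c j \<Longrightarrow> swap_map i j (D j / D i) \<in> K"
        "K \<subseteq> monomial_set {\<theta>. (\<forall>i. \<theta> i ^ m = 1) \<and> (\<forall>r. (\<Prod>i | c i = r. \<theta> i) ^ (m div p) = 1)} (label_perms c UNIV)"
      by (rule reflection_subgroup_structure[OF assms(2) K(1)]) (rule that; assumption)
    have D0: "D i \<noteq> 0" for i
      using cD(1) assms(2) by (rule root_of_unity_nonzero)
    have diag: "label_group ?q ?s (id :: 'n \<Rightarrow> 'n) \<subseteq> K"
      using K(2) l_diagonal_le_sylow[OF assms(1,2,3)] unfolding contains_sylow_def by blast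
    have "c i = c j" for i j
      by (rule sylow_reflection_subgroup_connected[OF assms diag cD(3)])
    then have le: "conjugate_subgroup (diag_map D) ?L \<subseteq> K"
      unfolding G_group_eq by (intro conjugate_label_group_le[OF KGL D0 cD(2) diag]) auto
    have "(\<Prod>i\<in>UNIV. D i) ^ m = 1"
      by (simp add: cD(1) prod_power_distrib)
    then obtain J where J: "(\<Prod>i\<in>UNIV. D i) = \<zeta> ^ J"
      using root_of_unity_exp[OF assms(2)] unfolding \<zeta>_def by blast
    obtain j v y where jvy: "j \<le> gcd (p div ?s) CARD('n) - 1" "v ^ m = 1" "y ^ ?q = 1"
        "(\<zeta> ^ J * inverse (\<zeta> ^ j) * v ^ CARD('n) * y) ^ (m div p) = 1"
      using exists_reduced_exponent[OF assms(1,2,3) _ \<zeta>, of "CARD('n)" J] by auto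
    have v0: "v \<noteq> 0" and \<zeta>0: "\<zeta> ^ j \<noteq> 0"
      using root_of_unity_nonzero[OF _ assms(2)] jvy(2) roots by blast+
    have ym: "y ^ m = 1"
      using jvy(3) multiplicity_dvd[of l m] by (metis dvdE power_mult power_one)
    \<comment> \<open>\<open>H\<close> is the altered \<open>D\<close> divided by \<theta>_\<alpha>
      for \<alpha> = \<open>\<zeta> ^ j\<close>. The choice of \<open>j\<close>, \<open>v\<close>,
      \<open>y\<close> puts \<open>H\<close> into G(m,p,n), while the scalar \<open>v\<close> and
      the entry \<open>y\<close> at \<open>e1\<close> leave the conjugate unchanged.\<close>
    define H where "H i = D i * ((?\<theta> y i * v) * ?\<theta> (inverse (\<zeta> ^ j)) i)" for i
    have "(\<Prod>i\<in>UNIV. H i) = \<zeta> ^ J * inverse (\<zeta> ^ j) * v ^ CARD('n) * y"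
      by (simp add: H_def prod.distrib J prod_one_update[where C = UNIV] mult_ac del: fun_upd_apply)
    moreover have "H i ^ m = 1" for i
      using cD(1) ym jvy(2) roots[of j] by (simp add: H_def power_mult_distrib power_inverse)
    ultimately have "H \<in> A_fun m p"
      using jvy(4) by (simp add: A_fun_def)
    then have HG: "diag_map H \<in> ?G"
      unfolding G_group_eq diag_map_eq label_group_def
      by (rule monomial_setI) (simp add: label_perms_UNIV)
    have "(\<lambda>i. H i * ?\<theta> (\<zeta> ^ j) i) = (\<lambda>i. D i * (?\<theta> y i * v))"
      using \<zeta>0 by (auto simp: H_def)
    then have "diag_map H \<circ> diag_map (?\<theta> (\<zeta> ^ j)) = diag_map (\<lambda>i. D i * (?\<theta> y i * v))"
      by (simp only: diag_map_comp)
    then have "conjugate_subgroup (diag_map H) (conjugate_subgroup (diag_map (?\<theta> (\<zeta> ^ j))) ?L) =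
        conjugate_subgroup (diag_map (\<lambda>i. D i * (?\<theta> y i * v))) ?L"
      using conjugate_subgroup_comp[OF subgroup.mem_carrier[OF G(1) HG] \<theta>GL[OF \<zeta>0]] by metis
    also have "\<dots> = conjugate_subgroup (diag_map D) ?L"
      unfolding G_group_eq
      using jvy(3) v0 D0 by (intro conjugate_label_group_cong[OF q, where u = "?\<theta> y" and v = "\<lambda>_. v"]) auto
    finally show "\<exists>\<alpha>\<in>{\<zeta> ^ j | j. j \<le> gcd (p div ?s) CARD('n) - 1}. \<exists>g\<in>?G.
        conjugate_subgroup g (conjugate_subgroup (diag_map (?\<theta> \<alpha>)) ?L) \<subseteq> K"
      using HG le jvy(1) by blast
  qed
qed

section \<open>The case where l does not divide p\<close>

lemma card_subgroup_dvd:
  fixes T :: "(complex ^ 'n::finite \<Rightarrow> complex ^ 'n) set"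
  assumes "subgroup S GL" "subgroup T GL" "S \<subseteq> T"
  shows "card S dvd card T"
proof -
  interpret T: group "GL\<lparr>carrier := T\<rparr>"
    using GL.subgroup_imp_group[OF assms(2)] .
  have "card T = card (rcosets\<^bsub>GL\<lparr>carrier := T\<rparr>\<^esub> S) * card S"
    using T.lagrange[OF GL.subgroup_incl[OF assms]] by (simp add: order_def)
  then show ?thesis
    by simp
qed

lemma sylow_reflection_classes_not_dividing:
  fixes P :: "'n::finite set set"
  assumes "prime l" "m > 0" "p dvd m" "\<not> l dvd p"
    and n: "CARD('n) = (\<Sum>i\<le>k. b i * l ^ i)" "\<forall>i\<le>k. b i < l"
    and P: "block_partition l k b UNIV P"
  shows "sylow_reflection_classes l (G_group m p) =
    {conjugacy_class (G_group m p) (block_product (l ^ multiplicity l m) P)}"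
proof -
  let ?q = "l ^ multiplicity l m"
  let ?G = "G_group m p :: (complex ^ 'n \<Rightarrow> complex ^ 'n) set"
  let ?L = "\<lambda>P :: 'n set set. label_group ?q 1 (block_of P)"
  have s: "l ^ multiplicity l p = 1"
    using assms(4) by (simp add: not_dvd_imp_multiplicity_0)
  have l: "l > 1"
    using assms(1) prime_gt_1_nat by blast
  have q: "?q > 0"
    using l by simp
  have p: "p > 0"
    using assms(2,3) by (auto intro: dvd_pos_nat)
  have G: "subgroup ?G GL" "finite ?G"
    using subgroup_label_group[OF assms(2)] finite_label_group[OF assms(2)] by (simp_all add: G_group_eq)
  have LG: "?L P \<subseteq> ?G"
    unfolding G_group_eq s[symmetric]
    by (intro label_group_mono A_fun_mono l_part_dvd[OF assms(1,2,3)] multiplicity_dvd refl)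
  have part: "partition_on UNIV P"
    using P by (simp add: block_partition_def)
  have "sylow_reflection_classes l ?G = {conjugacy_class ?G (?L P) | t :: unit. t \<in> UNIV}"
  proof (rule sylow_reflection_classes_eq[OF G, where N = "card (?L P)"])
    show "reflection_subgroup ?G (?L P)"
      using LG by (intro reflection_subgroup_label_group q) auto
    show "contains_sylow l ?G (?L P)"
      using label_group_contains_sylow[OF assms(1,2,3) multiplicity_card_block_perms[OF finite assms(1) n P]]
      unfolding s .
    fix K assume K: "reflection_subgroup ?G K" "contains_sylow l ?G K"
    then have KGL: "subgroup K GL"
      by (simp add: reflection_subgroup_def)
    obtain c :: "'n \<Rightarrow> 'n" and D :: "'n \<Rightarrow> complex" where cD: "\<And>i. D i ^ m = 1"
        "\<And>i j. i \<noteq> j \<Longrightarrow> c i = c j \<Longrightarrow> swap_map i j (D j / D i) \<in> K"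
        "K \<subseteq> monomial_set {\<theta>. (\<forall>i. \<theta> i ^ m = 1) \<and> (\<forall>r. (\<Prod>i | c i = r. \<theta> i) ^ (m div p) = 1)} (label_perms c UNIV)"
      by (rule reflection_subgroup_structure[OF assms(2) K(1)]) (rule that; assumption)
    have D0: "D i \<noteq> 0" for i
      using cD(1) assms(2) by (rule root_of_unity_nonzero)
    obtain S where S: "sylow_subgroup l ?G S" "S \<subseteq> K"
      using K(2) by (auto simp: contains_sylow_def)
    have diag: "label_group ?q 1 (id :: 'n \<Rightarrow> 'n) \<subseteq> K"
      using S l_diagonal_le_sylow[OF assms(1,2,3) S(1)] unfolding s by blast
    \<comment> \<open>Multiplying the component conditions gives the global one. The order of this
      overgroup is known, and by Lagrange a Sylow subgroup inside \<open>K\<close> bounds its l-part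
      from below.\<close>
    have "K \<subseteq> label_group m p c"
    proof
      fix f assume "f \<in> K"
      then obtain \<theta> \<pi> where f: "f = monomial_map \<theta> \<pi>" "\<forall>i. \<theta> i ^ m = 1"
          "\<forall>r. (\<Prod>i | c i = r. \<theta> i) ^ (m div p) = 1" "\<pi> \<in> label_perms c UNIV"
        using subsetD[OF cD(3)] unfolding monomial_set_def by fast
      have "(\<Prod>i\<in>UNIV. \<theta> i) ^ (m div p) = 1"
      proof -
        have "(\<Prod>i\<in>UNIV. \<theta> i) = (\<Prod>r\<in>UNIV. \<Prod>i | c i = r. \<theta> i)"
          using prod.group[of "UNIV :: 'n set" "UNIV :: 'n set" c \<theta>] by simp
        then show ?thesis
          using f(3) by (simp add: prod_power_distrib)
      qed
      then have "\<theta> \<in> A_fun m p"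
        using f(2) by (simp add: A_fun_def)
      then show "f \<in> label_group m p c"
        using f(1,4) by (simp add: label_group_def monomial_setI)
    qed
    then have "S \<subseteq> label_group m p c"
      using S(2) by blast
    moreover have "subgroup S GL"
      using S(1) by (simp add: sylow_subgroup_def)
    ultimately have "card S dvd card (label_group m p c)"
      by (intro card_subgroup_dvd[OF _ subgroup_label_group[OF assms(2)]])
    then have "l ^ multiplicity l (card ?G) dvd card (label_group m p c)"
      using S(1) by (simp add: sylow_subgroup_def)
    moreover have "card (label_group m p c) \<noteq> 0"
      using subgroup.one_closed[OF subgroup_label_group[OF assms(2)], of p c] finite_label_group[OF assms(2), of p c]
      by (auto simp: card_eq_0_iff)
    ultimately have "multiplicity l (card ?G) \<le> multiplicity l (card (label_group m p c))"
      using l by (simp add: power_dvd_iff_le_multiplicity)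
    moreover have "card (label_perms (\<lambda>_. ()) (UNIV :: 'n set)) = fact CARD('n)"
      using card_permutations[of "UNIV :: 'n set", OF refl] by (simp add: label_perms_def)
    \<comment> \<open>The diagonal contributions to the two orders coincide and cancel.\<close>
    ultimately have "multiplicity l (fact CARD('n) :: nat) \<le> multiplicity l (card (label_perms c (UNIV :: 'n set)))"
      by (simp add: G_group_eq multiplicity_card_label_group[OF assms(1,2,3)])
    from block_partition_refining[OF finite assms(1) n this]
    obtain Q where Q: "block_partition l k b UNIV Q" "\<forall>B\<in>Q. \<forall>i\<in>B. \<forall>j\<in>B. c i = c j"
      by blast
    have partQ: "partition_on UNIV Q"
      using Q(1) by (simp add: block_partition_def)
    have "c i = c j" if "block_of Q i = block_of Q j" for i j
    proof -
      have "j \<in> block_of Q i"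
        using block_of_in(2)[OF partQ UNIV_I, of j] that by simp
      then show ?thesis
        using Q(2) block_of_in[OF partQ UNIV_I, of i] by blast
    qed
    then have le: "conjugate_subgroup (diag_map D) (?L Q) \<subseteq> K"
      by (intro conjugate_label_group_le[OF KGL D0 cD(2) diag])
    obtain e :: 'n where True
      by simp
    \<comment> \<open>Any block can correct the determinant: its size is a power of
      \<open>l\<close>, hence prime to \<open>p\<close>.\<close>
    define B where "B = block_of Q e"
    have BQ: "B \<in> Q"
      unfolding B_def by (rule block_of_in[OF partQ UNIV_I])
    then obtain i where "card B = l ^ i"
      using block_partition_sizes(1)[OF finite l n(1) Q(1)] by blast
    then have "coprime (card B) p"
      using prime_imp_coprime[OF assms(1,4)] by simp
    moreover have "(\<Prod>i\<in>UNIV. D i) ^ m = 1"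
      by (simp add: cD(1) prod_power_distrib)
    ultimately obtain z where z: "z ^ m = 1" "((\<Prod>i\<in>UNIV. D i) * z ^ card B) ^ (m div p) = 1"
      using exists_root_scaling[OF p assms(3)] by blast
    \<comment> \<open>Scaling only \<open>B\<close> by \<open>z\<close> multiplies the determinant
      by \<open>z ^ card B\<close> and, being constant on blocks, leaves the conjugate
      unchanged.\<close>
    define v where "v C = (if C = B then z else 1)" for C
    have z0: "z \<noteq> 0"
      using z(1) assms(2) by (rule root_of_unity_nonzero)
    define D' where "D' i = D i * (1 * v (block_of Q i))" for i
    have "(\<Prod>i\<in>UNIV. v (block_of Q i)) = (\<Prod>i\<in>UNIV. if i \<in> B then z else 1)"
      using block_of_eq[OF partQ BQ] block_of_in[OF partQ] by (intro prod.cong refl) (auto simp: v_def)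
    also have "\<dots> = z ^ card B"
      by (simp flip: prod.inter_filter)
    finally have "(\<Prod>i\<in>UNIV. D' i) = (\<Prod>i\<in>UNIV. D i) * z ^ card B"
      by (simp add: D'_def prod.distrib)
    moreover have "D' i ^ m = 1" for i
      using cD(1) z(1) by (simp add: D'_def v_def power_mult_distrib)
    ultimately have "D' \<in> A_fun m p"
      using z(2) by (simp add: A_fun_def)
    then have D'G: "diag_map D' \<in> ?G"
      unfolding G_group_eq diag_map_eq label_group_def
      by (rule monomial_setI) (simp add: label_perms_UNIV)
    have conjQ: "conjugate_subgroup (diag_map D') (?L Q) = conjugate_subgroup (diag_map D) (?L Q)"
      using D0 z0 by (intro conjugate_label_group_cong[OF q, where u = "\<lambda>_. 1" and v = v]) (auto simp: v_def D'_def)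
    obtain \<sigma> where \<sigma>: "bij \<sigma>" "\<And>i j. block_of Q (\<sigma> i) = block_of Q (\<sigma> j) \<longleftrightarrow> block_of P i = block_of P j"
      using block_partitions_isomorphic[OF l n(1) P Q(1)] by (auto simp: permutes_UNIV_iff)
    \<comment> \<open>The partition \<open>Q\<close> depends on \<open>K\<close>; a permutation
      matrix, itself in G(m,p,n), carries the prescribed \<open>P\<close> to it.\<close>
    let ?\<sigma> = "monomial_map (\<lambda>_. 1) \<sigma> :: complex ^ 'n \<Rightarrow> complex ^ 'n"
    have \<sigma>G: "?\<sigma> \<in> ?G"
      unfolding G_group_eq label_group_def using \<sigma>(1)
      by (intro monomial_setI) (auto simp: A_fun_def label_perms_UNIV)
    have "conjugate_subgroup (diag_map D' \<circ> ?\<sigma>) (?L P) = conjugate_subgroup (diag_map D') (conjugate_subgroup ?\<sigma> (?L P))"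
      using subgroup.mem_carrier[OF G(1)] D'G \<sigma>G by (intro conjugate_subgroup_comp)
    also have "\<dots> \<subseteq> conjugate_subgroup (diag_map D') (?L Q)"
      by (intro conjugate_subgroup_mono conjugate_label_group_perm[where e = "block_of Q" and d = "block_of P", OF \<sigma>])
    also have "\<dots> \<subseteq> K"
      using le conjQ by simp
    finally show "\<exists>t\<in>UNIV. \<exists>g\<in>?G. conjugate_subgroup g (?L P) \<subseteq> K"
      using subgroup_GL_comp[OF G(1) D'G \<sigma>G] by blast
  qed auto
  then show ?thesis
    using block_product_eq[OF q part] by simp
qed

theorem theorem4p1:
  fixes m p l k :: nat and b :: "nat \<Rightarrow> nat" and e1 :: "'n::finite"
  assumes "m > 1" and "CARD('n) > 1" and "p \<ge> 1" and "p dvd m"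
    and "prime l" and "l dvd card (G_group m p :: (complex ^ 'n \<Rightarrow> complex ^ 'n) set)"
    and "CARD('n) = (\<Sum>i\<le>k. b i * l ^ i)" and "\<forall>i\<le>k. b i < l" and "b k \<noteq> 0"
  shows
    "(l dvd p \<longrightarrow>
        sylow_reflection_classes l (G_group m p :: (complex ^ 'n \<Rightarrow> complex ^ 'n) set) =
        {conjugacy_class (G_group m p)
           (conjugate_subgroup (diag_map ((\<lambda>_. 1)(e1 := \<alpha>)))
              (G_group (l ^ multiplicity l m) (l ^ multiplicity l p))) | \<alpha>.
         \<alpha> \<in> {exp (2 * pi * \<i> * j / m) | j :: nat.
                j \<le> gcd (p div l ^ multiplicity l p) CARD('n) - 1}}) \<and>
     (\<not> l dvd p \<longrightarrow>
        (\<forall>P :: 'n set set. block_partition l k b UNIV P \<longrightarrow>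
           sylow_reflection_classes l (G_group m p) =
           {conjugacy_class (G_group m p) (block_product (l ^ multiplicity l m) P)}))"
proof (intro conjI impI allI)
  have "exp (2 * pi * \<i> * j / m) = exp (2 * of_real pi * \<i> / of_nat m) ^ j" for j :: nat
    by (simp add: mult_ac flip: exp_of_nat_mult)
  then show "sylow_reflection_classes l (G_group m p :: (complex ^ 'n \<Rightarrow> complex ^ 'n) set) =
      {conjugacy_class (G_group m p)
         (conjugate_subgroup (diag_map ((\<lambda>_. 1)(e1 := \<alpha>)))
            (G_group (l ^ multiplicity l m) (l ^ multiplicity l p))) | \<alpha>.
       \<alpha> \<in> {exp (2 * pi * \<i> * j / m) | j :: nat.
              j \<le> gcd (p div l ^ multiplicity l p) CARD('n) - 1}}" if "l dvd p"
    using sylow_reflection_classes_dividing[OF assms(5) _ assms(4) that, of e1] assms(1) by simp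
  show "sylow_reflection_classes l (G_group m p) =
      {conjugacy_class (G_group m p) (block_product (l ^ multiplicity l m) P)}"
    if "\<not> l dvd p" "block_partition l k b UNIV P" for P :: "'n set set"
    using sylow_reflection_classes_not_dividing[OF assms(5) _ assms(4) that(1) assms(7,8) that(2)] assms(1)
    by simp
qed

end
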